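(* Let $X$ be a complex Banach space and $T\in\mathcal{B}(X)$. Then: 1) a-Browder's theorem holds for $T$ if and only if $\sigma_{gD\mathcal{M}}(T)=\sigma_{gD\mathcal{W}+}(T)$. 2) a-Browder's theorem holds for $T^*$ if and only if $\sigma_{gD\mathcal{Q}}(T)=\sigma_{gD\mathcal{W}-}(T)$. 3) Browder's theorem holds for $T$ if and only if $\sigma_{gD}(T)=\sigma_{gD\mathcal{W}}(T)$.
   Context: $\mathcal{B}(X)$ is the algebra of bounded linear operators on $X$; $T^*$ is the adjoint of $T$ acting on the dual space; $N(T)$, $R(T)$ are kernel and range. $(M,N)\in Red(T)$ means that $M,N$ are closed $T$-invariant subspaces with $X=M\oplus N$. $T$ is upper semi-Fredholm if $\dim N(T)<\infty$ and $R(T)$ is closed; lower semi-Fredholm if $\operatorname{codim}R(T)<\infty$; Fredholm if both. The index is $ind(T)=\dim N(T)-\operatorname{codim}R(T)$. $T$ is upper semi-Weyl if it is upper semi-Fredholm with $ind(T)\le 0$, Weyl if it is Fredholm with $ind(T)=0$. The ascent is $a(T)=\min\{p: N(T^p)=N(T^{p+1})\}$ and the descent is $d(T)=\min\{q: R(T^q)=R(T^{q+1})\}$ ($\infty$ if no such integer exists). $T$ is upper semi-Browder if it is upper semi-Fredholm with $a(T)<\infty$, lower semi-Browder if it is lower semi-Fredholm with $d(T)<\infty$, Browder if both. $\sigma_{uW}(T),\sigma_W(T),\sigma_{uB}(T),\sigma_B(T)$ denote the sets of $\lambda\in\mathbb{C}$ such that $T-\lambda I$ is not upper semi-Weyl,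 Weyl, upper semi-Browder, Browder, respectively. Browder's theorem holds for $T$ if $\sigma_W(T)=\sigma_B(T)$; a-Browder's theorem holds for $T$ if $\sigma_{uW}(T)=\sigma_{uB}(T)$ (and likewise for $T^*$ in place of $T$). $T$ is generalized Drazin invertible (resp. generalized Drazin bounded below, generalized Drazin surjective, generalized Drazin upper semi-Weyl, generalized Drazin lower semi-Weyl, pseudo B-Weyl) if there exists $(M,N)\in Red(T)$ such that $T_{|N}$ is quasi-nilpotent and $T_{|M}$ is invertible (resp. bounded below, surjective, upper semi-Fredholm with index $\le 0$, lower semi-Fredholm with index $\ge 0$, Weyl). The corresponding spectra, i.e. the sets of $\lambda\in\mathbb{C}$ for which $T-\lambda I$ does not have the property, are denoted $\sigma_{gD}(T)$, $\sigma_{gD\mathcal{M}}(T)$, $\sigma_{gD\mathcal{Q}}(T)$, $\sigma_{gD\mathcal{W}+}(T)$, $\sigma_{gD\mathcal{W}-}(T)$, $\sigma_{gD\mathcal{W}}(T)$, respectively. *)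

theory Defs
  imports "HOL-Analysis.Analysis"
begin

section \<open>Complex Banach spaces\<close>

class complex_normed_vector = real_normed_vector +
  fixes scaleC :: "complex \<Rightarrow> 'a \<Rightarrow> 'a" (infixr \<open>*\<^sub>C\<close> 75)
  assumes scaleC_add_right: "c *\<^sub>C (x + y) = c *\<^sub>C x + c *\<^sub>C y"
    and scaleC_add_left: "(c + d) *\<^sub>C x = c *\<^sub>C x + d *\<^sub>C x"
    and scaleC_scaleC: "c *\<^sub>C d *\<^sub>C x = (c * d) *\<^sub>C x"
    and scaleC_one: "1 *\<^sub>C x = x"
    and scaleC_of_real: "complex_of_real r *\<^sub>C x = r *\<^sub>R x"
    and norm_scaleC: "norm (c *\<^sub>C x) = cmod c * norm x"

class complex_banach = complex_normed_vector + complete_space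

subclass (in complex_banach) banach ..

global_interpretation complex_vector:
  vector_space "scaleC :: complex \<Rightarrow> 'a \<Rightarrow> 'a::complex_normed_vector"
  defines csubspace = complex_vector.subspace
    and cspan = complex_vector.span
    and cdependent = complex_vector.dependent
    and cdim = complex_vector.dim
  by unfold_locales (simp_all add: scaleC_add_right scaleC_add_left scaleC_scaleC scaleC_one)

instantiation complex :: complex_banach
begin

definition scaleC_complex :: "complex \<Rightarrow> complex \<Rightarrow> complex"
  where "scaleC_complex c x = c * x"

instance
  by standard (auto simp: scaleC_complex_def algebra_simps norm_mult scaleR_conv_of_real)

end

lemma bounded_linear_scaleC: "bounded_linear (\<lambda>x::'a::complex_normed_vector. c *\<^sub>C x)"
proof (rule bounded_linear_intro[where K = "cmod c"])
  fix r :: real and x :: 'a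
  show "c *\<^sub>C r *\<^sub>R x = r *\<^sub>R c *\<^sub>C x"
    by (simp add: scaleC_of_real[symmetric] scaleC_scaleC mult.commute)
qed (simp_all add: scaleC_add_right norm_scaleC mult.commute)

instantiation blinfun :: (real_normed_vector, complex_normed_vector) complex_normed_vector
begin

definition scaleC_blinfun :: "complex \<Rightarrow> 'a \<Rightarrow>\<^sub>L 'b \<Rightarrow> 'a \<Rightarrow>\<^sub>L 'b"
  where "scaleC_blinfun c f = Blinfun (\<lambda>x. c *\<^sub>C blinfun_apply f x)"

lemma blinfun_apply_scaleC:
  "blinfun_apply (c *\<^sub>C f) x = c *\<^sub>C blinfun_apply f x" for f :: "'a \<Rightarrow>\<^sub>L 'b"
proof -
  have "bounded_linear (\<lambda>x. c *\<^sub>C blinfun_apply f x)"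
    by (rule bounded_linear_compose[OF bounded_linear_scaleC blinfun.bounded_linear_right])
  then show ?thesis
    by (simp add: scaleC_blinfun_def bounded_linear_Blinfun_apply)
qed

instance
proof
  fix c :: complex and f :: "'a \<Rightarrow>\<^sub>L 'b"
  have le: "norm (d *\<^sub>C g) \<le> cmod d * norm g" for d and g :: "'a \<Rightarrow>\<^sub>L 'b"
  proof (rule norm_blinfun_bound)
    fix x
    show "norm (blinfun_apply (d *\<^sub>C g) x) \<le> cmod d * norm g * norm x"
      using norm_blinfun[of g x]
      by (simp add: blinfun_apply_scaleC norm_scaleC mult.assoc mult_left_mono)
  qed simp
  show "norm (c *\<^sub>C f) = cmod c * norm f"
  proof (cases "c = 0")
    case True
    then show ?thesis using le[of c f] by simp
  next
    case False
    have "inverse c *\<^sub>C c *\<^sub>C f = f"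
      using False by (intro blinfun_eqI) (simp add: blinfun_apply_scaleC scaleC_scaleC scaleC_one)
    then have "norm f \<le> cmod (inverse c) * norm (c *\<^sub>C f)"
      using le[of "inverse c" "c *\<^sub>C f"] by simp
    then have "cmod c * norm f \<le> norm (c *\<^sub>C f)"
      using False by (simp add: norm_divide norm_inverse divide_simps mult.commute)
    then show ?thesis using le[of c f] by simp
  qed
qed (auto intro!: blinfun_eqI simp: blinfun_apply_scaleC scaleC_add_right scaleC_add_left
      scaleC_scaleC scaleC_one scaleC_of_real blinfun.add_left blinfun.scaleR_left)

end

section \<open>Operators on a subspace\<close>

text \<open>
  Operators are functions on the ambient type together with the closed complex subspace
  \<open>M\<close> on which they are considered, so the restriction of \<open>T\<close> to an invariant subspace
  \<open>M\<close> is \<open>T\<close> used with carrier \<open>M\<close>; the whole space is \<open>UNIV\<close>.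
  No notion below depends on the values of \<open>T\<close> outside its carrier.
\<close>

definition bounded_operators :: "'a::complex_normed_vector set \<Rightarrow> ('a \<Rightarrow> 'a) set"
  where "bounded_operators M = {T.
    (\<forall>x\<in>M. T x \<in> M) \<and>
    (\<forall>x\<in>M. \<forall>y\<in>M. T (x + y) = T x + T y) \<and>
    (\<forall>c. \<forall>x\<in>M. T (c *\<^sub>C x) = c *\<^sub>C T x) \<and>
    (\<exists>K. \<forall>x\<in>M. norm (T x) \<le> K * norm x)}"

definition shift :: "('a::complex_normed_vector \<Rightarrow> 'a) \<Rightarrow> complex \<Rightarrow> 'a \<Rightarrow> 'a"
  where "shift T l = (\<lambda>x. T x - l *\<^sub>C x)"

definition kernel :: "'a::complex_normed_vector set \<Rightarrow> ('a \<Rightarrow> 'a) \<Rightarrow> 'a set"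
  where "kernel M T = {x \<in> M. T x = 0}"

definition direct_sum ::
  "'a::complex_normed_vector set \<Rightarrow> 'a set \<Rightarrow> 'a set \<Rightarrow> bool"
  where "direct_sum X M N \<longleftrightarrow> M \<inter> N = {0} \<and> X = {m + n | m n. m \<in> M \<and> n \<in> N}"

text \<open>\<open>cdim\<close> is \<open>0\<close> on infinite-dimensional spaces; \<open>ccdim\<close> is \<open>\<infinity>\<close> there.\<close>

definition ccdim :: "'a::complex_normed_vector set \<Rightarrow> enat"
  where "ccdim V = (if \<exists>B. finite B \<and> V \<subseteq> cspan B then enat (cdim V) else \<infinity>)"

text \<open>
  The codimension of \<open>R\<close> in \<open>M\<close> is the dimension of an algebraic complement (which is isomorphic
  to the quotient of \<open>M\<close> by \<open>R\<close>); lemma \<open>ccodim_eq\<close> shows that the choice is immaterial.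
\<close>

definition ccodim :: "'a::complex_normed_vector set \<Rightarrow> 'a set \<Rightarrow> enat"
  where "ccodim M R = ccdim (SOME C. csubspace C \<and> direct_sum M R C)"

lemma ex_complement:
  assumes "csubspace R" "csubspace M" "R \<subseteq> M"
  shows "\<exists>C. csubspace C \<and> direct_sum M R C"
proof -
  obtain B where B: "B \<subseteq> R" "\<not> cdependent B" "R \<subseteq> cspan B"
    by (rule complex_vector.maximal_independent_subset[of R])
  have "B \<subseteq> M" using B(1) assms(3) by (rule subset_trans)
  then obtain B' where B': "B \<subseteq> B'" "B' \<subseteq> M" "\<not> cdependent B'" "M \<subseteq> cspan B'"
    using B(2) by (rule complex_vector.maximal_independent_subset_extend)
  have R: "R = cspan B"
    using B(3) complex_vector.span_minimal[OF B(1) assms(1)] by (rule subset_antisym)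
  have M: "M = cspan B'"
    using B'(4) complex_vector.span_minimal[OF B'(2) assms(2)] by (rule subset_antisym)
  have "B' = B \<union> (B' - B)" using B'(1) by blast
  then have "M = cspan (B \<union> (B' - B))" using M by metis
  also have "\<dots> = {m + n | m n. m \<in> R \<and> n \<in> cspan (B' - B)}"
    unfolding complex_vector.span_Un R[symmetric] ..
  finally have "M = {m + n | m n. m \<in> R \<and> n \<in> cspan (B' - B)}" .
  moreover have "R \<inter> cspan (B' - B) = {0}"
  proof -
    have "cspan B \<inter> cspan (B' - B) \<subseteq> {0}"
    proof
      fix x assume x: "x \<in> cspan B \<inter> cspan (B' - B)"
      have "complex_vector.representation B' x = complex_vector.representation B x"
        using complex_vector.representation_extend[OF B'(3), of x B] B'(1) x by blast
      moreover have "complex_vector.representation B' x = complex_vector.representation (B' - B) x"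
        using complex_vector.representation_extend[OF B'(3), of x "B' - B"] x by blast
      ultimately have "complex_vector.representation B' x b = 0" for b
        using complex_vector.representation_ne_zero[of B x b]
          complex_vector.representation_ne_zero[of "B' - B" x b] by force
      moreover have "x \<in> cspan B'"
        using x complex_vector.span_mono[OF B'(1)] by blast
      ultimately show "x \<in> {0}"
        using complex_vector.sum_nonzero_representation_eq[OF B'(3), of x] by simp
    qed
    then show ?thesis
      using R complex_vector.span_zero by auto
  qed
  ultimately show ?thesis
    unfolding direct_sum_def using complex_vector.subspace_span by blast
qed

lemma complement_ccdim_le:
  assumes C: "csubspace C" "direct_sum M R C" and D: "csubspace D" "direct_sum M R D"
    and R: "csubspace R"
  shows "ccdim C \<le> ccdim D"
proof (cases "\<exists>B. finite B \<and> D \<subseteq> cspan B")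
  case False
  then have "ccdim D = \<infinity>" unfolding ccdim_def by (rule if_not_P)
  then show ?thesis by simp
next
  case True
  then obtain F where F: "finite F" "D \<subseteq> cspan F" by blast
  obtain B where B: "B \<subseteq> D" "\<not> cdependent B" "D \<subseteq> cspan B" "card B = cdim D"
    by (rule complex_vector.basis_exists[of D])
  have finB: "finite B"
    using complex_vector.independent_span_bound[OF F(1) B(2)] B(1) F(2) by blast
  have "\<exists>c. c \<in> C \<and> b - c \<in> R" if "b \<in> B" for b
  proof -
    have "0 \<in> R" using R complex_vector.subspace_0 by blast
    then have "b \<in> M" using that B(1) D(2) unfolding direct_sum_def by force
    then show ?thesis using C(2) unfolding direct_sum_def by force
  qed
  then obtain p where p: "\<And>b. b \<in> B \<Longrightarrow> p b \<in> C \<and> b - p b \<in> R" by metis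
  have sub: "\<exists>c \<in> cspan (p ` B). x - c \<in> R" if "x \<in> cspan B" for x
    using that
  proof (induction rule: complex_vector.span_induct_alt)
    case base
    then show ?case
      using complex_vector.span_zero complex_vector.subspace_0[OF R] by force
  next
    case (step k b y)
    then obtain c where c: "c \<in> cspan (p ` B)" "y - c \<in> R" by blast
    have "k *\<^sub>C p b + c \<in> cspan (p ` B)"
      by (intro complex_vector.span_add[OF complex_vector.span_scale c(1)]
          complex_vector.span_base imageI step(1))
    moreover have "k *\<^sub>C (b - p b) + (y - c) \<in> R"
      using p[OF step(1)] c(2) R
      by (intro complex_vector.subspace_add complex_vector.subspace_scale) auto
    then have "k *\<^sub>C b + y - (k *\<^sub>C p b + c) \<in> R"
      by (simp add: complex_vector.scale_right_diff_distrib algebra_simps)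
    ultimately show ?case by blast
  qed
  have pC: "cspan (p ` B) \<subseteq> C"
    using p C(1) by (intro complex_vector.span_minimal) auto
  have CB: "C \<subseteq> cspan (p ` B)"
  proof
    fix x assume x: "x \<in> C"
    have "x \<in> M"
      using x C(2) complex_vector.subspace_0[OF R] unfolding direct_sum_def by force
    then obtain r d where rd: "r \<in> R" "d \<in> D" "x = r + d"
      using D(2) unfolding direct_sum_def by blast
    obtain c where c: "c \<in> cspan (p ` B)" "d - c \<in> R" using sub rd(2) B(3) by blast
    have "r + (d - c) \<in> R" using rd(1) c(2) R complex_vector.subspace_add by blast
    then have "x - c \<in> R" using rd(3) by (simp add: algebra_simps)
    moreover have "x - c \<in> C" using x c(1) pC C(1) complex_vector.subspace_diff by blast
    ultimately have "x = c" using C(2) unfolding direct_sum_def by force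
    then show "x \<in> cspan (p ` B)" using c(1) by simp
  qed
  have "cdim C \<le> card (p ` B)"
    using complex_vector.dim_le_card[OF CB] finB by blast
  also have "\<dots> \<le> cdim D" using card_image_le[OF finB, of p] B(4) by simp
  finally have "cdim C \<le> cdim D" .
  moreover have "\<exists>B. finite B \<and> C \<subseteq> cspan B" using CB finB by blast
  ultimately show ?thesis using True unfolding ccdim_def by simp
qed

lemma ccodim_eq:
  assumes "csubspace R" "csubspace C" "direct_sum M R C"
  shows "ccodim M R = ccdim C"
proof -
  define D where "D = (SOME C. csubspace C \<and> direct_sum M R C)"
  have D: "csubspace D \<and> direct_sum M R D"
    unfolding D_def by (rule someI[of _ C]) (use assms in blast)
  have "ccdim D = ccdim C"
    using D assms by (intro antisym complement_ccdim_le[where M = M and R = R]) auto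
  then show ?thesis unfolding ccodim_def D_def .
qed

section \<open>Fredholm, Weyl and Browder operators\<close>

definition upper_semi_Fredholm ::
  "'a::complex_normed_vector set \<Rightarrow> ('a \<Rightarrow> 'a) \<Rightarrow> bool"
  where "upper_semi_Fredholm M T \<longleftrightarrow> ccdim (kernel M T) < \<infinity> \<and> closed (T ` M)"

definition lower_semi_Fredholm ::
  "'a::complex_normed_vector set \<Rightarrow> ('a \<Rightarrow> 'a) \<Rightarrow> bool"
  where "lower_semi_Fredholm M T \<longleftrightarrow> ccodim M (T ` M) < \<infinity>"

definition Fredholm :: "'a::complex_normed_vector set \<Rightarrow> ('a \<Rightarrow> 'a) \<Rightarrow> bool"
  where "Fredholm M T \<longleftrightarrow> upper_semi_Fredholm M T \<and> lower_semi_Fredholm M T"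

text \<open>
  The index may be \<open>-\<infinity>\<close> for upper and \<open>\<infinity>\<close> for lower semi-Fredholm operators; it is only used
  for semi-Fredholm operators, so that \<open>\<infinity> - \<infinity>\<close> does not occur.
\<close>

definition ind :: "'a::complex_normed_vector set \<Rightarrow> ('a \<Rightarrow> 'a) \<Rightarrow> ereal"
  where "ind M T = ereal_of_enat (ccdim (kernel M T)) - ereal_of_enat (ccodim M (T ` M))"

definition upper_semi_Weyl :: "'a::complex_normed_vector set \<Rightarrow> ('a \<Rightarrow> 'a) \<Rightarrow> bool"
  where "upper_semi_Weyl M T \<longleftrightarrow> upper_semi_Fredholm M T \<and> ind M T \<le> 0"

definition lower_semi_Weyl :: "'a::complex_normed_vector set \<Rightarrow> ('a \<Rightarrow> 'a) \<Rightarrow> bool"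
  where "lower_semi_Weyl M T \<longleftrightarrow> lower_semi_Fredholm M T \<and> ind M T \<ge> 0"

definition Weyl :: "'a::complex_normed_vector set \<Rightarrow> ('a \<Rightarrow> 'a) \<Rightarrow> bool"
  where "Weyl M T \<longleftrightarrow> Fredholm M T \<and> ind M T = 0"

text \<open>The infimum of the empty set in \<^typ>\<open>enat\<close> is \<open>\<infinity>\<close>.\<close>

definition ascent :: "'a::complex_normed_vector set \<Rightarrow> ('a \<Rightarrow> 'a) \<Rightarrow> enat"
  where "ascent M T = Inf {enat p | p. kernel M (T ^^ p) = kernel M (T ^^ (p + 1))}"

definition descent :: "'a::complex_normed_vector set \<Rightarrow> ('a \<Rightarrow> 'a) \<Rightarrow> enat"
  where "descent M T = Inf {enat q | q. (T ^^ q) ` M = (T ^^ (q + 1)) ` M}"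

definition upper_semi_Browder :: "'a::complex_normed_vector set \<Rightarrow> ('a \<Rightarrow> 'a) \<Rightarrow> bool"
  where "upper_semi_Browder M T \<longleftrightarrow> upper_semi_Fredholm M T \<and> ascent M T < \<infinity>"

definition lower_semi_Browder :: "'a::complex_normed_vector set \<Rightarrow> ('a \<Rightarrow> 'a) \<Rightarrow> bool"
  where "lower_semi_Browder M T \<longleftrightarrow> lower_semi_Fredholm M T \<and> descent M T < \<infinity>"

definition Browder :: "'a::complex_normed_vector set \<Rightarrow> ('a \<Rightarrow> 'a) \<Rightarrow> bool"
  where "Browder M T \<longleftrightarrow> upper_semi_Browder M T \<and> lower_semi_Browder M T"

definition sigma_uW :: "'a::complex_normed_vector set \<Rightarrow> ('a \<Rightarrow> 'a) \<Rightarrow> complex set"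
  where "sigma_uW M T = {l. \<not> upper_semi_Weyl M (shift T l)}"

definition sigma_W :: "'a::complex_normed_vector set \<Rightarrow> ('a \<Rightarrow> 'a) \<Rightarrow> complex set"
  where "sigma_W M T = {l. \<not> Weyl M (shift T l)}"

definition sigma_uB :: "'a::complex_normed_vector set \<Rightarrow> ('a \<Rightarrow> 'a) \<Rightarrow> complex set"
  where "sigma_uB M T = {l. \<not> upper_semi_Browder M (shift T l)}"

definition sigma_B :: "'a::complex_normed_vector set \<Rightarrow> ('a \<Rightarrow> 'a) \<Rightarrow> complex set"
  where "sigma_B M T = {l. \<not> Browder M (shift T l)}"

definition Browder_theorem :: "'a::complex_normed_vector set \<Rightarrow> ('a \<Rightarrow> 'a) \<Rightarrow> bool"
  where "Browder_theorem M T \<longleftrightarrow> sigma_W M T = sigma_B M T"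

definition a_Browder_theorem :: "'a::complex_normed_vector set \<Rightarrow> ('a \<Rightarrow> 'a) \<Rightarrow> bool"
  where "a_Browder_theorem M T \<longleftrightarrow> sigma_uW M T = sigma_uB M T"

section \<open>Dual space and adjoint\<close>

text \<open>
  The dual space consists of the complex-linear elements of the space of bounded real-linear
  functionals, with the operator norm inherited from \<^typ>\<open>'a \<Rightarrow>\<^sub>L complex\<close>. The adjoint is the
  Banach space adjoint (linear, not conjugate-linear, in the operator).
\<close>

definition cdual :: "('a::complex_normed_vector \<Rightarrow>\<^sub>L complex) set"
  where "cdual = {f. \<forall>c x. blinfun_apply f (c *\<^sub>C x) = c * blinfun_apply f x}"

definition dual_operator ::
  "('a::complex_normed_vector \<Rightarrow> 'a) \<Rightarrow> ('a \<Rightarrow>\<^sub>L complex) \<Rightarrow> ('a \<Rightarrow>\<^sub>L complex)"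
  where "dual_operator T f = Blinfun (\<lambda>x. blinfun_apply f (T x))"

lemma bounded_operators_UNIV_bounded_linear:
  assumes "T \<in> bounded_operators UNIV"
  shows "bounded_linear T"
proof -
  have add: "T (x + y) = T x + T y" and scale: "T (c *\<^sub>C x) = c *\<^sub>C T x" for x y c
    using assms by (auto simp: bounded_operators_def)
  obtain K where K: "\<And>x. norm (T x) \<le> K * norm x"
    using assms by (auto simp: bounded_operators_def)
  show ?thesis
    by (rule bounded_linear_intro[where K = K])
      (use add scale[of "complex_of_real _"] K in \<open>auto simp: scaleC_of_real mult.commute\<close>)
qed

lemma blinfun_apply_dual_operator:
  assumes "T \<in> bounded_operators UNIV"
  shows "blinfun_apply (dual_operator T f) x = blinfun_apply f (T x)"
  unfolding dual_operator_def
  using bounded_linear_compose[OF blinfun.bounded_linear_right[of f]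
      bounded_operators_UNIV_bounded_linear[OF assms]]
  by (simp add: bounded_linear_Blinfun_apply)

lemma csubspace_cdual: "csubspace cdual"
  by (auto simp: cdual_def complex_vector.subspace_def blinfun.add_left
      blinfun_apply_scaleC scaleC_complex_def algebra_simps)

lemma closed_cdual: "closed (cdual :: ('a::complex_normed_vector \<Rightarrow>\<^sub>L complex) set)"
proof -
  have "cdual = (\<Inter>c. \<Inter>x. {f :: 'a \<Rightarrow>\<^sub>L complex.
      blinfun_apply f (c *\<^sub>C x) = c * blinfun_apply f x})"
    by (auto simp: cdual_def)
  moreover have "closed \<dots>"
    by (intro closed_INT ballI closed_Collect_eq continuous_intros)
  ultimately show ?thesis by simp
qed

lemma dual_operator_bounded_operators:
  assumes "T \<in> bounded_operators UNIV"
  shows "dual_operator T \<in> bounded_operators cdual"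
proof -
  note ap = blinfun_apply_dual_operator[OF assms]
  have scale: "T (c *\<^sub>C x) = c *\<^sub>C T x" for c x
    using assms by (auto simp: bounded_operators_def)
  obtain K where K: "\<And>x. norm (T x) \<le> norm x * K" "K \<ge> 0"
    using bounded_linear.nonneg_bounded[OF bounded_operators_UNIV_bounded_linear[OF assms]]
    by blast
  have "norm (dual_operator T f) \<le> K * norm f" for f
  proof (rule norm_blinfun_bound)
    fix x
    have "norm (f (T x)) \<le> norm f * norm (T x)" by (rule norm_blinfun)
    also have "\<dots> \<le> norm f * (norm x * K)" by (intro mult_left_mono K) simp
    finally show "norm (dual_operator T f x) \<le> K * norm f * norm x" by (simp add: ap mult_ac)
  qed (use K in simp)
  moreover have "dual_operator T (f + g) = dual_operator T f + dual_operator T g" for f g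
    by (intro blinfun_eqI) (simp add: ap blinfun.add_left)
  moreover have "dual_operator T (c *\<^sub>C f) = c *\<^sub>C dual_operator T f" for c f
    by (intro blinfun_eqI) (simp add: ap blinfun_apply_scaleC)
  moreover have "dual_operator T f \<in> cdual" if "f \<in> cdual" for f
    using that by (auto simp: cdual_def ap scale)
  ultimately show ?thesis unfolding bounded_operators_def by blast
qed

section \<open>Generalized Drazin-type operators\<close>

definition invertible_on :: "'a::complex_normed_vector set \<Rightarrow> ('a \<Rightarrow> 'a) \<Rightarrow> bool"
  where "invertible_on M T \<longleftrightarrow>
    (\<exists>S \<in> bounded_operators M. \<forall>x\<in>M. S (T x) = x \<and> T (S x) = x)"

definition bounded_below :: "'a::complex_normed_vector set \<Rightarrow> ('a \<Rightarrow> 'a) \<Rightarrow> bool"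
  where "bounded_below M T \<longleftrightarrow> (\<exists>c>0. \<forall>x\<in>M. c * norm x \<le> norm (T x))"

definition surjective :: "'a::complex_normed_vector set \<Rightarrow> ('a \<Rightarrow> 'a) \<Rightarrow> bool"
  where "surjective M T \<longleftrightarrow> T ` M = M"

definition spectrum :: "'a::complex_normed_vector set \<Rightarrow> ('a \<Rightarrow> 'a) \<Rightarrow> complex set"
  where "spectrum M T = {l. \<not> invertible_on M (shift T l)}"

text \<open>
  Inclusion rather than equality, since the spectrum of the operator on the zero space is empty;
  that operator counts as quasi-nilpotent.
\<close>

definition quasi_nilpotent :: "'a::complex_normed_vector set \<Rightarrow> ('a \<Rightarrow> 'a) \<Rightarrow> bool"
  where "quasi_nilpotent M T \<longleftrightarrow> spectrum M T \<subseteq> {0}"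

definition Red :: "('a::complex_normed_vector \<Rightarrow> 'a) \<Rightarrow> ('a set \<times> 'a set) set"
  where "Red T = {(M, N).
    csubspace M \<and> closed M \<and> T ` M \<subseteq> M \<and>
    csubspace N \<and> closed N \<and> T ` N \<subseteq> N \<and> direct_sum UNIV M N}"

definition gD_invertible :: "('a::complex_normed_vector \<Rightarrow> 'a) \<Rightarrow> bool"
  where "gD_invertible T \<longleftrightarrow>
    (\<exists>(M, N) \<in> Red T. invertible_on M T \<and> quasi_nilpotent N T)"

definition gD_bounded_below :: "('a::complex_normed_vector \<Rightarrow> 'a) \<Rightarrow> bool"
  where "gD_bounded_below T \<longleftrightarrow>
    (\<exists>(M, N) \<in> Red T. bounded_below M T \<and> quasi_nilpotent N T)"

definition gD_surjective :: "('a::complex_normed_vector \<Rightarrow> 'a) \<Rightarrow> bool"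
  where "gD_surjective T \<longleftrightarrow>
    (\<exists>(M, N) \<in> Red T. surjective M T \<and> quasi_nilpotent N T)"

definition gD_upper_semi_Weyl :: "('a::complex_normed_vector \<Rightarrow> 'a) \<Rightarrow> bool"
  where "gD_upper_semi_Weyl T \<longleftrightarrow>
    (\<exists>(M, N) \<in> Red T. upper_semi_Weyl M T \<and> quasi_nilpotent N T)"

definition gD_lower_semi_Weyl :: "('a::complex_normed_vector \<Rightarrow> 'a) \<Rightarrow> bool"
  where "gD_lower_semi_Weyl T \<longleftrightarrow>
    (\<exists>(M, N) \<in> Red T. lower_semi_Weyl M T \<and> quasi_nilpotent N T)"

definition pseudo_B_Weyl :: "('a::complex_normed_vector \<Rightarrow> 'a) \<Rightarrow> bool"
  where "pseudo_B_Weyl T \<longleftrightarrow>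
    (\<exists>(M, N) \<in> Red T. Weyl M T \<and> quasi_nilpotent N T)"

definition sigma_gD :: "('a::complex_normed_vector \<Rightarrow> 'a) \<Rightarrow> complex set"
  where "sigma_gD T = {l. \<not> gD_invertible (shift T l)}"

definition sigma_gDM :: "('a::complex_normed_vector \<Rightarrow> 'a) \<Rightarrow> complex set"
  where "sigma_gDM T = {l. \<not> gD_bounded_below (shift T l)}"

definition sigma_gDQ :: "('a::complex_normed_vector \<Rightarrow> 'a) \<Rightarrow> complex set"
  where "sigma_gDQ T = {l. \<not> gD_surjective (shift T l)}"

definition sigma_gDW_plus :: "('a::complex_normed_vector \<Rightarrow> 'a) \<Rightarrow> complex set"
  where "sigma_gDW_plus T = {l. \<not> gD_upper_semi_Weyl (shift T l)}"

definition sigma_gDW_minus :: "('a::complex_normed_vector \<Rightarrow> 'a) \<Rightarrow> complex set"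
  where "sigma_gDW_minus T = {l. \<not> gD_lower_semi_Weyl (shift T l)}"

definition sigma_gDW :: "('a::complex_normed_vector \<Rightarrow> 'a) \<Rightarrow> complex set"
  where "sigma_gDW T = {l. \<not> pseudo_B_Weyl (shift T l)}"

end

theory Submission
  imports Defs
begin

text \<open>
  All three equivalences have the same shape. The spectra of generalized Drazin type satisfy one
  inclusion trivially, and so do the Weyl and Browder spectra, because finite ascent of an
  upper semi-Fredholm operator forces its index to be at most zero, and finite descent in addition
  makes the index of a Fredholm operator zero. What remains is, for \<open>a\<close>-Browder's theorem,
  the equivalence of
  \<^item> whenever \<open>T - l\<close> is upper semi-Weyl, its ascent is finite;
  \<^item> whenever \<open>T - l\<close> is the direct sum of an upper semi-Weyl and a quasi-nilpotent operator, it is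
    the direct sum of an operator that is bounded below and a quasi-nilpotent one.

  The connection is a dichotomy for an upper semi-Fredholm operator \<open>S\<close> on a Banach space
  (\<open>upper_semi_Fredholm_dichotomy\<close>): either \<open>S\<close> is the direct sum of an operator that is bounded below
  and a nilpotent one on a finite-dimensional space, or \<open>S - l\<close> has infinite ascent for all small \<open>l\<close>.
  It rests on the decomposition of Kato (\<open>Kato_decomposition\<close>), which splits off finitely many Jordan
  blocks until the kernel is contained in the range of every power. On the intersection of these
  ranges the remaining part is onto; if it has a nontrivial kernel there, all small shifts are onto
  with a nontrivial kernel as well.

  Assume the first statement and let \<open>S = T - l\<close> decompose on \<open>M \<oplus> N\<close> as in the second one. For small
  \<open>m \<noteq> 0\<close> the operator \<open>S - m\<close> is upper semi-Weyl on \<open>M\<close>, since the index condition is stable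
  (\<open>upper_semi_Weyl_shift\<close>), and invertible on \<open>N\<close>, so its ascent is finite. This rules out the second
  alternative for \<open>S\<close> on \<open>M\<close>, and the nilpotent part found in the first one is moved to \<open>N\<close>. Conversely,
  if \<open>S\<close> is upper semi-Weyl and the sum of an operator that is bounded below and a quasi-nilpotent
  one, then \<open>S - m\<close> is injective for small \<open>m \<noteq> 0\<close>, which again rules out the second alternative, now
  on the whole space, and the first one gives finite ascent.

  Browder's theorem is treated in the same way: when the index is zero, the part that is bounded
  below is also onto. For the adjoint, the closed range theorem (\<open>closed_range_of_adjoint\<close>) and the
  dimension formulas for annihilators translate upper semi-Weyl into lower semi-Weyl and ascent into
  descent, and a second dichotomy (\<open>lower_semi_Fredholm_dichotomy\<close>), with surjectivity and infinite
  descent, replaces the first.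
\<close>

section \<open>The open mapping theorem on complete subspaces\<close>

text \<open>
  Linearity and boundedness are required on \<open>M\<close> only, in keeping with operators that are functions
  on the ambient type considered on a carrier. Real linearity is enough for the open mapping theorem
  and lets it be applied to sum maps \<open>M \<times> N \<rightarrow> X\<close>, whose domain lies in a product type without a complex
  structure.
\<close>

definition bounded_linear_on ::
  "'a::real_normed_vector set \<Rightarrow> ('a \<Rightarrow> 'b::real_normed_vector) \<Rightarrow> bool"
  where "bounded_linear_on M T \<longleftrightarrow>
    (\<forall>x\<in>M. \<forall>y\<in>M. T (x + y) = T x + T y) \<and>
    (\<forall>r. \<forall>x\<in>M. T (r *\<^sub>R x) = r *\<^sub>R T x) \<and>
    (\<exists>K. \<forall>x\<in>M. norm (T x) \<le> K * norm x)"

lemma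
  assumes "bounded_linear_on M T" "subspace M"
  shows bounded_linear_on_zero: "T 0 = 0"
    and bounded_linear_on_diff: "x \<in> M \<Longrightarrow> y \<in> M \<Longrightarrow> T (x - y) = T x - T y"
proof -
  have add: "T (x + y) = T x + T y" if "x \<in> M" "y \<in> M" for x y
    using assms(1) that by (simp add: bounded_linear_on_def)
  have scale: "T (r *\<^sub>R x) = r *\<^sub>R T x" if "x \<in> M" for r x
    using assms(1) that by (simp add: bounded_linear_on_def)
  show "T 0 = 0" using scale[of 0 0] subspace_0[OF assms(2)] by simp
  have neg: "T (- x) = - T x" if "x \<in> M" for x using scale[of x "-1"] that by simp
  show "T (x - y) = T x - T y" if "x \<in> M" "y \<in> M" for x y
    using add[of x "- y"] neg[of y] subspace_neg[OF assms(2)] that by simp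
qed

lemma bounded_linear_on_pos_bound:
  assumes "bounded_linear_on M T"
  obtains K where "K > 0" "\<And>x. x \<in> M \<Longrightarrow> norm (T x) \<le> K * norm x"
proof -
  obtain K where K: "\<forall>x\<in>M. norm (T x) \<le> K * norm x"
    using assms by (auto simp: bounded_linear_on_def)
  have "norm (T x) \<le> (\<bar>K\<bar> + 1) * norm x" if "x \<in> M" for x
    using K that
    by (meson abs_ge_self add_increasing2 mult_right_mono norm_ge_zero order_trans zero_le_one)
  then show thesis by (intro that[of "\<bar>K\<bar> + 1"]) auto
qed

lemma bounded_linear_on_tendsto:
  assumes T: "bounded_linear_on M T" "subspace M" and x: "x \<in> M" "\<And>n. s n \<in> M" and "s \<longlonglongrightarrow> x"
  shows "(\<lambda>n. T (s n)) \<longlonglongrightarrow> T x"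
proof -
  obtain K where K: "K > 0" "\<And>x. x \<in> M \<Longrightarrow> norm (T x) \<le> K * norm x"
    using bounded_linear_on_pos_bound[OF T(1)] by blast
  have "(\<lambda>n. T (s n) - T x) \<longlonglongrightarrow> 0"
  proof (rule Lim_null_comparison)
    show "(\<lambda>n. K * norm (s n - x)) \<longlonglongrightarrow> 0"
      using assms(5) by (simp add: LIM_zero tendsto_mult_right_zero tendsto_norm_zero)
    have "norm (T (s n) - T x) \<le> K * norm (s n - x)" for n
      using K(2)[of "s n - x"] x T by (simp add: bounded_linear_on_diff subspace_diff)
    then show "\<forall>\<^sub>F n in sequentially. norm (T (s n) - T x) \<le> K * norm (s n - x)" by simp
  qed
  then show ?thesis by (simp add: LIM_zero_cancel)
qed

text \<open>
  Solving an equation up to half of the right-hand side, with a linear bound on the solution, is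
  enough to solve it: the remaining error is solved for in the same way, and the corrections are
  dominated by a geometric series. This is the second half of the proof of the open mapping theorem;
  it also gives the stability of surjectivity and the closed range theorem.
\<close>

lemma approximate_solutions_imp_solutions:
  fixes T :: "'a::real_normed_vector \<Rightarrow> 'b::real_normed_vector"
  assumes M: "subspace M" "complete M" and T: "bounded_linear_on M T"
    and Y: "subspace Y" "T ` M \<subseteq> Y" and C: "C \<ge> 0"
    and approx: "\<And>y. y \<in> Y \<Longrightarrow> \<exists>x\<in>M. norm x \<le> C * norm y \<and> norm (y - T x) \<le> norm y / 2"
    and y: "y \<in> Y"
  shows "\<exists>x\<in>M. T x = y \<and> norm x \<le> 2 * C * norm y"
proof -
  obtain g where g: "\<And>y. y \<in> Y \<Longrightarrow> g y \<in> M \<and> norm (g y) \<le> C * norm y \<and> norm (y - T (g y)) \<le> norm y / 2"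
    using approx by metis
  define r where "r = rec_nat y (\<lambda>_ z. z - T (g z))"
  have r0: "r 0 = y" and rS: "r (Suc n) = r n - T (g (r n))" for n by (simp_all add: r_def)
  have rY: "r n \<in> Y" for n
    by (induction n) (use r0 rS y g Y in \<open>auto intro!: subspace_diff\<close>)
  have rn: "norm (r n) \<le> norm y * (1/2) ^ n" for n
  proof (induction n)
    case (Suc n)
    then show ?case using g[OF rY[of n]] by (simp add: rS)
  qed (simp add: r0)
  define s where "s n = (\<Sum>i<n. g (r i))" for n
  have sM: "s n \<in> M" for n unfolding s_def using M(1) g rY by (intro subspace_sum) auto
  have Ts: "T (s n) = y - r n" for n
  proof (induction n)
    case 0
    then show ?case using bounded_linear_on_zero[OF T M(1)] by (simp add: s_def r0)
  next
    case (Suc n)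
    have "T (s (Suc n)) = T (s n) + T (g (r n))"
      using T sM[of n] g[OF rY[of n]] by (simp add: s_def bounded_linear_on_def)
    then show ?case using Suc rS by simp
  qed
  define S where "S n = (\<Sum>i<n. C * norm y * (1/2::real) ^ i)" for n
  have Sle: "S n \<le> 2 * C * norm y" for n
  proof -
    have "S n = C * norm y * (\<Sum>i<n. (1/2::real) ^ i)" by (simp add: S_def sum_distrib_left)
    also have "\<dots> \<le> C * norm y * 2"
      using C by (intro mult_left_mono) (auto simp: geometric_sum)
    finally show ?thesis by simp
  qed
  have inc: "norm (s m - s n) \<le> S m - S n" if "n \<le> m" for m n
    using that
  proof (induction m rule: dec_induct)
    case (step m)
    have "norm (g (r m)) \<le> C * (norm y * (1/2) ^ m)"
      using g[OF rY[of m]] rn[of m] C by (meson mult_left_mono order_trans)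
    moreover have "norm (s (Suc m) - s n) \<le> norm (s m - s n) + norm (g (r m))"
      using norm_triangle_ineq[of "s m - s n" "g (r m)"] by (simp add: s_def algebra_simps)
    ultimately show ?case using step.IH by (simp add: S_def mult.assoc)
  qed simp
  have "summable (\<lambda>i. C * norm y * (1/2::real) ^ i)"
    by (intro summable_mult summable_geometric) simp
  then have "Cauchy S" unfolding S_def
    unfolding summable_iff_convergent by (rule convergent_Cauchy)
  have "Cauchy s"
  proof (rule CauchyI)
    fix e :: real assume "0 < e"
    then obtain N where N: "\<And>m n. m \<ge> N \<Longrightarrow> n \<ge> N \<Longrightarrow> norm (S m - S n) < e"
      using CauchyD[OF \<open>Cauchy S\<close>] by metis
    have "norm (s m - s n) < e" if "m \<ge> N" "n \<ge> N" for m n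
    proof (cases "n \<le> m")
      case True
      then show ?thesis using inc[OF True] N[OF that] by simp
    next
      case False
      then show ?thesis using inc[of m n] N[OF that] by (simp add: norm_minus_commute)
    qed
    then show "\<exists>N. \<forall>m\<ge>N. \<forall>n\<ge>N. norm (s m - s n) < e" by blast
  qed
  then obtain x where x: "x \<in> M" "s \<longlonglongrightarrow> x"
    using M(2) sM unfolding complete_def by blast
  have "(\<lambda>n. T (s n)) \<longlonglongrightarrow> T x"
    using bounded_linear_on_tendsto[OF T M(1)] x sM by blast
  moreover have "r \<longlonglongrightarrow> 0"
  proof (rule Lim_null_comparison)
    show "(\<lambda>n. norm y * (1/2::real) ^ n) \<longlonglongrightarrow> 0"
      by (intro tendsto_mult_right_zero LIMSEQ_power_zero) simp
  qed (use rn in simp)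
  then have "(\<lambda>n. T (s n)) \<longlonglongrightarrow> y - 0" unfolding Ts by (intro tendsto_intros)
  ultimately have "T x = y" using LIMSEQ_unique by fastforce
  moreover have "norm x \<le> 2 * C * norm y"
  proof (rule Lim_bounded)
    show "(\<lambda>n. norm (s n)) \<longlonglongrightarrow> norm x" using x(2) by (rule tendsto_norm)
    have "norm (s n) \<le> 2 * C * norm y" for n
      using inc[of 0 n] Sle[of n] by (simp add: s_def S_def)
    then show "\<forall>n\<ge>0. norm (s n) \<le> 2 * C * norm y" by blast
  qed
  ultimately show ?thesis using x(1) by blast
qed

text \<open>
  A complete set is completely metrizable in its relative topology, so Baire's theorem applies inside
  a carrier.
\<close>

lemma complete_subspace_Baire:
  fixes Y :: "'b::real_normed_vector set"
  assumes Y: "complete Y" "Y \<noteq> {}" and cover: "Y \<subseteq> (\<Union>n::nat. F n)"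
  obtains n y0 e where "y0 \<in> Y" "e > 0" "Y \<inter> ball y0 e \<subseteq> closure (F n)"
proof -
  define G where "G = range (\<lambda>n. Y \<inter> closure (F n))"
  have "completely_metrizable_space (top_of_set Y)"
    unfolding completely_metrizable_space_def
  proof (intro exI conjI)
    interpret Submetric UNIV dist Y by unfold_locales auto
    show "Metric_space Y dist" by (rule sub.Metric_space_axioms)
    show "Metric_space.mcomplete Y dist"
      unfolding sub.mcomplete_def
    proof (intro allI impI)
      fix s assume "sub.MCauchy s"
      then have "Cauchy s" "\<And>n. s n \<in> Y"
        using MCauchy_submetric by auto
      then obtain x where "x \<in> Y" "s \<longlonglongrightarrow> x" using Y(1) unfolding complete_def by blast
      then show "\<exists>x. limitin sub.mtopology s x sequentially"
        using \<open>\<And>n. s n \<in> Y\<close> unfolding mtopology_submetric limitin_subtopology by auto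
    qed
    show "top_of_set Y = Metric_space.mtopology Y dist"
      using mtopology_submetric by simp
  qed
  moreover have "countable G" by (simp add: G_def)
  moreover have "\<Union>G = Y"
  proof
    show "Y \<subseteq> \<Union>G"
    proof
      fix y assume "y \<in> Y"
      moreover then obtain n where "y \<in> F n" using cover by blast
      moreover have "F n \<subseteq> closure (F n)" by (rule closure_subset)
      ultimately show "y \<in> \<Union>G" by (auto simp: G_def)
    qed
  qed (auto simp: G_def)
  moreover have "(top_of_set Y) interior_of Y = Y"
    by (metis interior_of_topspace topspace_euclidean_subtopology)
  ultimately have "\<not> (\<forall>S\<in>G. closedin (top_of_set Y) S \<and> (top_of_set Y) interior_of S = {})"
    using Baire_category_alt[of "top_of_set Y" G] Y(2) by metis
  moreover have "closedin (top_of_set Y) S" if "S \<in> G" for S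
    using that by (auto simp: G_def closedin_closed_Int)
  ultimately obtain S where S: "S \<in> G" "(top_of_set Y) interior_of S \<noteq> {}"
    by blast
  then obtain n where n: "S = Y \<inter> closure (F n)" by (auto simp: G_def)
  obtain y0 where y0: "y0 \<in> (top_of_set Y) interior_of S" using S(2) by blast
  have "openin (top_of_set Y) ((top_of_set Y) interior_of S)" by simp
  then obtain U where U: "open U" "(top_of_set Y) interior_of S = Y \<inter> U"
    unfolding openin_open by blast
  then obtain e where e: "e > 0" "ball y0 e \<subseteq> U" using y0 openE by blast
  have "Y \<inter> ball y0 e \<subseteq> closure (F n)"
    using e U interior_of_subset[of "top_of_set Y" S] n by blast
  with y0 U e show thesis by (intro that[of y0 e n]) auto
qed

text \<open>
  By Baire, the closure of the image of some ball contains a ball of the range, and differences of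
  its elements give approximate solutions for every small right-hand side.
\<close>

theorem open_mapping:
  fixes T :: "'a::real_normed_vector \<Rightarrow> 'b::real_normed_vector"
  assumes M: "subspace M" "complete M" and T: "bounded_linear_on M T" and TM: "complete (T ` M)"
  obtains C where "C > 0" "\<And>y. y \<in> T ` M \<Longrightarrow> \<exists>x\<in>M. T x = y \<and> norm x \<le> C * norm y"
proof -
  let ?Y = "T ` M"
  note lin = bounded_linear_on_diff[OF T M(1)] bounded_linear_on_zero[OF T M(1)]
  have add: "T (x + y) = T x + T y" if "x \<in> M" "y \<in> M" for x y
    using T that by (simp add: bounded_linear_on_def)
  have scale: "T (r *\<^sub>R x) = r *\<^sub>R T x" if "x \<in> M" for r x
    using T that by (simp add: bounded_linear_on_def)
  have Y: "subspace ?Y"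
    unfolding subspace_def using M(1) add scale lin
    by (auto simp: image_iff) (metis subspace_0 subspace_add subspace_scale)+
  have "?Y \<subseteq> (\<Union>n. T ` (M \<inter> cball 0 (real n)))"
    using real_arch_simple by (force simp: image_iff)
  then obtain n y0 e where e: "y0 \<in> ?Y" "e > 0"
      "?Y \<inter> ball y0 e \<subseteq> closure (T ` (M \<inter> cball 0 (real n)))"
    using complete_subspace_Baire[OF TM] M(1) subspace_0 by (metis empty_iff image_is_empty)
  have near: "\<exists>x\<in>M. norm x \<le> 2 * real n \<and> norm (y - T x) < d"
    if y: "y \<in> ?Y" "norm y < e" and d: "d > 0" for y d
  proof -
    have "y0 + y \<in> closure (T ` (M \<inter> cball 0 (real n)))"
      using e y Y by (auto simp: subspace_add dist_norm intro!: subsetD[OF e(3)])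
    then obtain x1 where x1: "x1 \<in> M" "norm x1 \<le> real n" "norm (T x1 - (y0 + y)) < d/2"
      using d unfolding closure_approachable by (force simp: dist_norm dest: spec[of _ "d/2"])
    have "y0 \<in> closure (T ` (M \<inter> cball 0 (real n)))"
      using e by (auto intro!: subsetD[OF e(3)])
    then obtain x2 where x2: "x2 \<in> M" "norm x2 \<le> real n" "norm (T x2 - y0) < d/2"
      using d unfolding closure_approachable by (force simp: dist_norm dest: spec[of _ "d/2"])
    have le: "norm (x1 - x2) \<le> 2 * real n" using norm_triangle_ineq4[of x1 x2] x1 x2 by simp
    have "y - T (x1 - x2) = (T x2 - y0) - (T x1 - (y0 + y))"
      using x1 x2 lin by simp
    have "norm (y - T (x1 - x2)) < d"
      unfolding \<open>y - T (x1 - x2) = _\<close>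
      using norm_triangle_ineq4[of "T x2 - y0" "T x1 - (y0 + y)"] x1(3) x2(3) by linarith
    with le show ?thesis using x1 x2 M(1) subspace_diff by blast
  qed
  define C where "C = 4 * real n / e + 1"
  have C: "C > 0" using e(2) by (simp add: C_def add_nonneg_pos)
  have "\<exists>x\<in>M. norm x \<le> C * norm y \<and> norm (y - T x) \<le> norm y / 2" if y: "y \<in> ?Y" for y
  proof (cases "y = 0")
    case True
    then show ?thesis using M(1) subspace_0 lin by (intro bexI[of _ 0]) auto
  next
    case False
    \<comment> \<open>scale \<open>y\<close> into the ball of radius \<open>e\<close>, solve approximately there and scale back\<close>
    define t where "t = e / (2 * norm y)"
    have t: "t > 0" "t * norm y = e / 2" using False e(2) by (auto simp: t_def)
    obtain x where x: "x \<in> M" "norm x \<le> 2 * real n" "norm (t *\<^sub>R y - T x) < e / 4"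
    proof -
      have "t *\<^sub>R y \<in> ?Y" using Y y by (rule subspace_scale)
      moreover have "norm (t *\<^sub>R y) < e" using t e(2) by simp
      ultimately show thesis using near[of "t *\<^sub>R y" "e/4"] e(2) that by auto
    qed
    have "norm (x /\<^sub>R t) \<le> C * norm y"
    proof -
      have "norm (x /\<^sub>R t) = norm x / t" using t by (simp add: field_simps)
      also have "\<dots> \<le> 2 * real n / t" using x t by (simp add: divide_right_mono)
      also have "\<dots> = 4 * real n / e * norm y" using e(2) False by (simp add: t_def field_simps)
      also have "\<dots> \<le> C * norm y" by (intro mult_right_mono) (auto simp: C_def)
      finally show ?thesis .
    qed
    moreover have "norm (y - T (x /\<^sub>R t)) \<le> norm y / 2"
    proof -
      have "t *\<^sub>R (y - T (x /\<^sub>R t)) = t *\<^sub>R y - T x"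
        using x t by (simp add: scale algebra_simps)
      then have "t * norm (y - T (x /\<^sub>R t)) = norm (t *\<^sub>R y - T x)"
        using t(1) norm_scaleR[of t "y - T (x /\<^sub>R t)"] by simp
      then have "t * norm (y - T (x /\<^sub>R t)) < t * (norm y / 2)" using x(3) t(2) by simp
      then have "norm (y - T (x /\<^sub>R t)) < norm y / 2"
        by (rule mult_left_less_imp_less) (use t(1) in simp)
      then show ?thesis by simp
    qed
    ultimately show ?thesis using subspace_scale[OF M(1) x(1)] by blast
  qed
  then have "\<exists>x\<in>M. T x = y \<and> norm x \<le> 2 * C * norm y" if "y \<in> ?Y" for y
    by (rule approximate_solutions_imp_solutions[OF M T Y subset_refl less_imp_le[OF C] _ that])
  then show thesis using C by (intro that[of "2 * C"]) auto
qed

section \<open>The Hahn-Banach theorem for seminorms\<close>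

definition sublinear :: "('a::real_vector \<Rightarrow> real) \<Rightarrow> bool"
  where "sublinear q \<longleftrightarrow> (\<forall>x y. q (x + y) \<le> q x + q y) \<and> (\<forall>r>0. \<forall>x. q (r *\<^sub>R x) \<le> r * q x)"

lemma
  assumes "sublinear q"
  shows sublinear_add: "q (x + y) \<le> q x + q y"
    and sublinear_zero: "q 0 = 0"
    and sublinear_scale: "r \<ge> 0 \<Longrightarrow> q (r *\<^sub>R x) = r * q x"
    and sublinear_neg: "- q (- x) \<le> q x"
proof -
  show add: "q (x + y) \<le> q x + q y" for x y using assms by (simp add: sublinear_def)
  have le: "r > 0 \<Longrightarrow> q (r *\<^sub>R x) \<le> r * q x" for r x using assms by (simp add: sublinear_def)
  show zero: "q 0 = 0" using add[of 0 0] le[of "1/2" 0] by simp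
  show "q (r *\<^sub>R x) = r * q x" if "r \<ge> 0"
  proof (cases "r = 0")
    case False
    then have "r > 0" using that by simp
    moreover have "q x \<le> (1/r) * q (r *\<^sub>R x)" using le[of "1/r" "r *\<^sub>R x"] \<open>r > 0\<close> by simp
    ultimately show ?thesis using le[of r x] by (simp add: field_simps)
  qed (simp add: zero)
  show "- q (- x) \<le> q x" using add[of x "- x"] zero by simp
qed

text \<open>
  A sublinear \<open>q\<close> with \<open>q (- y) > - q y\<close> is not minimal: taking the infimum of
  \<open>q (x + t y) - t q y\<close> over \<open>t \<ge> 0\<close> keeps it sublinear and lowers its value at \<open>- y\<close>.
  Hence minimal sublinear functionals are odd, and therefore linear. Applied once more before
  minimizing, the same construction fixes the value at a prescribed point.
\<close>

lemma sublinear_improve: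
  assumes q: "sublinear q"
  shows "\<exists>q'. sublinear q' \<and> q' \<le> q \<and> q' (- y) \<le> - q y"
proof -
  define F where "F x t = q (x + t *\<^sub>R y) - t * q y" for x t
  define q' where "q' x = (INF t\<in>{0..}. F x t)" for x
  have bdd: "bdd_below (F x ` {0..})" for x
  proof (rule bdd_belowI2)
    fix t :: real assume "t \<in> {0..}"
    then have "t * q y = q ((x + t *\<^sub>R y) + (- x))" using sublinear_scale[OF q] by simp
    also have "\<dots> \<le> q (x + t *\<^sub>R y) + q (- x)" by (rule sublinear_add[OF q])
    finally show "- q (- x) \<le> F x t" by (simp add: F_def)
  qed
  have lower: "q' x \<le> F x t" if "t \<ge> 0" for x t
    unfolding q'_def using bdd that by (intro cINF_lower) auto
  have greatest: "c \<le> q' x" if "\<And>t. t \<ge> 0 \<Longrightarrow> c \<le> F x t" for c x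
    unfolding q'_def using that by (intro cINF_greatest) auto
  have "q' (x1 + x2) \<le> q' x1 + q' x2" for x1 x2
  proof -
    have "q' (x1 + x2) \<le> F x1 s + F x2 t" if st: "s \<ge> 0" "t \<ge> 0" for s t
    proof -
      have "q' (x1 + x2) \<le> F (x1 + x2) (s + t)" using st by (intro lower) simp
      also have "\<dots> \<le> F x1 s + F x2 t"
        using sublinear_add[OF q, of "x1 + s *\<^sub>R y" "x2 + t *\<^sub>R y"]
        by (simp add: F_def algebra_simps)
      finally show ?thesis .
    qed
    then have "q' (x1 + x2) - F x2 t \<le> q' x1" if "t \<ge> 0" for t
      using that by (intro greatest) (simp add: algebra_simps)
    then have "q' (x1 + x2) - q' x1 \<le> q' x2"
      by (intro greatest) (simp add: algebra_simps)
    then show ?thesis by simp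
  qed
  moreover have "q' (r *\<^sub>R x) \<le> r * q' x" if r: "r > 0" for r x
  proof -
    have "q' (r *\<^sub>R x) / r \<le> F x t" if "t \<ge> 0" for t
    proof -
      have "q' (r *\<^sub>R x) \<le> F (r *\<^sub>R x) (r * t)" using r that by (intro lower) simp
      also have "\<dots> = q (r *\<^sub>R (x + t *\<^sub>R y)) - r * t * q y" by (simp add: F_def algebra_simps)
      also have "\<dots> = r * F x t"
        using sublinear_scale[OF q, of r "x + t *\<^sub>R y"] r by (simp add: F_def algebra_simps)
      finally show ?thesis using r by (simp add: field_simps)
    qed
    then have "q' (r *\<^sub>R x) / r \<le> q' x" by (rule greatest)
    then show ?thesis using r by (simp add: field_simps)
  qed
  ultimately have "sublinear q'" by (simp add: sublinear_def)
  moreover have "q' \<le> q" using lower[of 0] by (simp add: le_fun_def F_def)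
  moreover have "q' (- y) \<le> - q y" using lower[of 1 "- y"] sublinear_zero[OF q] by (simp add: F_def)
  ultimately show ?thesis by blast
qed

text \<open>
  Zorn's lemma, with pointwise infima as lower bounds of chains; each member \<open>q\<close> of a chain is
  bounded below by \<open>- p (- x)\<close>.
\<close>

lemma minimal_sublinear_exists:
  assumes p: "sublinear p"
  shows "\<exists>m. sublinear m \<and> m \<le> p \<and> (\<forall>q. sublinear q \<longrightarrow> q \<le> m \<longrightarrow> q = m)"
proof -
  define A where "A = {q. sublinear q \<and> q \<le> p}"
  have "\<exists>m\<in>A. \<forall>a\<in>A. a \<le> m \<longrightarrow> a = m"
  proof (rule predicate_Zorn[where P = "\<lambda>a b. b \<le> a"])
    show "partial_order_on A (relation_of (\<lambda>a b. b \<le> a) A)"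
      by (rule partial_order_on_relation_ofI) auto
    fix C assume "C \<in> Chains (relation_of (\<lambda>a b. b \<le> a) A)"
    then have CA: "C \<subseteq> A" and chain: "\<And>a b. a \<in> C \<Longrightarrow> b \<in> C \<Longrightarrow> a \<le> b \<or> b \<le> a"
      unfolding Chains_def relation_of_def by auto
    show "\<exists>u\<in>A. \<forall>a\<in>C. u \<le> a"
    proof (cases "C = {}")
      case True
      then show ?thesis using p by (auto simp: A_def)
    next
      case False
      define u where "u x = (INF q\<in>C. q x)" for x
      have sub: "sublinear q" "q \<le> p" if "q \<in> C" for q using CA that by (auto simp: A_def)
      have bdd: "bdd_below ((\<lambda>q. q x) ` C)" for x
      proof (rule bdd_belowI2)
        fix q assume "q \<in> C"
        then show "- p (- x) \<le> q x"
          using sublinear_neg[OF sub(1)] sub(2) by (meson le_funD neg_le_iff_le order_trans)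
      qed
      have lower: "u x \<le> q x" if "q \<in> C" for q x
        unfolding u_def using bdd that by (intro cINF_lower) auto
      have greatest: "c \<le> u x" if "\<And>q. q \<in> C \<Longrightarrow> c \<le> q x" for c x
        unfolding u_def using that False by (intro cINF_greatest) auto
      have "u (x + y) \<le> u x + u y" for x y
      proof -
        have le: "u (x + y) \<le> q1 x + q2 y" if "q1 \<in> C" "q2 \<in> C" for q1 q2
        proof -
          obtain q where q: "q \<in> C" "q \<le> q1" "q \<le> q2" using chain \<open>q1 \<in> C\<close> \<open>q2 \<in> C\<close> by (metis order_refl)
          have "u (x + y) \<le> q x + q y"
            using lower[OF q(1)] sublinear_add[OF sub(1)[OF q(1)]] by (meson order_trans)
          also have "\<dots> \<le> q1 x + q2 y" using q by (intro add_mono) (auto dest: le_funD)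
          finally show ?thesis .
        qed
        have "u (x + y) - q2 y \<le> u x" if "q2 \<in> C" for q2
          using le that by (intro greatest) (simp add: algebra_simps)
        then have "u (x + y) - u x \<le> u y" by (intro greatest) (simp add: algebra_simps)
        then show ?thesis by simp
      qed
      moreover have "u (r *\<^sub>R x) \<le> r * u x" if r: "r > 0" for r x
      proof -
        have "u (r *\<^sub>R x) / r \<le> q x" if "q \<in> C" for q
          using lower[OF that, of "r *\<^sub>R x"] sublinear_scale[OF sub(1)[OF that], of r x] r
          by (simp add: field_simps)
        then have "u (r *\<^sub>R x) / r \<le> u x" by (rule greatest)
        then show ?thesis using r by (simp add: field_simps)
      qed
      ultimately have "sublinear u" by (simp add: sublinear_def)
      moreover have "u \<le> p"
      proof -
        obtain q where "q \<in> C" using False by blast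
        then show ?thesis using lower sub(2) by (meson le_fun_def order_trans)
      qed
      ultimately show ?thesis using lower by (auto simp: A_def le_fun_def)
    qed
  qed
  then show ?thesis unfolding A_def by (metis (mono_tags, lifting) mem_Collect_eq order_trans)
qed

theorem Hahn_Banach_real:
  assumes p: "sublinear p"
  obtains q where "linear q" "\<And>x. q x \<le> p x" "q x0 = p x0"
proof -
  obtain p' where p': "sublinear p'" "p' \<le> p" "p' (- x0) \<le> - p x0"
    using sublinear_improve[OF p] by blast
  obtain m where m: "sublinear m" "m \<le> p'" and min: "\<And>q. sublinear q \<Longrightarrow> q \<le> m \<Longrightarrow> q = m"
    using minimal_sublinear_exists[OF p'(1)] by blast
  have neg: "m (- y) = - m y" for y
  proof -
    obtain q' where "sublinear q'" "q' \<le> m" "q' (- y) \<le> - m y"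
      using sublinear_improve[OF m(1)] by blast
    then have "m (- y) \<le> - m y" using min by blast
    then show ?thesis using sublinear_neg[OF m(1), of "y"] by simp
  qed
  have add: "m (x + y) = m x + m y" for x y
    using sublinear_add[OF m(1), of x y] sublinear_add[OF m(1), of "x + y" "- y"] neg[of y] by simp
  have "m (r *\<^sub>R x) = r * m x" for r x
  proof (cases "r \<ge> 0")
    case False
    then show ?thesis using sublinear_scale[OF m(1), of "- r" x] neg[of "r *\<^sub>R x"] by simp
  qed (simp add: sublinear_scale[OF m(1)])
  then have "linear m" using add by (intro linearI) auto
  moreover have le: "m x \<le> p x" for x using m(2) p'(2) by (meson le_funD order_trans)
  moreover have "m x0 = p x0"
  proof -
    have "m (- x0) \<le> p' (- x0)" using m(2) by (rule le_funD)
    then show ?thesis using p'(3) neg[of x0] le[of x0] by simp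
  qed
  ultimately show thesis by (rule that)
qed

text \<open>
  A complex-linear functional is determined by its real part, and its modulus at \<open>x\<close> is the real
  part at a rotation of \<open>x\<close>, so that the bound on the real part carries over. A seminorm, instead of
  a multiple of the norm, is what the closed range theorem needs.
\<close>

theorem Hahn_Banach_seminorm:
  fixes p :: "'a::complex_normed_vector \<Rightarrow> real"
  assumes add: "\<And>x y. p (x + y) \<le> p x + p y"
    and scale: "\<And>c x. p (c *\<^sub>C x) \<le> cmod c * p x"
    and bound: "\<And>x. p x \<le> K * norm x"
  obtains f where "f \<in> cdual" "\<And>x. cmod (blinfun_apply f x) \<le> p x"
    "blinfun_apply f x0 = complex_of_real (p x0)"
proof -
  have sub: "sublinear p"
    unfolding sublinear_def
  proof (intro conjI allI impI)
    show "p (r *\<^sub>R x) \<le> r * p x" if "0 < r" for r x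
      using scale[of "complex_of_real r" x] that by (simp add: scaleC_of_real)
  qed (rule add)
  obtain q where q: "linear q" "\<And>x. q x \<le> p x" "q x0 = p x0"
    using Hahn_Banach_real[OF sub, of x0] by blast
  \<comment> \<open>the complex-linear functional whose real part is \<open>q\<close>\<close>
  define g where "g x = Complex (q x) (- q (\<i> *\<^sub>C x))" for x
  have g_add: "g (x + y) = g x + g y" for x y
    using q(1) by (simp add: g_def linear_add scaleC_add_right complex_eq_iff)
  have g_scale: "g (c *\<^sub>C x) = c * g x" for c x
  proof -
    have c: "c *\<^sub>C x = Re c *\<^sub>R x + Im c *\<^sub>R (\<i> *\<^sub>C x)"
      by (simp add: scaleC_of_real[symmetric] scaleC_scaleC scaleC_add_left[symmetric])
        (metis complex_eq mult.commute)
    have "(\<i> * c) *\<^sub>C x = Re c *\<^sub>R (\<i> *\<^sub>C x) + (- Im c) *\<^sub>R x"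
      unfolding scaleC_of_real[symmetric] scaleC_scaleC scaleC_add_left[symmetric]
      by (rule arg_cong[where f = "\<lambda>c. c *\<^sub>C x"]) (simp add: complex_eq_iff)
    then have ic: "q (\<i> *\<^sub>C c *\<^sub>C x) = Re c * q (\<i> *\<^sub>C x) - Im c * q x"
      using q(1) by (simp add: scaleC_scaleC linear_diff linear_scale)
    have "q (c *\<^sub>C x) = Re c * q x + Im c * q (\<i> *\<^sub>C x)"
      using c q(1) by (simp add: linear_add linear_scale)
    then show ?thesis using ic by (simp add: g_def complex_eq_iff algebra_simps)
  qed
  have g_le: "cmod (g x) \<le> p x" for x
  proof (cases "g x = 0")
    case True
    then show ?thesis
      using q(2)[of x] q(2)[of "- x"] q(1) scale[of "-1" x]
      by (simp add: linear_neg complex_vector.scale_minus_left scaleC_one)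
  next
    case False
    define c where "c = cnj (g x) / cmod (g x)"
    have "c * g x = cmod (g x)"
      using False unfolding c_def
      by (simp add: complex_norm_square[symmetric] mult.commute power2_eq_square field_simps)
    then have "complex_of_real (cmod (g x)) = g (c *\<^sub>C x)" by (simp add: g_scale)
    then have "cmod (g x) = q (c *\<^sub>C x)" by (simp add: g_def complex_eq_iff)
    also have "\<dots> \<le> p (c *\<^sub>C x)" by (rule q(2))
    also have "\<dots> \<le> cmod c * p x" by (rule scale)
    also have "cmod c = 1" using False by (simp add: c_def norm_divide)
    finally show ?thesis by simp
  qed
  have "bounded_linear g"
  proof (rule bounded_linear_intro)
    show "g (r *\<^sub>R x) = r *\<^sub>R g x" for r x
      using g_scale[of "complex_of_real r" x] by (simp add: scaleC_of_real scaleR_conv_of_real)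
    show "norm (g x) \<le> norm x * K" for x
      using g_le[of x] bound[of x] by (simp add: mult.commute)
  qed (rule g_add)
  then have ap: "blinfun_apply (Blinfun g) = g" by (rule bounded_linear_Blinfun_apply)
  have "g x0 = complex_of_real (p x0)"
  proof -
    have "Re (g x0) = p x0" by (simp add: g_def q(3))
    moreover have "Im (g x0) = 0"
    proof -
      have "(Re (g x0))\<^sup>2 + (Im (g x0))\<^sup>2 \<le> (p x0)\<^sup>2"
        unfolding cmod_power2[symmetric] using g_le[of x0] by (intro power_mono) auto
      then show ?thesis using \<open>Re (g x0) = p x0\<close> by simp
    qed
    ultimately show ?thesis by (simp add: complex_eq_iff)
  qed
  then show thesis using g_le g_scale ap
    by (intro that[of "Blinfun g"]) (auto simp: cdual_def)
qed

section \<open>Distance to a subspace\<close>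

lemma infdist_greatest: "A \<noteq> {} \<Longrightarrow> (\<And>a. a \<in> A \<Longrightarrow> c \<le> dist x a) \<Longrightarrow> c \<le> infdist x A"
  unfolding infdist_def by (auto intro: cINF_greatest)

lemma infdist_subspace_le:
  fixes R :: "'a::real_normed_vector set"
  shows "r \<in> R \<Longrightarrow> infdist x R \<le> norm (x - r)"
  using infdist_le[of r R x] by (simp add: dist_norm)

lemma infdist_subspace_add:
  fixes x y :: "'a::complex_normed_vector"
  assumes R: "csubspace R"
  shows "infdist (x + y) R \<le> infdist x R + infdist y R"
proof -
  have ne: "R \<noteq> {}" using complex_vector.subspace_0[OF R] by blast
  have le: "infdist (x + y) R \<le> dist x a + dist y b" if "a \<in> R" "b \<in> R" for a b
  proof -
    have "infdist (x + y) R \<le> dist (x + y) (a + b)"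
      using complex_vector.subspace_add[OF R that] by (rule infdist_le)
    also have "\<dots> \<le> dist x a + dist y b" by (rule dist_triangle_add)
    finally show ?thesis .
  qed
  have "infdist (x + y) R - dist y b \<le> infdist x R" if "b \<in> R" for b
    using le that ne by (intro infdist_greatest) (simp_all add: algebra_simps)
  then have "infdist (x + y) R - infdist x R \<le> infdist y R"
    using ne by (intro infdist_greatest) (simp_all add: algebra_simps)
  then show ?thesis by simp
qed

lemma infdist_subspace_scale:
  fixes x :: "'a::complex_normed_vector"
  assumes R: "csubspace R"
  shows "infdist (c *\<^sub>C x) R = cmod c * infdist x R"
proof -
  have ne: "R \<noteq> {}" using complex_vector.subspace_0[OF R] by blast
  have le: "infdist (c *\<^sub>C x) R \<le> cmod c * infdist x R" for c and x :: 'a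
  proof (cases "c = 0")
    case True
    then show ?thesis using complex_vector.subspace_0[OF R] by (simp add: infdist_zero)
  next
    case False
    have "infdist (c *\<^sub>C x) R / cmod c \<le> dist x a" if "a \<in> R" for a
    proof -
      have "infdist (c *\<^sub>C x) R \<le> norm (c *\<^sub>C x - c *\<^sub>C a)"
        using complex_vector.subspace_scale[OF R that] by (rule infdist_subspace_le)
      also have "\<dots> = cmod c * dist x a"
        by (simp add: complex_vector.scale_right_diff_distrib[symmetric] norm_scaleC dist_norm)
      finally show ?thesis using False by (simp add: field_simps)
    qed
    then have "infdist (c *\<^sub>C x) R / cmod c \<le> infdist x R" using ne by (intro infdist_greatest) auto
    then show ?thesis using False by (simp add: field_simps)
  qed
  show ?thesis
  proof (cases "c = 0")
    case True
    then show ?thesis using complex_vector.subspace_0[OF R] by (simp add: infdist_zero)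
  next
    case False
    have "infdist x R \<le> cmod (inverse c) * infdist (c *\<^sub>C x) R"
      using le[of "inverse c" "c *\<^sub>C x"] False by (simp add: scaleC_scaleC scaleC_one)
    then have "cmod c * infdist x R \<le> infdist (c *\<^sub>C x) R"
      using False by (simp add: norm_divide norm_inverse field_simps)
    then show ?thesis using le[of c x] by simp
  qed
qed

lemma infdist_closed_subspace_eq_0_iff:
  fixes x :: "'a::complex_normed_vector"
  assumes "csubspace R" "closed R"
  shows "infdist x R = 0 \<longleftrightarrow> x \<in> R"
  using assms in_closed_iff_infdist_zero complex_vector.subspace_0 by (metis empty_iff)

text \<open>
  Hahn-Banach for the seminorm \<open>\<lambda>x. infdist x R\<close>, normalized at \<open>x0\<close>.
\<close>

lemma separating_functional:
  fixes x0 :: "'a::complex_normed_vector"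
  assumes R: "csubspace R" "closed R" and x0: "x0 \<notin> R"
  obtains f where "f \<in> cdual" "blinfun_apply f x0 = 1" "\<And>r. r \<in> R \<Longrightarrow> blinfun_apply f r = 0"
proof -
  have "infdist x R \<le> 1 * norm x" for x
    using infdist_subspace_le[OF complex_vector.subspace_0[OF R(1)], of x] by simp
  then obtain g where g: "g \<in> cdual" "\<And>x. cmod (blinfun_apply g x) \<le> infdist x R"
      "blinfun_apply g x0 = complex_of_real (infdist x0 R)"
    using Hahn_Banach_seminorm[of "\<lambda>x. infdist x R" 1 x0, OF infdist_subspace_add[OF R(1)]]
    infdist_subspace_scale[OF R(1)] by (metis order_refl)
  let ?d = "complex_of_real (infdist x0 R)"
  have d: "?d \<noteq> 0" using infdist_closed_subspace_eq_0_iff[OF R] x0 by simp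
  show thesis
  proof (rule that[of "inverse ?d *\<^sub>C g"])
    show "inverse ?d *\<^sub>C g \<in> cdual"
      using g(1) by (rule complex_vector.subspace_scale[OF csubspace_cdual])
    show "blinfun_apply (inverse ?d *\<^sub>C g) x0 = 1"
      using d g(3) by (simp add: blinfun_apply_scaleC scaleC_complex_def)
    show "blinfun_apply (inverse ?d *\<^sub>C g) r = 0" if "r \<in> R" for r
      using g(2)[of r] that by (simp add: blinfun_apply_scaleC scaleC_complex_def infdist_zero)
  qed
qed

section \<open>Dimension and codimension\<close>

definition subspace_sum :: "'a::complex_normed_vector set \<Rightarrow> 'a set \<Rightarrow> 'a set"
  where "subspace_sum M N = {m + n | m n. m \<in> M \<and> n \<in> N}"

definition clinear_on ::
  "'a::complex_normed_vector set \<Rightarrow> ('a \<Rightarrow> 'b::complex_normed_vector) \<Rightarrow> bool"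
  where "clinear_on V T \<longleftrightarrow>
    (\<forall>x\<in>V. \<forall>y\<in>V. T (x + y) = T x + T y) \<and> (\<forall>c. \<forall>x\<in>V. T (c *\<^sub>C x) = c *\<^sub>C T x)"

lemma direct_sum_iff: "direct_sum X M N \<longleftrightarrow> M \<inter> N = {0} \<and> X = subspace_sum M N"
  by (simp add: direct_sum_def subspace_sum_def)

lemma csubspace_sum: "csubspace M \<Longrightarrow> csubspace N \<Longrightarrow> csubspace (subspace_sum M N)"
  unfolding subspace_sum_def by (rule complex_vector.subspace_sums)

lemma subspace_sumI: "m \<in> M \<Longrightarrow> n \<in> N \<Longrightarrow> m + n \<in> subspace_sum M N"
  unfolding subspace_sum_def by blast

lemma subspace_sumE:
  assumes "x \<in> subspace_sum M N" obtains m n where "m \<in> M" "n \<in> N" "x = m + n"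
  using assms unfolding subspace_sum_def by blast

lemma subspace_sum_commute: "subspace_sum M N = subspace_sum N M"
  unfolding subspace_sum_def by (metis add.commute)

lemma subspace_sum_upper1: "csubspace N \<Longrightarrow> M \<subseteq> subspace_sum M N"
  using subspace_sumI[of _ M 0 N] complex_vector.subspace_0 by fastforce

lemma subspace_sum_upper2: "csubspace M \<Longrightarrow> N \<subseteq> subspace_sum M N"
  using subspace_sum_upper1 subspace_sum_commute by metis

lemma subspace_sum_least:
  "csubspace X \<Longrightarrow> M \<subseteq> X \<Longrightarrow> N \<subseteq> X \<Longrightarrow> subspace_sum M N \<subseteq> X"
  by (auto elim!: subspace_sumE intro!: complex_vector.subspace_add)

lemma subspace_sum_zero [simp]: "subspace_sum A {0} = A" "subspace_sum {0} A = A"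
  by (auto simp: subspace_sum_def)

lemma subspace_sum_assoc:
  "subspace_sum (subspace_sum A B) C = subspace_sum A (subspace_sum B C)"
proof (intro equalityI subsetI)
  fix x assume "x \<in> subspace_sum (subspace_sum A B) C"
  then obtain a b c where "a \<in> A" "b \<in> B" "c \<in> C" "x = a + (b + c)"
    by (auto elim!: subspace_sumE simp: add.assoc)
  then show "x \<in> subspace_sum A (subspace_sum B C)" by (auto intro!: subspace_sumI)
next
  fix x assume "x \<in> subspace_sum A (subspace_sum B C)"
  then obtain a b c where "a \<in> A" "b \<in> B" "c \<in> C" "x = (a + b) + c"
    by (auto elim!: subspace_sumE simp: add.assoc)
  then show "x \<in> subspace_sum (subspace_sum A B) C" by (auto intro!: subspace_sumI)
qed

lemma direct_sumI:
  assumes "csubspace M" "csubspace N" "M \<inter> N \<subseteq> {0}" "X = subspace_sum M N"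
  shows "direct_sum X M N"
proof -
  have "0 \<in> M \<inter> N"
    using complex_vector.subspace_0[OF assms(1)] complex_vector.subspace_0[OF assms(2)] by simp
  then show ?thesis using assms(3,4) by (auto simp: direct_sum_iff)
qed

lemma direct_sum_commute: "direct_sum X M N \<longleftrightarrow> direct_sum X N M"
  by (metis direct_sum_iff inf_commute subspace_sum_commute)

lemma direct_sum_unique:
  assumes "direct_sum X M N" "csubspace M" "csubspace N"
    and "m \<in> M" "n \<in> N" "m' \<in> M" "n' \<in> N" "m + n = m' + n'"
  shows "m = m'" "n = n'"
proof -
  have "m - m' = n' - n" using assms(8) by (simp add: algebra_simps)
  moreover have "m - m' \<in> M" "n' - n \<in> N"
    using assms complex_vector.subspace_diff by blast+
  ultimately have "m - m' \<in> M \<inter> N" by simp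
  then have "m - m' = 0" using assms(1) unfolding direct_sum_iff by blast
  then show "m = m'" by simp
  then show "n = n'" using assms(8) by simp
qed

lemma direct_sum_zero:
  assumes "direct_sum X M N" "csubspace M" "csubspace N" "m \<in> M" "n \<in> N" "m + n = 0"
  shows "m = 0" "n = 0"
  using direct_sum_unique[OF assms(1-5), of 0 0] assms(6)
    complex_vector.subspace_0[OF assms(2)] complex_vector.subspace_0[OF assms(3)] by simp_all

lemma direct_sum_supsets:
  assumes "direct_sum X M N" "csubspace M" "csubspace N"
  shows "M \<subseteq> X" "N \<subseteq> X"
proof -
  have X: "X = subspace_sum M N" using assms(1) by (simp add: direct_sum_iff)
  show "M \<subseteq> X" unfolding X by (rule subspace_sum_upper1[OF assms(3)])
  show "N \<subseteq> X" unfolding X by (rule subspace_sum_upper2[OF assms(2)])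
qed

lemma direct_sum_csubspace:
  "direct_sum X M N \<Longrightarrow> csubspace M \<Longrightarrow> csubspace N \<Longrightarrow> csubspace X"
  by (simp add: direct_sum_iff csubspace_sum)

lemma direct_sum_assoc:
  assumes 1: "direct_sum X L D" and 2: "direct_sum L R C"
    and sub: "csubspace R" "csubspace C" "csubspace D"
  shows "direct_sum X R (subspace_sum C D)" "direct_sum (subspace_sum C D) C D"
proof -
  have L: "csubspace L" "R \<subseteq> L" "C \<subseteq> L"
    using direct_sum_csubspace[OF 2 sub(1,2)] direct_sum_supsets[OF 2 sub(1,2)] by simp_all
  have "C \<inter> D \<subseteq> {0}" using 1 L(3) by (auto simp: direct_sum_iff)
  then show "direct_sum (subspace_sum C D) C D" by (rule direct_sumI[OF sub(2,3) _ refl])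
  have "R \<inter> subspace_sum C D \<subseteq> {0}"
  proof
    fix x assume x: "x \<in> R \<inter> subspace_sum C D"
    then obtain c d where cd: "c \<in> C" "d \<in> D" "x = c + d" by (auto elim: subspace_sumE)
    then have "x - c \<in> L" using x L complex_vector.subspace_diff by blast
    then have "d \<in> L \<inter> D" using cd by simp
    then have "d = 0" using 1 by (auto simp: direct_sum_iff)
    then have "x \<in> R \<inter> C" using x cd by simp
    then show "x \<in> {0}" using 2 by (auto simp: direct_sum_iff)
  qed
  moreover have "X = subspace_sum R (subspace_sum C D)"
  proof -
    have "X = subspace_sum (subspace_sum R C) D" using 1 2 by (simp add: direct_sum_iff)
    also have "\<dots> = subspace_sum R (subspace_sum C D)" by (rule subspace_sum_assoc)
    finally show ?thesis .
  qed
  ultimately show "direct_sum X R (subspace_sum C D)"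
    using direct_sumI[OF sub(1) csubspace_sum[OF sub(2,3)]] by blast
qed

lemma obtain_basis:
  assumes "csubspace V"
  obtains B where "B \<subseteq> V" "\<not> cdependent B" "cspan B = V"
proof -
  obtain B where B: "B \<subseteq> V" "\<not> cdependent B" "V \<subseteq> cspan B"
    by (rule complex_vector.maximal_independent_subset[of V])
  then show thesis using that complex_vector.span_minimal[OF B(1) assms] by blast
qed

lemma ccdim_span_independent:
  assumes "\<not> cdependent B"
  shows "ccdim (cspan B) = (if finite B then enat (card B) else \<infinity>)"
proof (cases "finite B")
  case True
  then show ?thesis using complex_vector.dim_span_eq_card_independent[OF assms]
    by (auto simp: ccdim_def)
next
  case False
  have "\<not> (\<exists>F. finite F \<and> cspan B \<subseteq> cspan F)"
    using False complex_vector.independent_span_bound[OF _ assms] complex_vector.span_superset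
    by (metis subset_trans)
  then show ?thesis using False by (simp add: ccdim_def)
qed

lemma ccdim_less_infinity_iff: "ccdim V < \<infinity> \<longleftrightarrow> (\<exists>B. finite B \<and> V \<subseteq> cspan B)"
  by (simp add: ccdim_def)

lemma ccdim_le_card:
  assumes "finite F" "V \<subseteq> cspan F"
  shows "ccdim V \<le> enat (card F)"
  using assms complex_vector.dim_le_card[OF assms(2,1)] by (auto simp: ccdim_def)

lemma obtain_finite_basis:
  assumes "csubspace V" "ccdim V < \<infinity>"
  obtains B where "finite B" "B \<subseteq> V" "\<not> cdependent B" "cspan B = V" "ccdim V = enat (card B)"
proof -
  obtain B where B: "B \<subseteq> V" "\<not> cdependent B" "cspan B = V" using obtain_basis[OF assms(1)] .
  then show thesis using that[of B] ccdim_span_independent[OF B(2)] assms(2)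
    by (auto split: if_splits)
qed

lemma ccdim_mono:
  assumes "csubspace V" "V \<subseteq> W"
  shows "ccdim V \<le> ccdim W"
proof (cases "ccdim W < \<infinity>")
  case True
  then obtain F where F: "finite F" "W \<subseteq> cspan F" unfolding ccdim_less_infinity_iff by blast
  obtain B where B: "B \<subseteq> W" "\<not> cdependent B" "W \<subseteq> cspan B" "card B = cdim W"
    by (rule complex_vector.basis_exists[of W])
  have "finite B" using complex_vector.independent_span_bound[OF F(1) B(2)] B(1) F(2) by blast
  then have "ccdim V \<le> enat (card B)" using assms(2) B(3) by (intro ccdim_le_card) auto
  also have "\<dots> = ccdim W" using B(4) F by (auto simp: ccdim_def)
  finally show ?thesis .
qed simp

lemma ccdim_eq_0_iff:
  assumes "csubspace V"
  shows "ccdim V = 0 \<longleftrightarrow> V = {0}"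
proof
  assume 0: "ccdim V = 0"
  then obtain B where B: "finite B" "cspan B = V" "ccdim V = enat (card B)"
    using obtain_finite_basis[OF assms] by (metis enat_ord_simps(4) i0_ne_infinity)
  then have "B = {}" using 0 by (simp add: zero_enat_def)
  then show "V = {0}" using B by simp
next
  assume "V = {0}"
  then show "ccdim V = 0" using ccdim_le_card[of "{}" V] by (simp add: zero_enat_def[symmetric])
qed

lemma ccdim_zero [simp]: "ccdim {0} = 0"
  using ccdim_eq_0_iff[of "{0}"] complex_vector.subspace_single_0 by simp

text \<open>
  The union of bases of the summands is a basis: a vector of one basis in the span of the others
  would be a sum \<open>u + v\<close>, with \<open>v\<close> in both summands and hence zero.
\<close>

lemma ccdim_direct_sum:
  assumes ds: "direct_sum X M N" and sub: "csubspace M" "csubspace N"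
  shows "ccdim X = ccdim M + ccdim N"
proof -
  obtain A where A: "A \<subseteq> M" "\<not> cdependent A" "cspan A = M" by (rule obtain_basis[OF sub(1)])
  obtain B where B: "B \<subseteq> N" "\<not> cdependent B" "cspan B = N" by (rule obtain_basis[OF sub(2)])
  have int: "M \<inter> N = {0}" and X: "X = subspace_sum M N" using ds by (simp_all add: direct_sum_iff)
  have disj: "A \<inter> B = {}"
  proof (rule ccontr)
    assume "A \<inter> B \<noteq> {}"
    then obtain a where a: "a \<in> A" "a \<in> B" by auto
    then have "a \<in> M \<inter> N" using A(1) B(1) by auto
    then have "a = 0" unfolding int by simp
    then show False using A(2) a(1) complex_vector.dependent_zero[of A] by simp
  qed
  have key: "a \<notin> cspan (U \<union> V - {a})"
    if a: "a \<in> U" "a \<notin> V" and U: "\<not> cdependent U" and UV: "cspan U \<inter> cspan V = {0}"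
    for a and U V :: "'a set"
  proof
    assume "a \<in> cspan (U \<union> V - {a})"
    moreover have "U \<union> V - {a} = (U - {a}) \<union> V" using a by auto
    ultimately have "a \<in> subspace_sum (cspan (U - {a})) (cspan V)"
      by (simp add: complex_vector.span_Un subspace_sum_def)
    then obtain u v where uv: "u \<in> cspan (U - {a})" "v \<in> cspan V" "a = u + v"
      by (rule subspace_sumE)
    have "u \<in> cspan U" using uv(1) complex_vector.span_mono[of "U - {a}" U] by auto
    then have "a - u \<in> cspan U" by (rule complex_vector.span_diff[OF complex_vector.span_base[OF a(1)]])
    then have "v \<in> cspan U \<inter> cspan V" using uv(2,3) by simp
    then have "v = 0" unfolding UV by simp
    then have "a \<in> cspan (U - {a})" using uv by simp
    then show False using U a(1) by (auto simp: complex_vector.dependent_def)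
  qed
  have "\<not> cdependent (A \<union> B)"
    unfolding complex_vector.dependent_def
  proof
    assume "\<exists>a\<in>A \<union> B. a \<in> cspan (A \<union> B - {a})"
    then obtain a where a: "a \<in> A \<union> B" "a \<in> cspan (A \<union> B - {a})" by blast
    show False
    proof (cases "a \<in> A")
      case True
      then have "a \<notin> B" using disj by auto
      then show False using key[OF True _ A(2), of B] a(2) int unfolding A(3) B(3) by simp
    next
      case False
      then have "a \<in> B" using a(1) by simp
      then show False using key[OF _ False B(2)] a(2) int unfolding A(3) B(3)
        by (simp add: Un_commute Int_commute)
    qed
  qed
  then have "ccdim (cspan (A \<union> B)) = (if finite (A \<union> B) then enat (card (A \<union> B)) else \<infinity>)"
    by (rule ccdim_span_independent)
  moreover have "cspan (A \<union> B) = X"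
    using A(3) B(3) X by (simp add: complex_vector.span_Un subspace_sum_def)
  ultimately show ?thesis
    using ccdim_span_independent[OF A(2)] ccdim_span_independent[OF B(2)]
    unfolding A(3) B(3) by (simp add: card_Un_disjoint[OF _ _ disj])
qed

lemma obtain_complement:
  assumes "csubspace R" "csubspace M" "R \<subseteq> M"
  obtains C where "csubspace C" "direct_sum M R C" "C \<subseteq> M" "ccodim M R = ccdim C"
proof -
  obtain C where C: "csubspace C" "direct_sum M R C" using ex_complement[OF assms] by blast
  show thesis
    by (rule that[OF C direct_sum_supsets(2)[OF C(2) assms(1) C(1)] ccodim_eq[OF assms(1) C]])
qed

lemma ccdim_eq_add_ccodim:
  assumes "csubspace R" "csubspace M" "R \<subseteq> M"
  shows "ccdim M = ccdim R + ccodim M R"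
proof -
  obtain C where C: "csubspace C" "direct_sum M R C" "C \<subseteq> M" "ccodim M R = ccdim C"
    by (rule obtain_complement[OF assms])
  show ?thesis using ccdim_direct_sum[OF C(2) assms(1) C(1)] C(4) by simp
qed

lemma ccodim_chain:
  assumes sub: "csubspace R" "csubspace L" "csubspace M" and "R \<subseteq> L" "L \<subseteq> M"
  shows "ccodim M R = ccodim M L + ccodim L R"
proof -
  obtain C where C: "csubspace C" "direct_sum L R C" "C \<subseteq> L" "ccodim L R = ccdim C"
    by (rule obtain_complement[OF sub(1,2) assms(4)])
  obtain D where D: "csubspace D" "direct_sum M L D" "D \<subseteq> M" "ccodim M L = ccdim D"
    by (rule obtain_complement[OF sub(2,3) assms(5)])
  note ds = direct_sum_assoc[OF D(2) C(2) sub(1) C(1) D(1)]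
  have "ccodim M R = ccdim (subspace_sum C D)"
    using ds(1) C D sub by (intro ccodim_eq csubspace_sum) auto
  also have "\<dots> = ccdim C + ccdim D" using ds(2) C D by (intro ccdim_direct_sum) auto
  finally show ?thesis using C D by (simp add: add.commute)
qed

lemma ccodim_eq_0_iff:
  assumes "csubspace R" "csubspace M" "R \<subseteq> M"
  shows "ccodim M R = 0 \<longleftrightarrow> R = M"
proof -
  obtain C where C: "csubspace C" "direct_sum M R C" "C \<subseteq> M" "ccodim M R = ccdim C"
    by (rule obtain_complement[OF assms])
  have "C = {0} \<longleftrightarrow> R = M"
  proof
    assume "C = {0}"
    then show "R = M" using C(2) by (auto simp: direct_sum_iff subspace_sum_def)
  next
    assume "R = M"
    then show "C = {0}" using C direct_sum_supsets(2)[OF C(2) assms(1) C(1)]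
      by (auto simp: direct_sum_iff)
  qed
  then show ?thesis using C(4) ccdim_eq_0_iff[OF C(1)] by simp
qed

lemma ccodim_zero: "csubspace M \<Longrightarrow> ccodim M {0} = ccdim M"
  using ccdim_eq_add_ccodim[of "{0}" M] complex_vector.subspace_single_0
    complex_vector.subspace_0[of M] by simp

section \<open>Linear maps and dimension\<close>

lemma
  assumes "clinear_on V T"
  shows clinear_on_add: "x \<in> V \<Longrightarrow> y \<in> V \<Longrightarrow> T (x + y) = T x + T y"
    and clinear_on_scale: "x \<in> V \<Longrightarrow> T (c *\<^sub>C x) = c *\<^sub>C T x"
  using assms by (auto simp: clinear_on_def)

lemma
  assumes "clinear_on V T" "csubspace V"
  shows clinear_on_zero: "T 0 = 0"
    and clinear_on_diff: "x \<in> V \<Longrightarrow> y \<in> V \<Longrightarrow> T (x - y) = T x - T y"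
    and csubspace_image: "csubspace W \<Longrightarrow> W \<subseteq> V \<Longrightarrow> csubspace (T ` W)"
proof -
  show zero: "T 0 = 0"
    using clinear_on_scale[OF assms(1), of 0 0] complex_vector.subspace_0[OF assms(2)] by simp
  show "T (x - y) = T x - T y" if "x \<in> V" "y \<in> V" for x y
  proof -
    have "T (x + (-1) *\<^sub>C y) = T x + (-1) *\<^sub>C T y"
      using that assms complex_vector.subspace_scale[OF assms(2)]
      by (metis clinear_on_add clinear_on_scale)
    then show ?thesis by (simp add: complex_vector.scale_minus_left scaleC_one)
  qed
  show "csubspace (T ` W)" if W: "csubspace W" "W \<subseteq> V"
    unfolding complex_vector.subspace_def
  proof (intro conjI ballI allI)
    show "0 \<in> T ` W" using zero complex_vector.subspace_0[OF W(1)] by force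
    show "x + y \<in> T ` W" if "x \<in> T ` W" "y \<in> T ` W" for x y
      using that W clinear_on_add[OF assms(1)] complex_vector.subspace_add[OF W(1)]
      by (auto simp: image_iff) (metis subsetD)
    show "c *\<^sub>C x \<in> T ` W" if "x \<in> T ` W" for c x
      using that W clinear_on_scale[OF assms(1)] complex_vector.subspace_scale[OF W(1)]
      by (auto simp: image_iff) (metis subsetD)
  qed
qed

lemma image_subspace_sum:
  assumes T: "clinear_on M T" and "L \<subseteq> M" "C \<subseteq> M"
  shows "T ` subspace_sum L C = subspace_sum (T ` L) (T ` C)"
proof -
  have add: "T (l + c) = T l + T c" if "l \<in> L" "c \<in> C" for l c
    using clinear_on_add[OF T] that assms(2,3) by blast
  show ?thesis
  proof (intro equalityI subsetI)
    fix y assume "y \<in> T ` subspace_sum L C"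
    then obtain l c where "l \<in> L" "c \<in> C" "y = T (l + c)" by (auto elim!: subspace_sumE)
    then show "y \<in> subspace_sum (T ` L) (T ` C)" using add by (auto intro: subspace_sumI)
  next
    fix y assume "y \<in> subspace_sum (T ` L) (T ` C)"
    then obtain l c where lc: "l \<in> L" "c \<in> C" "y = T l + T c" by (auto elim!: subspace_sumE)
    then have "y = T (l + c)" using add by simp
    then show "y \<in> T ` subspace_sum L C" using subspace_sumI[OF lc(1,2)] by (rule image_eqI)
  qed
qed

lemma clinear_on_subset: "clinear_on V T \<Longrightarrow> W \<subseteq> V \<Longrightarrow> clinear_on W T"
  unfolding clinear_on_def by blast

lemma csubspace_kernel:
  assumes "clinear_on V T" "csubspace V"
  shows "csubspace (kernel V T)"
  using assms clinear_on_zero[OF assms] unfolding complex_vector.subspace_def kernel_def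
  by (auto simp: clinear_on_add clinear_on_scale)

lemma ccdim_image_le:
  assumes T: "clinear_on V T" and V: "csubspace V"
  shows "ccdim (T ` V) \<le> ccdim V"
proof (cases "ccdim V < \<infinity>")
  case True
  obtain B where B: "finite B" "B \<subseteq> V" "cspan B = V" "ccdim V = enat (card B)"
    using obtain_finite_basis[OF V True] by metis
  have "x \<in> V \<and> T x \<in> cspan (T ` B)" if "x \<in> cspan B" for x
    using that
  proof (induction rule: complex_vector.span_induct_alt)
    case base
    then show ?case
      using clinear_on_zero[OF T V] complex_vector.subspace_0[OF V] complex_vector.span_zero by simp
  next
    case (step c x y)
    then have "x \<in> V" using B by blast
    then have "T (c *\<^sub>C x + y) = c *\<^sub>C T x + T y"
      using T step complex_vector.subspace_scale[OF V] by (simp add: clinear_on_add clinear_on_scale)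
    moreover have "c *\<^sub>C T x + T y \<in> cspan (T ` B)"
      using step by (intro complex_vector.span_add complex_vector.span_scale)
        (auto intro: complex_vector.span_base)
    ultimately show ?case
      using \<open>x \<in> V\<close> step V by (auto intro: complex_vector.subspace_add complex_vector.subspace_scale)
  qed
  then have "T ` V \<subseteq> cspan (T ` B)" using B(3) by blast
  then have "ccdim (T ` V) \<le> enat (card (T ` B))" using B(1) by (intro ccdim_le_card) auto
  also have "\<dots> \<le> ccdim V" using B card_image_le by simp
  finally show ?thesis .
qed simp

lemma ccdim_image_inj:
  assumes T: "clinear_on V T" and V: "csubspace V" and ker: "kernel V T = {0}"
  shows "ccdim (T ` V) = ccdim V"
proof (rule antisym)
  show "ccdim (T ` V) \<le> ccdim V" using ccdim_image_le[OF T V] .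
  have inj: "inj_on T V"
  proof (rule inj_onI)
    fix x y assume xy: "x \<in> V" "y \<in> V" "T x = T y"
    then have "x - y \<in> kernel V T"
      using V by (simp add: kernel_def clinear_on_diff[OF T V] complex_vector.subspace_diff)
    then show "x = y" using ker by simp
  qed
  let ?S = "inv_into V T"
  have S: "?S (T x) = x" if "x \<in> V" for x using inj that by simp
  have "clinear_on (T ` V) ?S"
    unfolding clinear_on_def
  proof (intro conjI ballI allI)
    show "?S (x + y) = ?S x + ?S y" if "x \<in> T ` V" "y \<in> T ` V" for x y
      using that S V by (auto simp: clinear_on_add[OF T, symmetric] complex_vector.subspace_add)
    show "?S (c *\<^sub>C x) = c *\<^sub>C ?S x" if "x \<in> T ` V" for c x
      using that S V by (auto simp: clinear_on_scale[OF T, symmetric] complex_vector.subspace_scale)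
  qed
  moreover have "?S ` T ` V = V" using inj by simp
  ultimately show "ccdim V \<le> ccdim (T ` V)"
    using ccdim_image_le[of "T ` V" ?S] csubspace_image[OF T V V] by simp
qed

text \<open>
  A linear map \<open>T\<close> loses exactly its kernel. With \<open>K'\<close> a complement of \<open>kernel Y T\<close> in
  \<open>kernel M T\<close> and \<open>C\<close> a complement of \<open>Y + K'\<close> in \<open>M\<close>, both sides are \<open>ccdim (kernel Y T)\<close> plus
  \<open>ccdim K' + ccdim C\<close>. Writing sums instead of differences avoids \<open>\<infinity> - \<infinity>\<close>.
\<close>

lemma ccodim_image:
  assumes T: "clinear_on M T" and sub: "csubspace M" "csubspace Y" and "Y \<subseteq> M"
  shows "ccodim M Y + ccdim (kernel Y T) = ccodim (T ` M) (T ` Y) + ccdim (kernel M T)"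
proof -
  have TY: "clinear_on Y T" using T assms(4) by (rule clinear_on_subset)
  let ?N = "kernel M T" and ?K = "kernel Y T"
  have N: "csubspace ?N" "csubspace ?K" "?K \<subseteq> ?N" "?N \<subseteq> M"
    using csubspace_kernel T TY sub assms(4) by (auto simp: kernel_def)
  obtain K' where K': "csubspace K'" "direct_sum ?N ?K K'" "K' \<subseteq> ?N" "ccodim ?N ?K = ccdim K'"
    by (rule obtain_complement[OF N(2,1,3)])
  have YK: "direct_sum (subspace_sum Y K') Y K'"
  proof (rule direct_sumI[OF sub(2) K'(1) _ refl])
    have "Y \<inter> K' \<subseteq> ?K \<inter> K'" using K'(3) by (auto simp: kernel_def)
    also have "\<dots> = {0}" using K'(2) by (simp add: direct_sum_iff)
    finally show "Y \<inter> K' \<subseteq> {0}" .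
  qed
  have L: "csubspace (subspace_sum Y K')" "subspace_sum Y K' \<subseteq> M"
    using csubspace_sum[OF sub(2) K'(1)] subspace_sum_least[OF sub(1) assms(4)] K'(3) N(4)
    by auto
  obtain C where C: "csubspace C" "direct_sum M (subspace_sum Y K') C" "C \<subseteq> M"
      "ccodim M (subspace_sum Y K') = ccdim C"
    by (rule obtain_complement[OF L(1) sub(1) L(2)])
  note ds = direct_sum_assoc[OF C(2) YK sub(2) K'(1) C(1)]
  have TC: "clinear_on C T" using T C(3) by (rule clinear_on_subset)
  have "ccodim M Y = ccdim K' + ccdim C"
    using ccodim_eq[OF sub(2) csubspace_sum[OF K'(1) C(1)] ds(1)]
      ccdim_direct_sum[OF ds(2) K'(1) C(1)] by simp
  moreover have "ccdim ?N = ccdim ?K + ccdim K'" using ccdim_direct_sum[OF K'(2) N(2) K'(1)] .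
  moreover have "ccodim (T ` M) (T ` Y) = ccdim C"
  proof -
    have key: "c = 0" if "y \<in> Y" "c \<in> C" "T y = T c" for y c
    proof -
      have yc: "y \<in> M" "c \<in> M" using that assms(4) C(3) by auto
      have "y - c \<in> ?N"
        using that yc sub by (simp add: kernel_def clinear_on_diff[OF T sub(1)] complex_vector.subspace_diff)
      then obtain k k' where k: "k \<in> ?K" "k' \<in> K'" "y - c = k + k'"
        using K'(2) unfolding direct_sum_iff by (metis subspace_sumE)
      then have c: "c = (y - k) + (- k')" by (simp add: algebra_simps)
      have "y - k \<in> Y"
        using k that sub by (auto simp: kernel_def intro: complex_vector.subspace_diff)
      moreover have "- k' \<in> K'" using k K' complex_vector.subspace_neg by blast
      ultimately have "c \<in> subspace_sum Y K'" unfolding c by (rule subspace_sumI)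
      then have "c \<in> subspace_sum Y K' \<inter> C" using that(2) by (rule IntI)
      then show ?thesis using C(2) by (auto simp: direct_sum_iff)
    qed
    have TY0: "T ` Y \<inter> T ` C \<subseteq> {0}"
    proof
      fix z assume "z \<in> T ` Y \<inter> T ` C"
      then obtain y c where yc: "y \<in> Y" "c \<in> C" "z = T y" "z = T c" by blast
      then have "c = 0" using key[of y c] by simp
      then show "z \<in> {0}" using yc clinear_on_zero[OF T sub(1)] by simp
    qed
    have "T ` K' = {0}"
      using K'(3) complex_vector.subspace_0[OF K'(1)] clinear_on_zero[OF T sub(1)]
      by (force simp: kernel_def)
    moreover have "M = subspace_sum (subspace_sum Y K') C" using C(2) by (simp add: direct_sum_iff)
    ultimately have TM: "T ` M = subspace_sum (T ` Y) (T ` C)"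
      using image_subspace_sum[OF T L(2) C(3)] image_subspace_sum[OF T assms(4), of K'] K'(3) N(4)
      by simp
    have sTC: "csubspace (T ` Y)" "csubspace (T ` C)"
      using csubspace_image[OF T sub(1)] sub C assms(4) by simp_all
    have "ccodim (T ` M) (T ` Y) = ccdim (T ` C)"
      by (rule ccodim_eq[OF sTC direct_sumI[OF sTC TY0 TM]])
    moreover have "kernel C T = {0}"
    proof
      show "kernel C T \<subseteq> {0}"
        using key[of 0] clinear_on_zero[OF T sub(1)] complex_vector.subspace_0[OF sub(2)]
        by (auto simp: kernel_def)
    qed (use clinear_on_zero[OF T sub(1)] complex_vector.subspace_0[OF C(1)] in \<open>auto simp: kernel_def\<close>)
    ultimately show ?thesis using ccdim_image_inj[OF TC C(1)] by simp
  qed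
  ultimately show ?thesis by (simp add: ac_simps)
qed

text \<open>
  Passing to a subspace \<open>Y\<close> of finite codimension changes the index by that codimension. Two
  operators agreeing on \<open>Y\<close> can therefore be compared through this equation.
\<close>

lemma index_on_subspace:
  assumes T: "clinear_on M T" and sub: "csubspace M" "csubspace Y" and "Y \<subseteq> M" "T ` M \<subseteq> M"
  shows "ccodim M (T ` M) + ccodim M Y + ccdim (kernel Y T) = ccodim M (T ` Y) + ccdim (kernel M T)"
proof -
  have "ccodim M (T ` Y) = ccodim M (T ` M) + ccodim (T ` M) (T ` Y)"
    using csubspace_image[OF T sub(1)] sub assms(4,5) by (intro ccodim_chain) auto
  then show ?thesis using ccodim_image[OF T sub assms(4)] by (simp add: add.assoc)
qed

lemma ccdim_kernel_eq_ccodim_range: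
  assumes T: "clinear_on M T" and M: "csubspace M" "ccdim M < \<infinity>" and "T ` M \<subseteq> M"
  shows "ccdim (kernel M T) = ccodim M (T ` M)"
proof -
  have 0: "T ` {0} = {0}" "kernel {0} T = {0}" "{0} \<subseteq> M"
    using clinear_on_zero[OF T M(1)] complex_vector.subspace_0[OF M(1)] by (auto simp: kernel_def)
  have "ccodim M (T ` M) + ccdim M = ccdim M + ccdim (kernel M T)"
    using index_on_subspace[OF T M(1) complex_vector.subspace_single_0 0(3) assms(4)] 0
      ccodim_zero[OF M(1)] by simp
  then show ?thesis using M(2) by (auto simp: add.commute[of _ "ccdim M"] enat_add_left_cancel)
qed

section \<open>Pairings and annihilators\<close>

lemma ccodim_functional_kernel_le:
  fixes f :: "'a::complex_normed_vector \<Rightarrow> complex"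
  assumes V: "csubspace V" and f: "clinear_on V f"
  shows "csubspace {v \<in> V. f v = 0}" "ccodim V {v \<in> V. f v = 0} \<le> 1"
proof -
  let ?K = "{v \<in> V. f v = 0}"
  show K: "csubspace ?K"
    using V f clinear_on_zero[OF f V] unfolding complex_vector.subspace_def
    by (auto simp: clinear_on_add clinear_on_scale scaleC_complex_def)
  show "ccodim V ?K \<le> 1"
  proof (cases "\<forall>v\<in>V. f v = 0")
    case True
    then have "?K = V" by blast
    then show ?thesis using ccodim_eq_0_iff[OF V V] by simp
  next
    case False
    then obtain v0 where v0: "v0 \<in> V" "f v0 \<noteq> 0" by blast
    have span: "cspan {v0} = range (\<lambda>c. c *\<^sub>C v0)" by (rule complex_vector.span_singleton)
    have inV: "c *\<^sub>C v0 \<in> V" for c using complex_vector.subspace_scale[OF V v0(1)] .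
    have "direct_sum V ?K (cspan {v0})"
    proof (rule direct_sumI[OF K complex_vector.subspace_span])
      show "?K \<inter> cspan {v0} \<subseteq> {0}"
        using v0 by (auto simp: span clinear_on_scale[OF f] scaleC_complex_def)
      show "V = subspace_sum ?K (cspan {v0})"
      proof
        show "V \<subseteq> subspace_sum ?K (cspan {v0})"
        proof
          fix v assume v: "v \<in> V"
          let ?c = "f v / f v0"
          have "v - ?c *\<^sub>C v0 \<in> ?K"
            using v v0 inV V by (simp add: clinear_on_diff[OF f V] clinear_on_scale[OF f]
                scaleC_complex_def complex_vector.subspace_diff)
          moreover have "?c *\<^sub>C v0 \<in> cspan {v0}" unfolding span by (rule rangeI)
          ultimately have "v - ?c *\<^sub>C v0 + ?c *\<^sub>C v0 \<in> subspace_sum ?K (cspan {v0})"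
            by (rule subspace_sumI)
          then show "v \<in> subspace_sum ?K (cspan {v0})" by simp
        qed
        show "subspace_sum ?K (cspan {v0}) \<subseteq> V"
          using inV by (intro subspace_sum_least[OF V]) (auto simp: span)
      qed
    qed
    then have "ccodim V ?K = ccdim (cspan {v0})"
      by (rule ccodim_eq[OF K complex_vector.subspace_span])
    also have "\<dots> \<le> enat (card {v0})" by (rule ccdim_le_card) auto
    finally show ?thesis by (simp add: one_enat_def)
  qed
qed

lemma ccodim_Int_functional_kernels_le:
  fixes f :: "'i \<Rightarrow> 'a::complex_normed_vector \<Rightarrow> complex"
  assumes V: "csubspace V" and "finite I" and f: "\<And>i. i \<in> I \<Longrightarrow> clinear_on V (f i)"
  shows "csubspace {v \<in> V. \<forall>i\<in>I. f i v = 0} \<and> ccodim V {v \<in> V. \<forall>i\<in>I. f i v = 0} \<le> enat (card I)"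
  using assms(2) f
proof (induction I)
  case empty
  show ?case using ccodim_eq_0_iff[OF V V] V by simp
next
  case (insert i I)
  let ?W = "{v \<in> V. \<forall>i\<in>I. f i v = 0}"
  have W: "csubspace ?W" "ccodim V ?W \<le> enat (card I)" using insert by auto
  have fi: "clinear_on ?W (f i)" using insert.prems[of i] by (auto simp: clinear_on_def)
  have eq: "{v \<in> V. \<forall>j\<in>insert i I. f j v = 0} = {v \<in> ?W. f i v = 0}" by auto
  have K: "csubspace {v \<in> ?W. f i v = 0}" "ccodim ?W {v \<in> ?W. f i v = 0} \<le> 1"
    using ccodim_functional_kernel_le[OF W(1) fi] by auto
  have "ccodim V {v \<in> ?W. f i v = 0} = ccodim V ?W + ccodim ?W {v \<in> ?W. f i v = 0}"
    by (rule ccodim_chain[OF K(1) W(1) V]) auto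
  also have "\<dots> \<le> enat (card I) + 1" using W(2) K(2) by (rule add_mono)
  also have "\<dots> = enat (card (insert i I))" using insert by (simp add: one_enat_def)
  finally show ?case using K(1) unfolding eq by simp
qed

text \<open>
  One half of \<open>row rank = column rank\<close> for a bilinear pairing: if finitely many functionals span
  \<open>A\<close> modulo those vanishing on \<open>V\<close>, the common kernel of \<open>A\<close> in \<open>V\<close> is the common kernel of these.
\<close>

lemma ccodim_pairing_le:
  fixes b :: "'b::complex_normed_vector \<Rightarrow> 'a::complex_normed_vector \<Rightarrow> complex"
  assumes A: "csubspace A" and V: "csubspace V"
    and bA: "\<And>v. v \<in> V \<Longrightarrow> clinear_on A (\<lambda>f. b f v)"
    and bV: "\<And>f. f \<in> A \<Longrightarrow> clinear_on V (b f)"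
  shows "ccodim V {v \<in> V. \<forall>f\<in>A. b f v = 0} \<le> ccodim A {f \<in> A. \<forall>v\<in>V. b f v = 0}"
proof (cases "ccodim A {f \<in> A. \<forall>v\<in>V. b f v = 0} < \<infinity>")
  case True
  let ?A0 = "{f \<in> A. \<forall>v\<in>V. b f v = 0}"
  have A0: "csubspace ?A0"
    using A unfolding complex_vector.subspace_def
    by (auto simp: clinear_on_add[OF bA] clinear_on_scale[OF bA] clinear_on_zero[OF bA A])
  obtain C where C: "csubspace C" "direct_sum A ?A0 C" "C \<subseteq> A" "ccodim A ?A0 = ccdim C"
    by (rule obtain_complement[OF A0 A]) auto
  have "ccdim C < \<infinity>" using True C(4) by simp
  then obtain F where F: "finite F" "F \<subseteq> C" "\<not> cdependent F" "cspan F = C" "ccdim C = enat (card F)"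
    using obtain_finite_basis[OF C(1)] by metis
  have "b f v = 0" if v: "v \<in> V" "\<forall>f\<in>F. b f v = 0" and f: "f \<in> A" for f v
  proof -
    have "g \<in> A \<and> b g v = 0" if "g \<in> cspan F" for g
      using that
    proof (induction rule: complex_vector.span_induct_alt)
      case base
      then show ?case using clinear_on_zero[OF bA[OF v(1)] A] complex_vector.subspace_0[OF A] by simp
    next
      case (step c g h)
      then have "g \<in> A" "c *\<^sub>C g \<in> A" using F C complex_vector.subspace_scale[OF A] by auto
      then show ?case
        using step v complex_vector.subspace_add[OF A] clinear_on_scale[OF bA[OF v(1)], of g c]
          clinear_on_add[OF bA[OF v(1)], of "c *\<^sub>C g" h] by (simp add: scaleC_complex_def)
    qed
    then have C0: "b g v = 0" if "g \<in> C" for g using that F(4) by blast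
    have "f \<in> subspace_sum ?A0 C" using f C(2) unfolding direct_sum_iff by simp
    then obtain g h where gh: "g \<in> ?A0" "h \<in> C" "f = g + h" by (rule subspace_sumE)
    then have "g \<in> A" "h \<in> A" "b g v = 0" using C(3) v(1) by auto
    then show ?thesis
      using gh(3) C0[OF gh(2)] clinear_on_add[OF bA[OF v(1)], of g h] by simp
  qed
  then have "{v \<in> V. \<forall>f\<in>A. b f v = 0} = {v \<in> V. \<forall>f\<in>F. b f v = 0}"
    using F(2) C(3) by (metis (no_types, lifting) subsetD)
  moreover have "ccodim V {v \<in> V. \<forall>f\<in>F. b f v = 0} \<le> enat (card F)"
    using ccodim_Int_functional_kernels_le[OF V F(1), of b] bV F(2) C(3) by (simp add: subset_iff)
  ultimately show ?thesis using F(5) C(4) by simp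
qed simp

lemma ccodim_pairing_eq:
  fixes b :: "'b::complex_normed_vector \<Rightarrow> 'a::complex_normed_vector \<Rightarrow> complex"
  assumes A: "csubspace A" and V: "csubspace V"
    and bA: "\<And>v. v \<in> V \<Longrightarrow> clinear_on A (\<lambda>f. b f v)"
    and bV: "\<And>f. f \<in> A \<Longrightarrow> clinear_on V (b f)"
  shows "ccodim V {v \<in> V. \<forall>f\<in>A. b f v = 0} = ccodim A {f \<in> A. \<forall>v\<in>V. b f v = 0}"
  using ccodim_pairing_le[of A V b, OF assms] ccodim_pairing_le[of V A "\<lambda>v f. b f v", OF V A bV bA]
  by (rule antisym)

definition annihilator :: "'a::complex_normed_vector set \<Rightarrow> ('a \<Rightarrow>\<^sub>L complex) set"
  where "annihilator V = {f \<in> cdual. \<forall>v\<in>V. blinfun_apply f v = 0}"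

lemma clinear_on_cdual: "f \<in> cdual \<Longrightarrow> clinear_on V (blinfun_apply f)"
  by (auto simp: clinear_on_def cdual_def blinfun.add_right scaleC_complex_def)

lemma clinear_on_evaluation: "clinear_on A (\<lambda>f. blinfun_apply f v)"
  by (auto simp: clinear_on_def blinfun.add_left blinfun_apply_scaleC)

lemma csubspace_annihilator: "csubspace (annihilator V)"
  using csubspace_cdual unfolding annihilator_def complex_vector.subspace_def
  by (auto simp: blinfun.add_left blinfun_apply_scaleC)

lemma closed_annihilator: "closed (annihilator V)"
proof -
  have "annihilator V = cdual \<inter> (\<Inter>v\<in>V. {f. blinfun_apply f v = 0})"
    by (auto simp: annihilator_def)
  moreover have "closed \<dots>"
    by (intro closed_Int closed_cdual closed_INT ballI closed_Collect_eq continuous_intros)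
  ultimately show ?thesis by simp
qed

text \<open>
  For the pairing of \<open>annihilator R\<close> with the whole space, no nonzero functional vanishes everywhere,
  and by Hahn-Banach the vectors on which all these functionals vanish are those of \<open>R\<close>.
\<close>

lemma ccdim_annihilator:
  fixes R :: "'a::complex_normed_vector set"
  assumes "csubspace R" "closed R"
  shows "ccdim (annihilator R) = ccodim UNIV R"
proof -
  have 1: "{v \<in> UNIV. \<forall>f\<in>annihilator R. blinfun_apply f v = 0} = R"
  proof
    show "{v \<in> UNIV. \<forall>f\<in>annihilator R. blinfun_apply f v = 0} \<subseteq> R"
    proof
      fix v assume v: "v \<in> {v \<in> UNIV. \<forall>f\<in>annihilator R. blinfun_apply f v = 0}"
      show "v \<in> R"
      proof (rule ccontr)
        assume "v \<notin> R"
        then obtain f where "f \<in> cdual" "blinfun_apply f v = 1" "\<And>r. r \<in> R \<Longrightarrow> blinfun_apply f r = 0"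
          using separating_functional[OF assms] by blast
        then show False using v by (auto simp: annihilator_def)
      qed
    qed
  qed (auto simp: annihilator_def)
  have "f = 0" if "\<forall>v. blinfun_apply f v = 0" for f :: "'a \<Rightarrow>\<^sub>L complex"
    using that by (intro blinfun_eqI) simp
  then have 2: "{f \<in> annihilator R. \<forall>v\<in>UNIV. blinfun_apply f v = 0} = {0}"
    using complex_vector.subspace_0[OF csubspace_annihilator] by auto
  have lin: "clinear_on UNIV (blinfun_apply f)" if "f \<in> annihilator R" for f
    by (rule clinear_on_cdual) (use that in \<open>simp add: annihilator_def\<close>)
  have ev: "clinear_on (annihilator R) (\<lambda>f. blinfun_apply f v)" if "v \<in> UNIV" for v
    by (rule clinear_on_evaluation)
  have "ccodim UNIV R = ccodim (annihilator R) {0}"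
    using ccodim_pairing_eq[OF csubspace_annihilator complex_vector.subspace_UNIV ev lin]
    unfolding 1 2 .
  then show ?thesis using ccodim_zero[OF csubspace_annihilator, of R] by simp
qed

text \<open>
  For the pairing of the dual with \<open>V\<close>, the functionals vanishing on \<open>V\<close> form its annihilator, and by
  Hahn-Banach only the zero vector is killed by all functionals.
\<close>

lemma ccodim_annihilator:
  fixes V :: "'a::complex_normed_vector set"
  assumes V: "csubspace V"
  shows "ccodim cdual (annihilator V) = ccdim V"
proof -
  have "v = 0" if "\<forall>f\<in>cdual. blinfun_apply f v = 0" for v :: 'a
  proof (rule ccontr)
    assume "v \<noteq> 0"
    then obtain f where "f \<in> cdual" "blinfun_apply f v = 1"
      using separating_functional[of "{0}" v] complex_vector.subspace_single_0 by auto
    then show False using that by auto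
  qed
  then have "{v \<in> V. \<forall>f\<in>cdual. blinfun_apply f v = 0} = {0}"
    using complex_vector.subspace_0[OF V] by auto
  moreover have "ccodim V {v \<in> V. \<forall>f\<in>cdual. blinfun_apply f v = 0}
      = ccodim cdual {f \<in> cdual. \<forall>v\<in>V. blinfun_apply f v = 0}"
    by (rule ccodim_pairing_eq[OF csubspace_cdual V])
      (auto intro: clinear_on_cdual clinear_on_evaluation)
  ultimately show ?thesis using ccodim_zero[OF V] by (simp add: annihilator_def)
qed

section \<open>Finite-dimensional extensions of closed subspaces\<close>

lemma bounded_linear_scaleC_left: "bounded_linear (\<lambda>c. c *\<^sub>C (x::'a::complex_normed_vector))"
proof (rule bounded_linear_intro[where K = "norm x"])
  show "(r *\<^sub>R c) *\<^sub>C x = r *\<^sub>R c *\<^sub>C x" for r :: real and c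
    by (simp add: scaleC_of_real[symmetric] scaleC_scaleC scaleR_conv_of_real scaleC_complex_def)
qed (simp_all add: scaleC_add_left norm_scaleC)

lemma closed_sum_line:
  fixes e :: "'a::complex_normed_vector"
  assumes R: "csubspace R" "closed R"
  shows "closed (subspace_sum R (cspan {e}))"
proof (cases "e \<in> R")
  case True
  then have "cspan {e} \<subseteq> R" using R(1) complex_vector.span_minimal by blast
  then have "subspace_sum R (cspan {e}) = R"
    using subspace_sum_least[OF R(1), of R "cspan {e}"]
      subspace_sum_upper1[of "cspan {e}" R, OF complex_vector.subspace_span] by blast
  then show ?thesis using R(2) by simp
next
  case False
  then obtain f where f: "f \<in> cdual" "blinfun_apply f e = 1" "\<And>r. r \<in> R \<Longrightarrow> blinfun_apply f r = 0"
    using separating_functional[OF R] by blast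
  have span: "cspan {e} = range (\<lambda>c. c *\<^sub>C e)" by (rule complex_vector.span_singleton)
  \<comment> \<open>\<open>f\<close> reads off the coefficient of \<open>e\<close>, so membership is the closed condition below\<close>
  have "subspace_sum R (cspan {e}) = (\<lambda>x. x - blinfun_apply f x *\<^sub>C e) -` R"
  proof (intro equalityI subsetI)
    fix x assume "x \<in> subspace_sum R (cspan {e})"
    then obtain r c where rc: "r \<in> R" "x = r + c *\<^sub>C e" by (auto elim!: subspace_sumE simp: span)
    then have "blinfun_apply f x = c" using f by (simp add: blinfun.add_right cdual_def)
    then show "x \<in> (\<lambda>x. x - blinfun_apply f x *\<^sub>C e) -` R" using rc by simp
  next
    fix x assume x: "x \<in> (\<lambda>x. x - blinfun_apply f x *\<^sub>C e) -` R"
    have "(x - blinfun_apply f x *\<^sub>C e) + blinfun_apply f x *\<^sub>C e \<in> subspace_sum R (cspan {e})"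
      using x by (intro subspace_sumI) (auto simp: span)
    then show "x \<in> subspace_sum R (cspan {e})" by simp
  qed
  moreover have "closed \<dots>"
    by (intro continuous_closed_vimage R(2) continuous_intros
        bounded_linear.isCont[OF bounded_linear_scaleC_left] isCont_o2[OF _ bounded_linear.isCont[OF bounded_linear_scaleC_left]])
  ultimately show ?thesis by simp
qed

lemma closed_sum_finite_span:
  fixes F :: "'a::complex_normed_vector set"
  assumes R: "csubspace R" "closed R" and "finite F"
  shows "closed (subspace_sum R (cspan F))"
  using assms(3)
proof (induction F)
  case empty
  show ?case using R by simp
next
  case (insert e F)
  have "subspace_sum R (cspan (insert e F)) = subspace_sum (subspace_sum R (cspan F)) (cspan {e})"
  proof -
    have "cspan (insert e F) = subspace_sum (cspan F) (cspan {e})"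
      using complex_vector.span_Un[of F "{e}"] by (simp add: subspace_sum_def)
    then show ?thesis by (simp add: subspace_sum_assoc)
  qed
  then show ?case
    using closed_sum_line[OF csubspace_sum[OF R(1) complex_vector.subspace_span] insert.IH] by simp
qed

lemma closed_sum_finite_dim:
  fixes V :: "'a::complex_normed_vector set"
  assumes R: "csubspace R" "closed R" and V: "csubspace V" "ccdim V < \<infinity>"
  shows "closed (subspace_sum R V)"
proof -
  obtain F where "finite F" "F \<subseteq> V" "\<not> cdependent F" "cspan F = V" "ccdim V = enat (card F)"
    by (rule obtain_finite_basis[OF V])
  then show ?thesis using closed_sum_finite_span[OF R, of F] by simp
qed

lemma closed_finite_dim:
  fixes V :: "'a::complex_normed_vector set"
  assumes "csubspace V" "ccdim V < \<infinity>"
  shows "closed V"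
  using closed_sum_finite_dim[OF complex_vector.subspace_single_0 _ assms] by simp

section \<open>Bounded operators on complete subspaces\<close>

text \<open>
  The setting of most of the development: the restriction of a bounded operator to a complete
  invariant subspace. It covers Banach spaces, the summands of a reducing decomposition and the dual
  space inside the space of real-linear functionals.
\<close>

definition banach_operator :: "'a::complex_normed_vector set \<Rightarrow> ('a \<Rightarrow> 'a) \<Rightarrow> bool"
  where "banach_operator M S \<longleftrightarrow> csubspace M \<and> complete M \<and> S \<in> bounded_operators M"

lemma csubspace_imp_subspace: "csubspace M \<Longrightarrow> subspace M"
  unfolding subspace_def complex_vector.subspace_def by (metis scaleC_of_real)

lemma
  assumes "banach_operator M S"
  shows banach_operator_csubspace: "csubspace M"
    and banach_operator_complete: "complete M"
    and banach_operator_closed: "closed M"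
    and banach_operator_subspace: "subspace M"
    and banach_operator_clinear: "clinear_on M S"
    and banach_operator_bounded: "bounded_linear_on M S"
    and banach_operator_maps: "S ` M \<subseteq> M"
    and banach_operator_range: "csubspace (S ` M)"
    and banach_operator_kernel: "csubspace (kernel M S)"
proof -
  show M: "csubspace M" "complete M" using assms by (simp_all add: banach_operator_def)
  show "closed M" using M(2) by (rule complete_imp_closed)
  show "subspace M" using M(1) by (rule csubspace_imp_subspace)
  show S: "clinear_on M S" using assms
    by (simp add: banach_operator_def bounded_operators_def clinear_on_def)
  have "S (r *\<^sub>R x) = r *\<^sub>R S x" if "x \<in> M" for r x
    using clinear_on_scale[OF S that, of "complex_of_real r"] by (simp add: scaleC_of_real)
  then show "bounded_linear_on M S"
    using assms by (simp add: banach_operator_def bounded_operators_def bounded_linear_on_def)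
  show "S ` M \<subseteq> M" using assms by (auto simp: banach_operator_def bounded_operators_def)
  show "csubspace (S ` M)" by (rule csubspace_image[OF S M(1) M(1)]) simp
  show "csubspace (kernel M S)" by (rule csubspace_kernel[OF S M(1)])
qed

lemma banach_operatorI:
  assumes "csubspace M" "complete M" "clinear_on M S" "S ` M \<subseteq> M"
    and "\<And>x. x \<in> M \<Longrightarrow> norm (S x) \<le> K * norm x"
  shows "banach_operator M S"
  using assms unfolding banach_operator_def bounded_operators_def clinear_on_def by blast

lemma banach_operator_restrict:
  assumes S: "banach_operator M S" and L: "csubspace L" "closed L" "L \<subseteq> M" "S ` L \<subseteq> L"
  shows "banach_operator L S"
proof -
  obtain K where K: "K > 0" "\<And>x. x \<in> M \<Longrightarrow> norm (S x) \<le> K * norm x"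
    using bounded_linear_on_pos_bound[OF banach_operator_bounded[OF S]] by blast
  show ?thesis
  proof (rule banach_operatorI[OF L(1) _ _ L(4)])
    show "complete L"
      using complete_closed_subset[OF L(2,3) banach_operator_complete[OF S]] .
    show "clinear_on L S" using clinear_on_subset[OF banach_operator_clinear[OF S] L(3)] .
    show "norm (S x) \<le> K * norm x" if "x \<in> L" for x using K(2) L(3) that by blast
  qed
qed

lemma banach_operator_compose:
  assumes S: "banach_operator M S" and T: "banach_operator M T"
  shows "banach_operator M (\<lambda>x. S (T x))"
proof -
  obtain K where K: "K > 0" "\<And>x. x \<in> M \<Longrightarrow> norm (S x) \<le> K * norm x"
    using bounded_linear_on_pos_bound[OF banach_operator_bounded[OF S]] by blast
  obtain L where L: "L > 0" "\<And>x. x \<in> M \<Longrightarrow> norm (T x) \<le> L * norm x"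
    using bounded_linear_on_pos_bound[OF banach_operator_bounded[OF T]] by blast
  have T_in: "T x \<in> M" if "x \<in> M" for x using banach_operator_maps[OF T] that by blast
  show ?thesis
  proof (rule banach_operatorI[OF banach_operator_csubspace[OF S] banach_operator_complete[OF S]])
    show "clinear_on M (\<lambda>x. S (T x))"
      using banach_operator_clinear[OF S] banach_operator_clinear[OF T] T_in
      by (simp add: clinear_on_def)
    show "(\<lambda>x. S (T x)) ` M \<subseteq> M" using T_in banach_operator_maps[OF S] by blast
    show "norm (S (T x)) \<le> (K * L) * norm x" if "x \<in> M" for x
    proof -
      have "norm (S (T x)) \<le> K * norm (T x)" using K(2) T_in that by blast
      also have "\<dots> \<le> K * (L * norm x)" using K(1) L(2)[OF that] by (intro mult_left_mono) auto
      finally show ?thesis by (simp add: mult.assoc)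
    qed
  qed
qed

lemma banach_operator_id:
  assumes "csubspace M" "complete M"
  shows "banach_operator M (\<lambda>x. x)"
  by (rule banach_operatorI[OF assms, where K = 1]) (auto simp: clinear_on_def)

lemma banach_operator_power:
  assumes S: "banach_operator M S"
  shows "banach_operator M (S ^^ n)"
proof (induction n)
  case 0
  then show ?case
    using banach_operator_id[OF banach_operator_csubspace[OF S] banach_operator_complete[OF S]]
    by (simp add: id_def)
next
  case (Suc n)
  then show ?case using banach_operator_compose[OF S Suc] by (simp add: o_def)
qed

lemma banach_operator_add:
  assumes S: "banach_operator M S" and T: "banach_operator M T"
  shows "banach_operator M (\<lambda>x. S x + T x)"
proof -
  obtain K where K: "K > 0" "\<And>x. x \<in> M \<Longrightarrow> norm (S x) \<le> K * norm x"
    using bounded_linear_on_pos_bound[OF banach_operator_bounded[OF S]] by blast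
  obtain L where L: "L > 0" "\<And>x. x \<in> M \<Longrightarrow> norm (T x) \<le> L * norm x"
    using bounded_linear_on_pos_bound[OF banach_operator_bounded[OF T]] by blast
  note M = banach_operator_csubspace[OF S]
  show ?thesis
  proof (rule banach_operatorI[OF M banach_operator_complete[OF S]])
    show "clinear_on M (\<lambda>x. S x + T x)"
      using banach_operator_clinear[OF S] banach_operator_clinear[OF T]
      by (simp add: clinear_on_def scaleC_add_right)
    show "(\<lambda>x. S x + T x) ` M \<subseteq> M"
      using banach_operator_maps[OF S] banach_operator_maps[OF T]
      by (auto intro!: complex_vector.subspace_add[OF M])
    show "norm (S x + T x) \<le> (K + L) * norm x" if "x \<in> M" for x
      using norm_triangle_ineq[of "S x" "T x"] K(2)[OF that] L(2)[OF that]
      by (simp add: distrib_right)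
  qed
qed

lemma banach_operator_scaled_id:
  assumes "csubspace M" "complete M"
  shows "banach_operator M (\<lambda>x. c *\<^sub>C x)"
  by (rule banach_operatorI[OF assms, where K = "cmod c"])
    (auto simp: clinear_on_def scaleC_add_right scaleC_scaleC mult.commute norm_scaleC
      intro: complex_vector.subspace_scale[OF assms(1)])

lemma banach_operator_shift:
  assumes S: "banach_operator M S"
  shows "banach_operator M (shift S l)"
  using banach_operator_add[OF S banach_operator_scaled_id[of M "- l"]]
    banach_operator_csubspace[OF S] banach_operator_complete[OF S]
  by (simp add: shift_def complex_vector.scale_minus_left)

lemma shift_shift: "shift (shift S a) b = shift S (a + b)"
  by (simp add: shift_def fun_eq_iff scaleC_add_left)

lemma banach_operator_open:
  assumes S: "banach_operator M S" and cl: "closed (S ` M)"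
  obtains C where "C > 0" "\<And>y. y \<in> S ` M \<Longrightarrow> \<exists>x\<in>M. S x = y \<and> norm x \<le> C * norm y"
proof -
  have "complete (S ` M)"
    using complete_closed_subset[OF cl banach_operator_maps[OF S] banach_operator_complete[OF S]] .
  then show thesis
    using open_mapping[OF banach_operator_subspace[OF S] banach_operator_complete[OF S]
        banach_operator_bounded[OF S]] that by blast
qed

text \<open>
  If \<open>S l\<^sub>n \<longlonglongrightarrow> S x\<close>, the open mapping theorem gives preimages \<open>z\<^sub>n \<longlonglongrightarrow> 0\<close> of \<open>S l\<^sub>n - S x\<close>; then
  \<open>x + z\<^sub>n\<close> differs from \<open>l\<^sub>n\<close> by an element of the kernel, so \<open>x\<close> is a limit of elements of \<open>L\<close>.
\<close>

lemma closed_image_of_closed: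
  assumes S: "banach_operator M S" and cl: "closed (S ` M)"
    and L: "csubspace L" "closed L" "L \<subseteq> M" "kernel M S \<subseteq> L"
  shows "closed (S ` L)"
  unfolding closed_sequential_limits
proof (intro allI impI, elim conjE)
  note M = banach_operator_csubspace[OF S]
  note diff = clinear_on_diff[OF banach_operator_clinear[OF S] M]
  obtain C where C: "C > 0" "\<And>y. y \<in> S ` M \<Longrightarrow> \<exists>x\<in>M. S x = y \<and> norm x \<le> C * norm y"
    using banach_operator_open[OF S cl] by blast
  fix s y assume s: "\<forall>n. s n \<in> S ` L" and lim: "s \<longlonglongrightarrow> y"
  then have "\<forall>n. s n \<in> S ` M" using L(3) by blast
  then have "y \<in> S ` M" using cl lim unfolding closed_sequential_limits by blast
  then obtain x where x: "x \<in> M" "y = S x" by blast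
  have "\<forall>n. \<exists>x. x \<in> L \<and> s n = S x" using s by auto
  then obtain l where l: "\<And>n. l n \<in> L \<and> s n = S (l n)" by metis
  have "\<exists>z\<in>M. S z = s n - y \<and> norm z \<le> C * norm (s n - y)" for n
    by (rule C(2), rule complex_vector.subspace_diff[OF banach_operator_range[OF S]])
      (use \<open>\<forall>n. s n \<in> S ` M\<close> \<open>y \<in> S ` M\<close> in auto)
  then obtain z where z: "\<And>n. z n \<in> M \<and> S (z n) = s n - y \<and> norm (z n) \<le> C * norm (s n - y)"
    by metis
  have "x + z n \<in> L" for n
  proof -
    have lM: "l n \<in> M" "z n \<in> M" using l L(3) z by auto
    then have "l n - x - z n \<in> kernel M S"
      using x l[of n] z[of n] complex_vector.subspace_diff[OF M]
      by (simp add: kernel_def diff)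
    then have "l n - x - z n \<in> L" using L(4) by blast
    then have "l n - (l n - x - z n) \<in> L"
      by (rule complex_vector.subspace_diff[OF L(1) conjunct1[OF l]])
    then show ?thesis by (simp add: add.commute)
  qed
  moreover have "z \<longlonglongrightarrow> 0"
  proof (rule Lim_null_comparison)
    show "(\<lambda>n. C * norm (s n - y)) \<longlonglongrightarrow> 0"
      using lim by (simp add: LIM_zero tendsto_mult_right_zero tendsto_norm_zero)
  qed (use z in simp)
  then have "(\<lambda>n. x + z n) \<longlonglongrightarrow> x + 0" by (intro tendsto_intros)
  ultimately have "x + 0 \<in> L" by (rule closed_sequentially[OF L(2)])
  then show "y \<in> S ` L" using x by simp
qed

lemma complete_product:
  fixes A :: "'a::metric_space set" and D :: "'b::metric_space set"
  assumes A: "complete A" and D: "complete D"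
  shows "complete (A \<times> D)"
  unfolding complete_def
proof (intro allI impI, elim conjE)
  fix s :: "nat \<Rightarrow> 'a \<times> 'b" assume s: "\<forall>n. s n \<in> A \<times> D" "Cauchy s"
  have "\<And>n. fst (s n) \<in> A" "\<And>n. snd (s n) \<in> D" using s(1) by (auto simp: mem_Times_iff)
  moreover have "Cauchy (\<lambda>n. fst (s n))" "Cauchy (\<lambda>n. snd (s n))"
    using s(2) by (auto intro: Cauchy_fst Cauchy_snd)
  ultimately obtain a d where ad: "a \<in> A" "(\<lambda>n. fst (s n)) \<longlonglongrightarrow> a"
      "d \<in> D" "(\<lambda>n. snd (s n)) \<longlonglongrightarrow> d"
    using A D unfolding complete_def by metis
  then have "(\<lambda>n. (fst (s n), snd (s n))) \<longlonglongrightarrow> (a, d)" by (intro tendsto_Pair)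
  then show "\<exists>l\<in>A \<times> D. s \<longlonglongrightarrow> l" using ad by auto
qed

text \<open>
  The map \<open>(a, d) \<mapsto> T a + d\<close> is onto \<open>X\<close>, and the \<open>D\<close>-component of a preimage is unique, so the
  open mapping theorem bounds it. With \<open>T\<close> the identity this is the continuity of the projections of a
  closed direct sum; with \<open>T\<close> an operator and \<open>D\<close> finite-dimensional it shows that a range of finite
  codimension is closed.
\<close>

lemma direct_sum_bounded_projection:
  fixes T :: "'a::real_normed_vector \<Rightarrow> 'b::complex_normed_vector"
  assumes A: "subspace A" "complete A" and T: "bounded_linear_on A T"
    and D: "csubspace D" "complete D" and TA: "csubspace (T ` A)"
    and X: "complete X" "direct_sum X (T ` A) D"
  obtains K where "K > 0" "\<And>a d. a \<in> A \<Longrightarrow> d \<in> D \<Longrightarrow> norm d \<le> K * norm (T a + d)"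
proof -
  define U where "U = (\<lambda>(a, d). T a + d)"
  obtain B where B: "B > 0" "\<And>x. x \<in> A \<Longrightarrow> norm (T x) \<le> B * norm x"
    using bounded_linear_on_pos_bound[OF T] by blast
  have sub: "subspace (A \<times> D)"
    using subspace_Times[OF A(1) csubspace_imp_subspace[OF D(1)]] .
  have comp: "complete (A \<times> D)" using A(2) D(2) by (rule complete_product)
  have norm_U: "norm (U p) \<le> (B + 1) * norm p" if pin: "p \<in> A \<times> D" for p
  proof -
    obtain a d where p: "p = (a, d)" "a \<in> A" using pin by auto
    have "norm a \<le> norm p" "norm d \<le> norm p"
      using p norm_fst_le[of a d] norm_snd_le[of d a] by auto
    have "norm (T a) \<le> B * norm a" using B(2) p(2) .
    also have "\<dots> \<le> B * norm p" using \<open>norm a \<le> norm p\<close> B(1) by (intro mult_left_mono) auto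
    finally have "norm (T a) \<le> B * norm p" .
    moreover note \<open>norm d \<le> norm p\<close>
    ultimately show ?thesis
      using norm_triangle_ineq[of "T a" d] p(1) by (simp add: U_def distrib_right)
  qed
  have "bounded_linear_on (A \<times> D) U"
    unfolding bounded_linear_on_def
  proof (intro conjI exI ballI allI)
    show "U (x + y) = U x + U y" if "x \<in> A \<times> D" "y \<in> A \<times> D" for x y
      using that T by (auto simp: U_def bounded_linear_on_def algebra_simps)
    show "U (r *\<^sub>R x) = r *\<^sub>R U x" if "x \<in> A \<times> D" for r x
      using that T by (auto simp: U_def bounded_linear_on_def algebra_simps)
  qed (rule norm_U)
  moreover have range: "U ` (A \<times> D) = X"
    using X(2) unfolding direct_sum_iff U_def subspace_sum_def by force
  ultimately obtain K where K: "K > 0"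
      "\<And>y. y \<in> X \<Longrightarrow> \<exists>p\<in>A \<times> D. U p = y \<and> norm p \<le> K * norm y"
    using open_mapping[OF sub comp, of U] X(1) by (metis (no_types, lifting))
  show thesis
  proof (rule that[OF K(1)])
    fix a d assume ad: "a \<in> A" "d \<in> D"
    then have "T a + d \<in> X" using range unfolding U_def by force
    then obtain p where p: "p \<in> A \<times> D" "U p = T a + d" "norm p \<le> K * norm (T a + d)"
      using K(2) by blast
    then obtain a' d' where p': "p = (a', d')" "a' \<in> A" "d' \<in> D" by auto
    then have "T a' + d' = T a + d" using p(2) by (simp add: U_def)
    then have "d' = d"
      by (rule direct_sum_unique(2)[OF X(2) TA D(1) imageI[OF p'(2)] p'(3) imageI[OF ad(1)] ad(2)])
    then have "norm d \<le> norm p" using p'(1) norm_snd_le by metis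
    then show "norm d \<le> K * norm (T a + d)" using p(3) by simp
  qed
qed

lemma closed_range_of_finite_codim:
  assumes S: "banach_operator M S" and fin: "ccodim M (S ` M) < \<infinity>"
  shows "closed (S ` M)"
proof -
  note M = banach_operator_csubspace[OF S] banach_operator_complete[OF S]
  note R = banach_operator_range[OF S]
  obtain D where D: "csubspace D" "direct_sum M (S ` M) D" "D \<subseteq> M" "ccodim M (S ` M) = ccdim D"
    by (rule obtain_complement[OF R M(1) banach_operator_maps[OF S]])
  have "closed D" using closed_finite_dim[OF D(1)] fin D(4) by simp
  then have "complete D" using complete_closed_subset[OF _ D(3) M(2)] by simp
  then obtain K where K: "K > 0" "\<And>a d. a \<in> M \<Longrightarrow> d \<in> D \<Longrightarrow> norm d \<le> K * norm (S a + d)"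
    using direct_sum_bounded_projection[OF banach_operator_subspace[OF S] M(2)
        banach_operator_bounded[OF S] D(1) _ R M(2) D(2)] by metis
  show ?thesis
    unfolding closed_sequential_limits
  proof (intro allI impI, elim conjE)
    fix s y assume s: "\<forall>n. s n \<in> S ` M" and lim: "s \<longlonglongrightarrow> y"
    have "\<forall>n. s n \<in> M" using s banach_operator_maps[OF S] by blast
    then have "y \<in> M" using banach_operator_closed[OF S] lim unfolding closed_sequential_limits by blast
    then have "y \<in> subspace_sum (S ` M) D" using D(2) by (simp add: direct_sum_iff)
    then obtain r d where rd: "r \<in> S ` M" "d \<in> D" "y = r + d" by (rule subspace_sumE)
    have "norm d \<le> K * norm (s n - y)" for n
    proof -
      have "s n - r \<in> S ` M" by (rule complex_vector.subspace_diff[OF R]) (use s rd in auto)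
      then obtain a where a: "a \<in> M" "s n - r = S a" by blast
      have "norm (- d) \<le> K * norm (S a + - d)"
        using K(2)[OF a(1) complex_vector.subspace_neg[OF D(1) rd(2)]] .
      moreover have "S a + - d = s n - y" using a(2)[symmetric] rd(3) by simp
      ultimately show ?thesis by simp
    qed
    moreover have "(\<lambda>n. K * norm (s n - y)) \<longlonglongrightarrow> 0"
      using lim by (simp add: LIM_zero tendsto_mult_right_zero tendsto_norm_zero)
    ultimately have "norm d \<le> 0" by (intro tendsto_lowerbound[OF _ _ sequentially_bot, of _ 0]) auto
    then show "y \<in> S ` M" using rd by simp
  qed
qed

lemma closed_direct_sum_part:
  assumes X: "complete X" "direct_sum X M N" and M: "csubspace M" "closed M"
    and N: "csubspace N" "closed N" and L: "csubspace L" "closed L" "L \<subseteq> M"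
  shows "closed (subspace_sum L N)"
proof -
  have cM: "complete M" "complete N"
    using complete_closed_subset[OF M(2) direct_sum_supsets(1)[OF X(2) M(1) N(1)] X(1)]
      complete_closed_subset[OF N(2) direct_sum_supsets(2)[OF X(2) M(1) N(1)] X(1)] .
  have ds: "direct_sum X ((\<lambda>x. x) ` N) M" "csubspace ((\<lambda>x. x) ` N)"
    using X(2) N(1) by (simp_all add: direct_sum_commute)
  obtain K where K: "K > 0" "\<And>n m. n \<in> N \<Longrightarrow> m \<in> M \<Longrightarrow> norm m \<le> K * norm (n + m)"
    using direct_sum_bounded_projection[OF csubspace_imp_subspace[OF N(1)] cM(2)
        banach_operator_bounded[OF banach_operator_id[OF N(1) cM(2)]] M(1) cM(1) ds(2) X(1) ds(1)]
    by metis
  show ?thesis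
    unfolding closed_sequential_limits
  proof (intro allI impI, elim conjE)
    fix s y assume s: "\<forall>k. s k \<in> subspace_sum L N" and lim: "s \<longlonglongrightarrow> y"
    have "\<exists>l n. l \<in> L \<and> n \<in> N \<and> s k = l + n" for k using s by (metis subspace_sumE)
    then obtain l n where ln: "\<And>k. l k \<in> L \<and> n k \<in> N \<and> s k = l k + n k" by metis
    have "s k \<in> X" for k
      using ln[of k] L(3) X(2) subspace_sumI[of "l k" M "n k" N] by (auto simp: direct_sum_iff)
    then have "y \<in> X" using complete_imp_closed[OF X(1)] lim unfolding closed_sequential_limits by blast
    then have "y \<in> subspace_sum M N" using X(2) by (simp add: direct_sum_iff)
    then obtain a b where ab: "a \<in> M" "b \<in> N" "y = a + b" by (rule subspace_sumE)
    have le: "norm (l k - a) \<le> K * norm (s k - y)" for k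
    proof -
      have "l k \<in> M" using ln[of k] L(3) by auto
      then have "n k - b \<in> N" "l k - a \<in> M"
        using ln[of k] ab complex_vector.subspace_diff[OF N(1)]
          complex_vector.subspace_diff[OF M(1)] by simp_all
      moreover have "(n k - b) + (l k - a) = s k - y" using ln[of k] ab(3) by (simp add: algebra_simps)
      ultimately show ?thesis using K(2)[of "n k - b" "l k - a"] by simp
    qed
    have "(\<lambda>k. K * norm (s k - y)) \<longlonglongrightarrow> 0"
      using lim by (simp add: LIM_zero tendsto_mult_right_zero tendsto_norm_zero)
    then have "(\<lambda>k. l k - a) \<longlonglongrightarrow> 0"
      by (rule Lim_null_comparison[rotated]) (simp add: le)
    then have "l \<longlonglongrightarrow> a" by (simp add: LIM_zero_cancel)
    then have "a \<in> L" using L(2) ln unfolding closed_sequential_limits by blast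
    then show "y \<in> subspace_sum L N" using ab by (auto intro: subspace_sumI)
  qed
qed

lemma injective_closed_range_iff_bounded_below:
  assumes S: "banach_operator M S"
  shows "kernel M S = {0} \<and> closed (S ` M) \<longleftrightarrow> bounded_below M S"
proof
  note M = banach_operator_csubspace[OF S] banach_operator_complete[OF S]
  note diff = clinear_on_diff[OF banach_operator_clinear[OF S] M(1)]
  assume L: "kernel M S = {0} \<and> closed (S ` M)"
  obtain C where C: "C > 0" "\<And>y. y \<in> S ` M \<Longrightarrow> \<exists>x\<in>M. S x = y \<and> norm x \<le> C * norm y"
    using banach_operator_open[OF S] L by blast
  have "inverse C * norm x \<le> norm (S x)" if x: "x \<in> M" for x
  proof -
    obtain z where z: "z \<in> M" "S z = S x" "norm z \<le> C * norm (S x)" using C(2) x by blast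
    then have "z - x \<in> kernel M S"
      using x complex_vector.subspace_diff[OF M(1)] by (simp add: kernel_def diff)
    then have "z = x" using L by simp
    then show ?thesis using z(3) C(1) by (simp add: field_simps)
  qed
  then show "bounded_below M S" unfolding bounded_below_def using C(1) positive_imp_inverse_positive by blast
next
  note M = banach_operator_csubspace[OF S] banach_operator_complete[OF S]
  note diff = clinear_on_diff[OF banach_operator_clinear[OF S] M(1)]
  assume "bounded_below M S"
  then obtain c where c: "c > 0" "\<And>x. x \<in> M \<Longrightarrow> c * norm x \<le> norm (S x)"
    by (auto simp: bounded_below_def)
  have "kernel M S \<subseteq> {0}"
  proof
    fix x assume "x \<in> kernel M S"
    then have "c * norm x \<le> 0" using c(2)[of x] by (simp add: kernel_def)
    then show "x \<in> {0}" using c(1) by (simp add: mult_le_0_iff)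
  qed
  moreover have "0 \<in> kernel M S" using complex_vector.subspace_0[OF banach_operator_kernel[OF S]] .
  moreover have "closed (S ` M)"
    unfolding closed_sequential_limits
  proof (intro allI impI, elim conjE)
    fix s y assume s: "\<forall>n. s n \<in> S ` M" and lim: "s \<longlonglongrightarrow> y"
    have "\<forall>n. \<exists>x. x \<in> M \<and> s n = S x" using s by auto
    then obtain x where x: "\<And>n. x n \<in> M \<and> s n = S (x n)" by metis
    have "Cauchy x"
    proof (rule CauchyI)
      fix e :: real assume "0 < e"
      then obtain N where N: "\<And>m n. m \<ge> N \<Longrightarrow> n \<ge> N \<Longrightarrow> norm (s m - s n) < c * e"
        using CauchyD[OF LIMSEQ_imp_Cauchy[OF lim], of "c * e"] c(1) by auto
      have "norm (x m - x n) < e" if "m \<ge> N" "n \<ge> N" for m n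
      proof -
        have "c * norm (x m - x n) \<le> norm (s m - s n)"
          using c(2)[of "x m - x n"] x complex_vector.subspace_diff[OF M(1)] by (simp add: diff)
        also have "\<dots> < c * e" using N that by blast
        finally show ?thesis using c(1) by simp
      qed
      then show "\<exists>N. \<forall>m\<ge>N. \<forall>n\<ge>N. norm (x m - x n) < e" by blast
    qed
    then obtain x0 where x0: "x0 \<in> M" "x \<longlonglongrightarrow> x0" using M(2) x unfolding complete_def by blast
    then have "(\<lambda>n. S (x n)) \<longlonglongrightarrow> S x0"
      using bounded_linear_on_tendsto[OF banach_operator_bounded[OF S] banach_operator_subspace[OF S]] x
      by blast
    moreover have "(\<lambda>n. S (x n)) = s" using x by auto
    ultimately have "s \<longlonglongrightarrow> S x0" by simp
    then show "y \<in> S ` M" using LIMSEQ_unique[OF lim] x0(1) by blast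
  qed
  ultimately show "kernel M S = {0} \<and> closed (S ` M)" by blast
qed

lemma invertible_on_iff_bijective:
  assumes S: "banach_operator M S"
  shows "invertible_on M S \<longleftrightarrow> kernel M S = {0} \<and> S ` M = M"
proof
  note M = banach_operator_csubspace[OF S] banach_operator_complete[OF S]
  assume "invertible_on M S"
  then obtain V where V: "V \<in> bounded_operators M" "\<And>x. x \<in> M \<Longrightarrow> V (S x) = x \<and> S (V x) = x"
    by (auto simp: invertible_on_def)
  have V_in: "V x \<in> M" if "x \<in> M" for x using V(1) that by (auto simp: bounded_operators_def)
  have "V 0 = 0" using V(2)[of 0] clinear_on_zero[OF banach_operator_clinear[OF S] M(1)]
      complex_vector.subspace_0[OF M(1)] by simp
  then have "x = 0" if "x \<in> kernel M S" for x
    using that V(2)[of x] by (simp add: kernel_def)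
  then have "kernel M S \<subseteq> {0}" by blast
  then have "kernel M S = {0}" using complex_vector.subspace_0[OF banach_operator_kernel[OF S]] by blast
  moreover have "M \<subseteq> S ` M" using V(2) V_in by force
  ultimately show "kernel M S = {0} \<and> S ` M = M" using banach_operator_maps[OF S] by blast
next
  note M = banach_operator_csubspace[OF S] banach_operator_complete[OF S]
  note lin = banach_operator_clinear[OF S]
  assume R: "kernel M S = {0} \<and> S ` M = M"
  then obtain c where c: "c > 0" "\<And>x. x \<in> M \<Longrightarrow> c * norm x \<le> norm (S x)"
    using injective_closed_range_iff_bounded_below[OF S] banach_operator_closed[OF S]
    by (auto simp: bounded_below_def)
  have inj: "inj_on S M"
  proof (rule inj_onI)
    fix x y assume xy: "x \<in> M" "y \<in> M" "S x = S y"
    then have "x - y \<in> kernel M S"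
      using complex_vector.subspace_diff[OF M(1)] by (simp add: kernel_def clinear_on_diff[OF lin M(1)])
    then show "x = y" using R by simp
  qed
  let ?V = "inv_into M S"
  have V: "?V (S x) = x" "S (?V x) = x" "?V x \<in> M" if "x \<in> M" for x
    using that inj R f_inv_into_f[of x S M] inv_into_into[of x S M] by auto
  have V_eq: "?V y = x" if "x \<in> M" "S x = y" for x y using V(1)[OF that(1)] that(2) by simp
  have "?V \<in> bounded_operators M"
    unfolding bounded_operators_def
  proof (intro CollectI conjI ballI allI exI)
    show "?V (x + y) = ?V x + ?V y" if "x \<in> M" "y \<in> M" for x y
      using V(2,3) that complex_vector.subspace_add[OF M(1)] by (intro V_eq) (simp_all add: clinear_on_add[OF lin])
    show "?V (a *\<^sub>C x) = a *\<^sub>C ?V x" if "x \<in> M" for a x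
      using V(2,3) that complex_vector.subspace_scale[OF M(1)] by (intro V_eq) (simp_all add: clinear_on_scale[OF lin])
    show "norm (?V x) \<le> inverse c * norm x" if "x \<in> M" for x
      using c(2)[OF V(3)[OF that]] V(2)[OF that] c(1) by (simp add: field_simps)
  qed (rule V(3))
  then show "invertible_on M S" unfolding invertible_on_def using V by blast
qed

lemma bounded_below_shift:
  assumes S: "bounded_below M S"
  obtains e where "e > 0" "\<And>l. cmod l < e \<Longrightarrow> bounded_below M (shift S l)"
proof -
  obtain c where c: "c > 0" "\<And>x. x \<in> M \<Longrightarrow> c * norm x \<le> norm (S x)"
    using S by (auto simp: bounded_below_def)
  show thesis
  proof (rule that[OF c(1)])
    fix l assume l: "cmod l < c"
    have "(c - cmod l) * norm x \<le> norm (shift S l x)" if "x \<in> M" for x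
    proof -
      have "norm (S x) \<le> norm (S x - l *\<^sub>C x) + norm (l *\<^sub>C x)"
        using norm_triangle_ineq[of "S x - l *\<^sub>C x" "l *\<^sub>C x"] by simp
      then show ?thesis using c(2)[OF that] by (simp add: shift_def norm_scaleC algebra_simps)
    qed
    then show "bounded_below M (shift S l)"
      unfolding bounded_below_def using l by (intro exI[of _ "c - cmod l"]) auto
  qed
qed

text \<open>
  The bound \<open>C\<close> is uniform in the shift; this is what makes it possible to correct an approximate
  kernel vector later on.
\<close>

lemma shift_surjective_bound:
  assumes S: "banach_operator M S" and surj: "S ` M = M"
  obtains C e where "C > 0" "e > 0"
    "\<And>l y. cmod l < e \<Longrightarrow> y \<in> M \<Longrightarrow> \<exists>x\<in>M. shift S l x = y \<and> norm x \<le> C * norm y"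
proof -
  obtain C where C: "C > 0" "\<And>y. y \<in> S ` M \<Longrightarrow> \<exists>x\<in>M. S x = y \<and> norm x \<le> C * norm y"
    using banach_operator_open[OF S] surj banach_operator_closed[OF S] by metis
  show thesis
  proof (rule that)
    show "2 * C > 0" "1 / (2 * C) > 0" using C(1) by simp_all
    fix l y assume l: "cmod l < 1 / (2 * C)" and y: "y \<in> M"
    note Sl = banach_operator_shift[OF S, of l]
    show "\<exists>x\<in>M. shift S l x = y \<and> norm x \<le> 2 * C * norm y"
    proof (rule approximate_solutions_imp_solutions[OF banach_operator_subspace[OF S]
          banach_operator_complete[OF S] banach_operator_bounded[OF Sl]
          banach_operator_subspace[OF S] banach_operator_maps[OF Sl] less_imp_le[OF C(1)] _ y])
      fix z assume "z \<in> M"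
      then obtain x where x: "x \<in> M" "S x = z" "norm x \<le> C * norm z" using C(2) surj by metis
      have "norm (z - shift S l x) = cmod l * norm x" using x by (simp add: shift_def norm_scaleC)
      also have "\<dots> \<le> (1 / (2 * C)) * (C * norm z)" using l x C(1) by (intro mult_mono) auto
      also have "\<dots> = norm z / 2" using C(1) by simp
      finally show "\<exists>x\<in>M. norm x \<le> C * norm z \<and> norm (z - shift S l x) \<le> norm z / 2"
        using x by blast
    qed
  qed
qed

lemma surjective_shift:
  assumes S: "banach_operator M S" and surj: "S ` M = M"
  obtains e where "e > 0" "\<And>l. cmod l < e \<Longrightarrow> shift S l ` M = M"
proof -
  obtain C e where e: "C > 0" "e > 0"
      "\<And>l y. cmod l < e \<Longrightarrow> y \<in> M \<Longrightarrow> \<exists>x\<in>M. shift S l x = y \<and> norm x \<le> C * norm y"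
    using shift_surjective_bound[OF assms] by blast
  have "shift S l ` M = M" if "cmod l < e" for l
    using e(3)[OF that] banach_operator_maps[OF banach_operator_shift[OF S, of l]] by (metis image_eqI subsetI subset_antisym)
  then show thesis using that e(2) by blast
qed

section \<open>Invariant decompositions\<close>

text \<open>
  The isomorphism \<open>(A + B) / (A + B') \<cong> B / B'\<close> in terms of dimensions.
\<close>

lemma ccodim_sum_right:
  assumes X: "direct_sum X A B" and sub: "csubspace A" "csubspace B" "csubspace B'" and "B' \<subseteq> B"
  shows "ccodim X (subspace_sum A B') = ccodim B B'"
proof -
  obtain D where D: "csubspace D" "direct_sum B B' D" "D \<subseteq> B" "ccodim B B' = ccdim D"
    by (rule obtain_complement[OF sub(3,2) assms(5)])
  have "direct_sum X D (subspace_sum B' A)"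
    using X D(2) by (intro direct_sum_assoc(1)[OF _ _ D(1) sub(3,1)]) (simp_all add: direct_sum_commute)
  then have "direct_sum X (subspace_sum A B') D"
    by (simp add: direct_sum_commute subspace_sum_commute)
  then show ?thesis using ccodim_eq[OF csubspace_sum[OF sub(1,3)] D(1)] D(4) by simp
qed

context
  fixes S :: "'a::complex_normed_vector \<Rightarrow> 'a" and M M1 M2 :: "'a set"
  assumes ds: "direct_sum M M1 M2" and sub: "csubspace M1" "csubspace M2"
    and S: "clinear_on M S" and inv: "S ` M1 \<subseteq> M1" "S ` M2 \<subseteq> M2"
begin

lemma invariant_sum_subsets: "M1 \<subseteq> M" "M2 \<subseteq> M" "csubspace M"
  using direct_sum_supsets[OF ds sub] direct_sum_csubspace[OF ds sub] by simp_all

lemma invariant_sum_components: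
  assumes "x \<in> M"
  obtains a b where "a \<in> M1" "b \<in> M2" "x = a + b" "S x = S a + S b" "S a \<in> M1" "S b \<in> M2"
proof -
  have "x \<in> subspace_sum M1 M2" using assms ds by (simp add: direct_sum_iff)
  then obtain a b where ab: "a \<in> M1" "b \<in> M2" "x = a + b" by (rule subspace_sumE)
  then have "S x = S a + S b" using clinear_on_add[OF S] invariant_sum_subsets by auto
  then show thesis using that[OF ab] ab inv by blast
qed

lemma kernel_invariant_sum: "direct_sum (kernel M S) (kernel M1 S) (kernel M2 S)"
proof (rule direct_sumI)
  show "csubspace (kernel M1 S)" "csubspace (kernel M2 S)"
    using csubspace_kernel clinear_on_subset[OF S] invariant_sum_subsets sub by blast+
  show "kernel M1 S \<inter> kernel M2 S \<subseteq> {0}" using ds by (auto simp: direct_sum_iff kernel_def)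
  show "kernel M S = subspace_sum (kernel M1 S) (kernel M2 S)"
  proof (intro equalityI subsetI)
    fix x assume x: "x \<in> kernel M S"
    then have "x \<in> M" by (simp add: kernel_def)
    then obtain a b where ab: "a \<in> M1" "b \<in> M2" "x = a + b" "S x = S a + S b"
        "S a \<in> M1" "S b \<in> M2"
      by (rule invariant_sum_components)
    have "S a + S b = 0" using x ab(4) by (simp add: kernel_def)
    then have "S a = 0" "S b = 0" using direct_sum_zero[OF ds sub ab(5,6)] by simp_all
    then show "x \<in> subspace_sum (kernel M1 S) (kernel M2 S)"
      unfolding ab(3) using ab(1,2) by (intro subspace_sumI) (simp_all add: kernel_def)
  next
    fix x assume "x \<in> subspace_sum (kernel M1 S) (kernel M2 S)"
    then obtain a b where ab: "a \<in> kernel M1 S" "b \<in> kernel M2 S" "x = a + b"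
      by (rule subspace_sumE)
    have "a \<in> M" "b \<in> M" using ab invariant_sum_subsets by (auto simp: kernel_def)
    then show "x \<in> kernel M S"
      using ab clinear_on_add[OF S] complex_vector.subspace_add[OF invariant_sum_subsets(3)]
      by (simp add: kernel_def)
  qed
qed

lemma range_invariant_sum: "direct_sum (S ` M) (S ` M1) (S ` M2)"
proof (rule direct_sumI)
  note M = invariant_sum_subsets
  show "csubspace (S ` M1)" "csubspace (S ` M2)"
    using csubspace_image[OF S M(3)] sub M by simp_all
  show "S ` M1 \<inter> S ` M2 \<subseteq> {0}" using inv ds unfolding direct_sum_iff by blast
  show "S ` M = subspace_sum (S ` M1) (S ` M2)"
    using image_subspace_sum[OF S M(1,2)] ds by (simp add: direct_sum_iff)
qed

lemma ccdim_kernel_invariant_sum: "ccdim (kernel M S) = ccdim (kernel M1 S) + ccdim (kernel M2 S)"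
  by (rule ccdim_direct_sum[OF kernel_invariant_sum])
    (use csubspace_kernel clinear_on_subset[OF S] invariant_sum_subsets sub in blast)+

lemma ccodim_range_invariant_sum:
  "ccodim M (S ` M) = ccodim M1 (S ` M1) + ccodim M2 (S ` M2)"
proof -
  note M = invariant_sum_subsets
  have R: "csubspace (S ` M1)" "csubspace (S ` M2)"
    using csubspace_image[OF S M(3)] sub M by simp_all
  let ?X = "subspace_sum M1 (S ` M2)"
  have X: "csubspace ?X" "csubspace (S ` M)" "?X \<subseteq> M"
    using csubspace_sum[OF sub(1) R(2)] csubspace_image[OF S M(3) M(3)]
      subspace_sum_least[OF M(3) M(1)] inv(2) M(2) by auto
  have SM: "S ` M = subspace_sum (S ` M2) (S ` M1)"
    using range_invariant_sum by (simp add: direct_sum_iff subspace_sum_commute)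
  have "direct_sum ?X (S ` M2) M1"
    using ds inv(2) by (intro direct_sumI[OF R(2) sub(1)]) (auto simp: subspace_sum_commute direct_sum_iff)
  then have 1: "ccodim ?X (S ` M) = ccodim M1 (S ` M1)"
    unfolding SM by (rule ccodim_sum_right[OF _ R(2) sub(1) R(1) inv(1)])
  have "S ` M \<subseteq> ?X"
    unfolding SM
    by (rule subspace_sum_least[OF X(1) subspace_sum_upper2[OF sub(1)]
          order_trans[OF inv(1) subspace_sum_upper1[OF R(2)]]])
  then have "ccodim M (S ` M) = ccodim M ?X + ccodim ?X (S ` M)"
    using X(3) by (rule ccodim_chain[OF X(2,1) M(3)])
  moreover have "ccodim M ?X = ccodim M2 (S ` M2)"
    by (rule ccodim_sum_right[OF ds sub R(2) inv(2)])
  ultimately show ?thesis using 1 by (simp add: add.commute)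
qed

lemma range_invariant_part: "S ` M1 = S ` M \<inter> M1"
proof (intro equalityI subsetI)
  fix y assume y: "y \<in> S ` M \<inter> M1"
  then obtain x where x: "x \<in> M" "y = S x" by blast
  obtain a b where ab: "a \<in> M1" "b \<in> M2" "x = a + b" "S x = S a + S b" "S a \<in> M1" "S b \<in> M2"
    using x(1) by (rule invariant_sum_components)
  have "S a + S b = y + 0" using ab x by simp
  then have "S a = y"
    using direct_sum_unique(1)[OF ds sub ab(5,6)] y complex_vector.subspace_0[OF sub(2)] by blast
  then show "y \<in> S ` M1" using ab(1) by blast
qed (use inv invariant_sum_subsets in auto)

end

lemma power_invariant: "S ` M \<subseteq> M \<Longrightarrow> (S ^^ n) ` M \<subseteq> (M :: 'a set)"
  by (induction n) auto

lemma power_in: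
  assumes "banach_operator M S" "x \<in> M"
  shows "(S ^^ n) x \<in> M"
  using banach_operator_maps[OF banach_operator_power[OF assms(1)]] assms(2) by blast

lemma power_zero: "banach_operator M S \<Longrightarrow> (S ^^ n) 0 = 0"
  using clinear_on_zero[OF banach_operator_clinear[OF banach_operator_power]]
    banach_operator_csubspace by blast

lemma power_range_antimono:
  assumes S: "banach_operator M S" and "m \<le> n"
  shows "(S ^^ n) ` M \<subseteq> (S ^^ m) ` M"
proof
  fix y assume "y \<in> (S ^^ n) ` M"
  then obtain x where "x \<in> M" "y = (S ^^ n) x" by blast
  then have "y = (S ^^ m) ((S ^^ (n - m)) x)"
    using assms(2) by (metis comp_apply funpow_add le_add_diff_inverse)
  then show "y \<in> (S ^^ m) ` M" using power_in[OF S \<open>x \<in> M\<close>] by blast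
qed

section \<open>The Kato decomposition of a semi-Fredholm operator\<close>

text \<open>
  Semi-regular operators are also known as Kato operators. Usually only the range of \<open>S\<close> itself is
  required to be closed; together with the inclusion of the kernel this makes all the ranges closed.
\<close>

definition semi_regular :: "'a::complex_normed_vector set \<Rightarrow> ('a \<Rightarrow> 'a) \<Rightarrow> bool"
  where "semi_regular M S \<longleftrightarrow> (\<forall>n. closed ((S ^^ n) ` M) \<and> kernel M S \<subseteq> (S ^^ n) ` M)"

context
  fixes S :: "'a::complex_normed_vector \<Rightarrow> 'a" and M :: "'a set" and e :: 'a and j :: nat
  assumes S: "banach_operator M S" and e: "e \<in> M" "S ((S ^^ j) e) = 0"
    and x: "(S ^^ j) e \<notin> (S ^^ Suc j) ` M"
begin

lemma chain_vanishes: "i > j \<Longrightarrow> (S ^^ i) e = 0"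
proof -
  assume "i > j"
  then have "(S ^^ i) e = (S ^^ (i - Suc j)) ((S ^^ Suc j) e)"
    by (metis Suc_leI comp_apply funpow_add le_add_diff_inverse2)
  also have "(S ^^ Suc j) e = 0" using e(2) by simp
  finally show ?thesis using power_zero[OF S] by simp
qed

text \<open>
  The vectors \<open>(S ^^ i) e\<close> with \<open>i \<le> j\<close> are independent modulo the range of \<open>S ^^ Suc j\<close>. In the
  induction on the lowest index \<open>m\<close> that occurs, \<open>S ^^ (j - m)\<close> sends \<open>(S ^^ m) e\<close> to \<open>(S ^^ j) e\<close> and
  all later vectors to zero, so the coefficient at \<open>m\<close> vanishes.
\<close>

lemma chain_end_not_in_span:
  "(S ^^ j) e \<notin> subspace_sum ((S ^^ Suc j) ` M) (cspan ((\<lambda>i. (S ^^ i) e) ` {m..<j}))"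
proof (cases "m \<le> j")
  case True
  let ?R = "(S ^^ Suc j) ` M"
  note lin = banach_operator_clinear[OF banach_operator_power[OF S]]
  note M = banach_operator_csubspace[OF S]
  have R: "csubspace ?R" by (rule banach_operator_range[OF banach_operator_power[OF S]])
  from True show ?thesis
  proof (induction m rule: inc_induct)
    case base
    then show ?case using x by (auto elim!: subspace_sumE)
  next
    case (step m)
    let ?B = "(\<lambda>i. (S ^^ i) e) ` {Suc m..<j}"
    have "{m..<j} = insert m {Suc m..<j}" using step.hyps by auto
    then have ins: "(\<lambda>i. (S ^^ i) e) ` {m..<j} = insert ((S ^^ m) e) ?B" by simp
    show ?case
    proof
      assume "(S ^^ j) e \<in> subspace_sum ?R (cspan ((\<lambda>i. (S ^^ i) e) ` {m..<j}))"
      then obtain r w where rw: "r \<in> ?R" "w \<in> cspan (insert ((S ^^ m) e) ?B)" "(S ^^ j) e = r + w"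
        unfolding ins by (rule subspace_sumE)
      then obtain c where c: "w - c *\<^sub>C (S ^^ m) e \<in> cspan ?B"
        using complex_vector.span_breakdown_eq by blast
      define w' where "w' = w - c *\<^sub>C (S ^^ m) e"
      \<comment> \<open>applying \<open>S ^^ (j - m)\<close> kills everything except the coefficient of \<open>(S ^^ m) e\<close>\<close>
      let ?P = "S ^^ (j - m)"
      have BM: "?B \<subseteq> kernel M ?P"
      proof
        fix y assume "y \<in> ?B"
        then obtain i where i: "y = (S ^^ i) e" "i \<ge> Suc m" by auto
        have "?P y = (S ^^ (j - m + i)) e" by (simp add: i funpow_add)
        moreover have "j - m + i > j" using i step.hyps by simp
        ultimately show "y \<in> kernel M ?P"
          using chain_vanishes power_in[OF S e(1)] i by (simp add: kernel_def)
      qed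
      have w': "w' \<in> M" "?P w' = 0"
        using subsetD[OF complex_vector.span_minimal[OF BM
              banach_operator_kernel[OF banach_operator_power[OF S]]] c]
        by (auto simp: kernel_def w'_def)
      have rM: "r \<in> M" using rw(1) banach_operator_maps[OF banach_operator_power[OF S]] by blast
      have eM: "(S ^^ m) e \<in> M" "c *\<^sub>C (S ^^ m) e \<in> M"
        using power_in[OF S e(1)] complex_vector.subspace_scale[OF M] by auto
      have Pm: "?P ((S ^^ m) e) = (S ^^ j) e"
        using step.hyps by (metis comp_apply funpow_add le_add_diff_inverse2 less_imp_le)
      have "?P ((S ^^ j) e) = 0"
      proof -
        have "?P ((S ^^ j) e) = (S ^^ (j - m + j)) e" by (simp add: funpow_add)
        then show ?thesis using chain_vanishes step.hyps by simp
      qed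
      moreover have "(S ^^ j) e = r + (c *\<^sub>C (S ^^ m) e + w')" using rw(3) by (simp add: w'_def)
      ultimately have "0 = ?P r + (c *\<^sub>C (S ^^ j) e + 0)"
        using rM eM w' complex_vector.subspace_add[OF M]
        by (metis Pm clinear_on_add[OF lin] clinear_on_scale[OF lin])
      then have cj: "c *\<^sub>C (S ^^ j) e = - ?P r" by (simp add: eq_neg_iff_add_eq_0 add.commute)
      have "?P r \<in> ?R"
      proof -
        obtain y where "y \<in> M" "r = (S ^^ Suc j) y" using rw(1) by blast
        then have "?P r = (S ^^ Suc j) (?P y)"
          by (metis add.commute comp_apply funpow_add)
        then show ?thesis using power_in[OF S \<open>y \<in> M\<close>] by blast
      qed
      then have cR: "c *\<^sub>C (S ^^ j) e \<in> ?R" unfolding cj by (rule complex_vector.subspace_neg[OF R])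
      have "c = 0"
      proof (rule ccontr)
        assume "c \<noteq> 0"
        then have "(S ^^ j) e = inverse c *\<^sub>C c *\<^sub>C (S ^^ j) e" by (simp add: scaleC_scaleC scaleC_one)
        then have "(S ^^ j) e \<in> ?R" using complex_vector.subspace_scale[OF R cR, of "inverse c"] by simp
        then show False using x by simp
      qed
      then have "w \<in> cspan ?B" using c by simp
      then have "(S ^^ j) e \<in> subspace_sum ?R (cspan ?B)"
        unfolding rw(3) using rw(1) by (intro subspace_sumI)
      then show False using step.IH by simp
    qed
  qed
next
  case False
  then show ?thesis using x by (auto elim!: subspace_sumE)
qed

text \<open>
  A kernel vector \<open>(S ^^ j) e\<close> outside the range of \<open>S ^^ Suc j\<close> splits off a nilpotent Jordan
  block. Take a functional \<open>f\<close> that is 1 at \<open>(S ^^ j) e\<close> and vanishes at the earlier vectors of the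
  chain and on the range of \<open>S ^^ Suc j\<close>. The span \<open>E\<close> of the chain and the common kernel \<open>M1\<close> of the
  functionals \<open>f \<circ> S ^^ i\<close> are invariant, and the coefficients of a vector along the chain are read off
  by these functionals.
\<close>

lemma nilpotent_chain_splits:
  assumes cl: "closed ((S ^^ Suc j) ` M)"
  obtains M1 E where "csubspace M1" "closed M1" "S ` M1 \<subseteq> M1"
    "csubspace E" "ccdim E < \<infinity>" "S ` E \<subseteq> E" "\<And>z. z \<in> E \<Longrightarrow> (S ^^ Suc j) z = 0"
    "direct_sum M M1 E" "(S ^^ j) e \<in> E"
proof -
  let ?R = "(S ^^ Suc j) ` M"
  define b where "b i = (S ^^ i) e" for i
  note M = banach_operator_csubspace[OF S]
  note lin = banach_operator_clinear[OF banach_operator_power[OF S]]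
  have R: "csubspace ?R" by (rule banach_operator_range[OF banach_operator_power[OF S]])
  have bM: "b i \<in> M" for i unfolding b_def by (rule power_in[OF S e(1)])
  have Sb: "(S ^^ i) (b l) = b (i + l)" for i l by (simp add: b_def funpow_add)
  have b0: "b i = 0" if "i > j" for i using chain_vanishes that by (simp add: b_def)
  let ?L = "subspace_sum ?R (cspan (b ` {0..<j}))"
  have "b j \<notin> ?L" using chain_end_not_in_span[of 0] by (simp add: b_def)
  then obtain f where f: "f \<in> cdual" "blinfun_apply f (b j) = 1" "\<And>y. y \<in> ?L \<Longrightarrow> blinfun_apply f y = 0"
    using separating_functional[OF csubspace_sum[OF R complex_vector.subspace_span]
        closed_sum_finite_span[OF R cl]] by (metis finite_atLeastLessThan finite_imageI)
  have fR: "blinfun_apply f y = 0" if "y \<in> ?R" for y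
    using f(3) subsetD[OF subspace_sum_upper1[OF complex_vector.subspace_span] that] .
  have "blinfun_apply f (b i) = 0" if "i < j" for i
    using that by (intro f(3) subsetD[OF subspace_sum_upper2[OF R]] complex_vector.span_base) auto
  then have fb: "blinfun_apply f (b i) = (if i = j then 1 else 0)" for i
    using f(2) b0[of i] by (cases i j rule: linorder_cases) (auto simp: blinfun.zero_right)
  have f_scale: "blinfun_apply f (c *\<^sub>C y) = c * blinfun_apply f y" for c y
    using f(1) by (simp add: cdual_def)
  define E where "E = cspan (b ` {..j})"
  define M1 where "M1 = {y \<in> M. \<forall>i\<le>j. blinfun_apply f ((S ^^ i) y) = 0}"
  define P where "P y = (\<Sum>l\<le>j. blinfun_apply f ((S ^^ (j - l)) y) *\<^sub>C b l)" for y
  have E: "csubspace E" unfolding E_def by (rule complex_vector.subspace_span)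
  have bE: "b i \<in> E" if "i \<le> j" for i
    unfolding E_def using that by (intro complex_vector.span_base) auto
  have bE': "b i \<in> E" for i
    using bE[of i] b0[of i] complex_vector.subspace_0[OF E] by (cases "i \<le> j") auto
  have span_E: "E \<subseteq> W" if "csubspace W" "\<And>i. i \<le> j \<Longrightarrow> b i \<in> W" for W
    unfolding E_def using that by (intro complex_vector.span_minimal) auto
  have EM: "E \<subseteq> M" using bM by (intro span_E M)
  have M1: "csubspace M1"
    unfolding complex_vector.subspace_def M1_def
    using M by (auto simp: complex_vector.subspace_0 complex_vector.subspace_add
        complex_vector.subspace_scale clinear_on_zero[OF lin M] clinear_on_add[OF lin]
        clinear_on_scale[OF lin] blinfun.add_right f_scale)
  have "closed M1"
    unfolding closed_sequential_limits
  proof (intro allI impI, elim conjE)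
    fix s y assume s: "\<forall>n. s n \<in> M1" and lim: "s \<longlonglongrightarrow> y"
    have sM: "s n \<in> M" for n using s by (simp add: M1_def)
    then have y: "y \<in> M" using banach_operator_closed[OF S] lim unfolding closed_sequential_limits by blast
    have "blinfun_apply f ((S ^^ i) y) = 0" if "i \<le> j" for i
    proof -
      have "(\<lambda>n. (S ^^ i) (s n)) \<longlonglongrightarrow> (S ^^ i) y"
        using bounded_linear_on_tendsto[OF banach_operator_bounded[OF banach_operator_power[OF S]]
            banach_operator_subspace[OF S] y sM lim] .
      then have "(\<lambda>n. blinfun_apply f ((S ^^ i) (s n))) \<longlonglongrightarrow> blinfun_apply f ((S ^^ i) y)"
        by (intro blinfun.tendsto tendsto_const)
      moreover have "blinfun_apply f ((S ^^ i) (s n)) = 0" for n using s that by (simp add: M1_def)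
      ultimately show ?thesis by (simp add: LIMSEQ_const_iff)
    qed
    then show "y \<in> M1" using y by (simp add: M1_def)
  qed
  moreover have "S ` M1 \<subseteq> M1"
  proof (intro image_subsetI)
    fix y assume y: "y \<in> M1"
    then have yM: "y \<in> M" by (simp add: M1_def)
    have "blinfun_apply f ((S ^^ i) (S y)) = 0" if "i \<le> j" for i
    proof (cases "i = j")
      case True
      have "(S ^^ i) (S y) \<in> ?R" unfolding True using yM by (auto simp: funpow_swap1)
      then show ?thesis by (rule fR)
    next
      case False
      then have "Suc i \<le> j" using that by simp
      then have "blinfun_apply f ((S ^^ Suc i) y) = 0" using y unfolding M1_def by blast
      then show ?thesis by (simp add: funpow_swap1)
    qed
    then show "S y \<in> M1" using banach_operator_maps[OF S] yM by (auto simp: M1_def)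
  qed
  moreover have "S ` E \<subseteq> E"
  proof -
    have "E \<subseteq> {z \<in> M. S z \<in> E}"
    proof (rule span_E)
      show "csubspace {z \<in> M. S z \<in> E}"
        using M E banach_operator_clinear[OF S] clinear_on_zero[OF banach_operator_clinear[OF S] M]
        unfolding complex_vector.subspace_def by (auto simp: clinear_on_add clinear_on_scale)
      show "b i \<in> {z \<in> M. S z \<in> E}" for i using bM bE' Sb[of 1 i] by simp
    qed
    then show ?thesis by blast
  qed
  moreover have "(S ^^ Suc j) z = 0" if "z \<in> E" for z
  proof -
    have "E \<subseteq> kernel M (S ^^ Suc j)"
    proof (rule span_E[OF banach_operator_kernel[OF banach_operator_power[OF S]]])
      show "b i \<in> kernel M (S ^^ Suc j)" for i
        using bM Sb[of "Suc j" i] b0[of "Suc j + i"] by (simp add: kernel_def)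
    qed
    then show ?thesis using that by (auto simp: kernel_def)
  qed
  moreover have "ccdim E < \<infinity>"
    unfolding ccdim_less_infinity_iff E_def by (intro exI[of _ "b ` {..j}"]) auto
  moreover have "direct_sum M M1 E"
  proof (rule direct_sumI[OF M1 E])
    have P_E: "P y \<in> E" for y
      unfolding P_def by (intro complex_vector.subspace_sum[OF E] complex_vector.subspace_scale[OF E] bE')
    have P_add: "P (y + z) = P y + P z" if "y \<in> M" "z \<in> M" for y z
      using that by (simp add: P_def clinear_on_add[OF lin] blinfun.add_right scaleC_add_left sum.distrib)
    have P_scale: "P (c *\<^sub>C y) = c *\<^sub>C P y" if "y \<in> M" for c y
      using that by (simp add: P_def clinear_on_scale[OF lin] f_scale scaleC_scaleC complex_vector.scale_sum_right)
    have P_b: "P (b i) = b i" if "i \<le> j" for i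
    proof -
      have "P (b i) = (\<Sum>l\<le>j. if l = i then b l else 0)"
        unfolding P_def Sb fb using that
        by (intro sum.cong) (auto simp: scaleC_one)
      then show ?thesis using that by simp
    qed
    have P_0: "P 0 = 0" using P_scale[of 0 0] complex_vector.subspace_0[OF M] by simp
    have "E \<subseteq> {z \<in> M. P z = z}"
    proof (rule span_E)
      show "csubspace {z \<in> M. P z = z}"
        using M P_0 unfolding complex_vector.subspace_def by (auto simp: P_add P_scale)
      show "b i \<in> {z \<in> M. P z = z}" if "i \<le> j" for i using bM P_b that by simp
    qed
    then have P_id: "P z = z" if "z \<in> E" for z using that by blast
    show "M1 \<inter> E \<subseteq> {0}"
    proof
      fix z assume z: "z \<in> M1 \<inter> E"
      then have "P z = 0" unfolding P_def M1_def by (intro sum.neutral) simp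
      then show "z \<in> {0}" using P_id z by simp
    qed
    have "y - P y \<in> M1" if y: "y \<in> M" for y
    proof -
      have "blinfun_apply f ((S ^^ i) (y - P y)) = 0" if i: "i \<le> j" for i
      proof -
        have "(S ^^ i) (P y) = (\<Sum>l\<le>j. blinfun_apply f ((S ^^ (j - l)) y) *\<^sub>C b (i + l))"
        proof -
          have "(S ^^ i) (\<Sum>l\<in>A. c l *\<^sub>C b l) = (\<Sum>l\<in>A. c l *\<^sub>C b (i + l)) \<and> (\<Sum>l\<in>A. c l *\<^sub>C b l) \<in> M"
            if "finite A" for A c
            using that
          proof (induction A)
            case empty
            then show ?case using power_zero[OF S] complex_vector.subspace_0[OF M] by simp
          next
            case (insert a A)
            have "c a *\<^sub>C b a \<in> M" using bM by (rule complex_vector.subspace_scale[OF M])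
            then show ?case using insert bM
              by (simp add: clinear_on_add[OF lin] clinear_on_scale[OF lin] Sb complex_vector.subspace_add[OF M])
          qed
          then show ?thesis unfolding P_def by simp
        qed
        then have "blinfun_apply f ((S ^^ i) (P y))
            = (\<Sum>l\<le>j. blinfun_apply f ((S ^^ (j - l)) y) * blinfun_apply f (b (i + l)))"
          by (simp add: blinfun.sum_right f_scale)
        also have "\<dots> = (\<Sum>l\<le>j. if l = j - i then blinfun_apply f ((S ^^ i) y) else 0)"
          unfolding fb using i by (intro sum.cong) auto
        also have "\<dots> = blinfun_apply f ((S ^^ i) y)" by simp
        finally show ?thesis
          using y P_E EM by (simp add: clinear_on_diff[OF lin M] subsetD blinfun.diff_right)
      qed
      then show ?thesis
        using complex_vector.subspace_diff[OF M y subsetD[OF EM P_E]] by (simp add: M1_def)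
    qed
    then have "y \<in> subspace_sum M1 E" if "y \<in> M" for y
      using subspace_sumI[of "y - P y" M1 "P y" E] P_E that by simp
    moreover have "M1 \<subseteq> M" by (auto simp: M1_def)
    ultimately show "M = subspace_sum M1 E" using subspace_sum_least[OF M _ EM, of M1] by blast
  qed
  ultimately show thesis using that M1 E bE[of j] by (simp add: b_def)
qed

end

text \<open>
  The part \<open>M0\<close> is finite-dimensional and nilpotent, so it contributes equally to the kernel and the
  cokernel, and can be absorbed into a quasi-nilpotent summand.
\<close>

definition nilpotent_splitting ::
  "'a::complex_normed_vector set \<Rightarrow> ('a \<Rightarrow> 'a) \<Rightarrow> 'a set \<Rightarrow> 'a set \<Rightarrow> bool"
  where "nilpotent_splitting M S M1 M0 \<longleftrightarrow>
    csubspace M1 \<and> closed M1 \<and> S ` M1 \<subseteq> M1 \<and>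
    csubspace M0 \<and> ccdim M0 < \<infinity> \<and> S ` M0 \<subseteq> M0 \<and> direct_sum M M1 M0 \<and>
    (\<exists>p. \<forall>z\<in>M0. (S ^^ p) z = 0)"

lemma power_range_closed_direct_part:
  assumes S: "banach_operator M S" and ds: "direct_sum M M1 M2"
    and sub: "csubspace M1" "csubspace M2" "closed M1"
    and inv: "S ` M1 \<subseteq> M1" "S ` M2 \<subseteq> M2" and cl: "closed ((S ^^ n) ` M)"
  shows "closed ((S ^^ n) ` M1)"
proof -
  have "(S ^^ n) ` M1 = (S ^^ n) ` M \<inter> M1"
    by (rule range_invariant_part[OF ds sub(1,2) banach_operator_clinear[OF banach_operator_power[OF S]]
          power_invariant[OF inv(1)] power_invariant[OF inv(2)]])
  then show ?thesis using cl sub(3) by (simp add: closed_Int)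
qed

lemma enat_less_summand: "enat n = a + c \<Longrightarrow> c > 0 \<Longrightarrow> \<exists>m<n. a = enat m"
  by (cases a; cases c) (auto simp: zero_enat_def)

text \<open>
  As long as \<open>S\<close> is not semi-regular, a Jordan block splits off; the shortest chain violating
  semi-regularity is the one to use. Every block lowers both the dimension of the kernel and the
  codimension of the range, and one of them is finite.
\<close>

lemma Kato_decomposition:
  assumes S: "banach_operator M S" and cl: "\<And>n. closed ((S ^^ n) ` M)"
    and fin: "ccdim (kernel M S) < \<infinity> \<or> ccodim M (S ` M) < \<infinity>"
  shows "\<exists>M1 M0. nilpotent_splitting M S M1 M0 \<and> semi_regular M1 S"
proof -
  obtain n where "ccdim (kernel M S) = enat n \<or> ccodim M (S ` M) = enat n" using fin by auto
  then show ?thesis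
    using S cl
  proof (induction n arbitrary: M rule: less_induct)
    case (less n)
    note S = less.prems(2) and cl = less.prems(3)
    note M = banach_operator_csubspace[OF S]
    show ?case
    proof (cases "semi_regular M S")
      case True
      have "nilpotent_splitting M S M {0}"
        unfolding nilpotent_splitting_def
      proof (intro conjI)
        show "direct_sum M M {0}"
          by (rule direct_sumI[OF M complex_vector.subspace_single_0]) (auto simp: subspace_sum_def)
        show "S ` {0} \<subseteq> {0}" using power_zero[OF S, of 1] by simp
        show "\<exists>p. \<forall>z\<in>{0}. (S ^^ p) z = 0" by (intro exI[of _ 0]) simp
      qed (use M banach_operator_closed[OF S] banach_operator_maps[OF S] complex_vector.subspace_single_0
          in auto)
      then show ?thesis using True by blast
    next
      case False
      then have ex: "\<exists>n. \<exists>x\<in>kernel M S. x \<notin> (S ^^ n) ` M" using cl by (auto simp: semi_regular_def)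
      define k where "k = (LEAST n. \<exists>x\<in>kernel M S. x \<notin> (S ^^ n) ` M)"
      obtain x where x: "x \<in> kernel M S" "x \<notin> (S ^^ k) ` M"
        using LeastI_ex[OF ex] unfolding k_def by blast
      have "k \<noteq> 0" using x by (auto simp: kernel_def)
      then obtain j where j: "k = Suc j" by (cases k) auto
      then have "\<not> (\<exists>x\<in>kernel M S. x \<notin> (S ^^ j) ` M)"
        using not_less_Least[of j "\<lambda>n. \<exists>x\<in>kernel M S. x \<notin> (S ^^ n) ` M"] unfolding k_def by simp
      then obtain e where e: "e \<in> M" "x = (S ^^ j) e" using x(1) by blast
      have Se: "S ((S ^^ j) e) = 0" "(S ^^ j) e \<notin> (S ^^ Suc j) ` M"
        using x e j by (auto simp: kernel_def)
      obtain M1 E where M1: "csubspace M1" "closed M1" "S ` M1 \<subseteq> M1"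
        and E: "csubspace E" "ccdim E < \<infinity>" "S ` E \<subseteq> E" "\<And>z. z \<in> E \<Longrightarrow> (S ^^ Suc j) z = 0"
        and ds: "direct_sum M M1 E" and jE: "(S ^^ j) e \<in> E"
        using nilpotent_chain_splits[OF S e(1) Se cl] by metis
      note lin = banach_operator_clinear[OF S]
      have EM: "E \<subseteq> M" "M1 \<subseteq> M" using direct_sum_supsets[OF ds M1(1) E(1)] by auto
      have S1: "banach_operator M1 S" by (rule banach_operator_restrict[OF S M1(1,2) EM(2) M1(3)])
      have linE: "clinear_on E S" using lin EM(1) by (rule clinear_on_subset)
      have kerE: "ccdim (kernel E S) = ccodim E (S ` E)"
        by (rule ccdim_kernel_eq_ccodim_range[OF linE E(1,2,3)])
      have "ccdim (kernel E S) \<noteq> 0"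
      proof
        assume "ccdim (kernel E S) = 0"
        then have "kernel E S = {0}" using ccdim_eq_0_iff[OF csubspace_kernel[OF linE E(1)]] by simp
        then have "(S ^^ j) e = 0" using jE Se(1) by (auto simp: kernel_def)
        moreover have "0 \<in> (S ^^ Suc j) ` M"
          by (rule complex_vector.subspace_0[OF banach_operator_range[OF banach_operator_power[OF S]]])
        ultimately show False using Se(2) by simp
      qed
      then have pos: "ccdim (kernel E S) > 0" by simp
      have "ccdim (kernel M S) = ccdim (kernel M1 S) + ccdim (kernel E S)"
        by (rule ccdim_kernel_invariant_sum[OF ds M1(1) E(1) lin M1(3) E(3)])
      moreover have "ccodim M (S ` M) = ccodim M1 (S ` M1) + ccdim (kernel E S)"
        unfolding kerE by (rule ccodim_range_invariant_sum[OF ds M1(1) E(1) lin M1(3) E(3)])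
      ultimately have "\<exists>m<n. ccdim (kernel M1 S) = enat m \<or> ccodim M1 (S ` M1) = enat m"
        using less.prems(1) enat_less_summand[OF _ pos, of n] by metis
      then obtain m where m: "m < n" "ccdim (kernel M1 S) = enat m \<or> ccodim M1 (S ` M1) = enat m"
        by blast
      have "closed ((S ^^ n) ` M1)" for n
        by (rule power_range_closed_direct_part[OF S ds M1(1) E(1) M1(2,3) E(3) cl])
      then obtain M1' M0 where sp: "nilpotent_splitting M1 S M1' M0" and reg: "semi_regular M1' S"
        using less.IH[OF m(1,2) S1] by blast
      then obtain p where p: "\<forall>z\<in>M0. (S ^^ p) z = 0" by (auto simp: nilpotent_splitting_def)
      have 1: "csubspace M1'" "closed M1'" "S ` M1' \<subseteq> M1'"
        "csubspace M0" "ccdim M0 < \<infinity>" "S ` M0 \<subseteq> M0" "direct_sum M1 M1' M0"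
        using sp by (simp_all add: nilpotent_splitting_def)
      let ?E = "subspace_sum M0 E"
      note ds' = direct_sum_assoc[OF ds 1(7) 1(1) 1(4) E(1)]
      have M0M: "M0 \<subseteq> M" using direct_sum_supsets[OF 1(7) 1(1) 1(4)] EM(2) by blast
      have "nilpotent_splitting M S M1' ?E"
        unfolding nilpotent_splitting_def
      proof (intro conjI 1(1-3) ds'(1))
        show "csubspace ?E" by (rule csubspace_sum[OF 1(4) E(1)])
        show "ccdim ?E < \<infinity>" using ccdim_direct_sum[OF ds'(2) 1(4) E(1)] 1(5) E(2)
          by (simp add: plus_eq_infty_iff_enat)
        show "S ` ?E \<subseteq> ?E"
        proof (intro image_subsetI)
          fix z assume "z \<in> ?E"
          then obtain a b where ab: "a \<in> M0" "b \<in> E" "z = a + b" by (rule subspace_sumE)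
          then have "S z = S a + S b" using clinear_on_add[OF lin] M0M EM by auto
          then show "S z \<in> ?E" using ab 1(6) E(3) subspace_sumI[of "S a" M0 "S b" E] by auto
        qed
        show "\<exists>q. \<forall>z\<in>?E. (S ^^ q) z = 0"
        proof (intro exI ballI)
          fix z assume "z \<in> ?E"
          then obtain a b where ab: "a \<in> M0" "b \<in> E" "z = a + b" by (rule subspace_sumE)
          have "(S ^^ (Suc j + p)) a = (S ^^ Suc j) ((S ^^ p) a)" by (simp only: funpow_add comp_apply)
          then have "(S ^^ (Suc j + p)) a = 0"
            using bspec[OF p ab(1)] power_zero[OF S] by (simp only:)
          moreover have "(S ^^ (p + Suc j)) b = (S ^^ p) ((S ^^ Suc j) b)" by (simp only: funpow_add comp_apply)
          then have "(S ^^ (Suc j + p)) b = 0"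
            using E(4)[OF ab(2)] power_zero[OF S] by (simp only: add.commute)
          moreover have "a \<in> M" "b \<in> M" using ab M0M EM by auto
          ultimately show "(S ^^ (Suc j + p)) z = 0"
            using clinear_on_add[OF banach_operator_clinear[OF banach_operator_power[OF S]],
                of a b "Suc j + p"] unfolding ab(3) by (simp only: add_0)
        qed
      qed
      then show ?thesis using reg by blast
    qed
  qed
qed

text \<open>
  Adding the finite-dimensional kernel to a closed subspace keeps it closed and does not change its
  image.
\<close>

lemma closed_power_ranges_upper:
  assumes S: "banach_operator M S" and fin: "ccdim (kernel M S) < \<infinity>" and cl: "closed (S ` M)"
  shows "closed ((S ^^ n) ` M)"
proof (induction n)
  case 0
  then show ?case using banach_operator_closed[OF S] by simp
next
  case (Suc n)
  let ?L = "(S ^^ n) ` M" and ?N = "kernel M S"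
  have L: "csubspace ?L" "?L \<subseteq> M"
    using banach_operator_range banach_operator_maps banach_operator_power[OF S] by blast+
  note N = banach_operator_kernel[OF S]
  have NM: "?N \<subseteq> M" by (auto simp: kernel_def)
  have "closed (S ` subspace_sum ?L ?N)"
  proof (rule closed_image_of_closed[OF S cl csubspace_sum[OF L(1) N]])
    show "closed (subspace_sum ?L ?N)" by (rule closed_sum_finite_dim[OF L(1) Suc N fin])
    show "subspace_sum ?L ?N \<subseteq> M"
      by (rule subspace_sum_least[OF banach_operator_csubspace[OF S] L(2) NM])
    show "?N \<subseteq> subspace_sum ?L ?N" by (rule subspace_sum_upper2[OF L(1)])
  qed
  moreover have "S ` ?N = {0}"
    using complex_vector.subspace_0[OF N] clinear_on_zero[OF banach_operator_clinear[OF S]]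
      banach_operator_csubspace[OF S] by (force simp: kernel_def)
  then have "S ` subspace_sum ?L ?N = S ` ?L"
    using image_subspace_sum[OF banach_operator_clinear[OF S] L(2) NM] by simp
  moreover have "(S ^^ Suc n) ` M = S ` ?L" by (simp add: image_comp)
  ultimately show ?case by simp
qed

lemma ccodim_sum_le:
  assumes "csubspace L" "csubspace C"
  shows "ccodim (subspace_sum L C) L \<le> ccdim C"
proof -
  have LC: "csubspace (L \<inter> C)" by (rule complex_vector.subspace_inter[OF assms])
  obtain C' where C': "csubspace C'" "direct_sum C (L \<inter> C) C'" "C' \<subseteq> C" "ccodim C (L \<inter> C) = ccdim C'"
    by (rule obtain_complement[OF LC assms(2)]) auto
  have C: "C = subspace_sum (L \<inter> C) C'" using C'(2) by (simp add: direct_sum_iff)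
  have "direct_sum (subspace_sum L C) L C'"
  proof (rule direct_sumI[OF assms(1) C'(1)])
    show "L \<inter> C' \<subseteq> {0}" using C'(2,3) by (auto simp: direct_sum_iff)
    have "subspace_sum L C \<subseteq> subspace_sum L C'"
    proof (rule subspace_sum_least[OF csubspace_sum[OF assms(1) C'(1)] subspace_sum_upper1[OF C'(1)]])
      show "C \<subseteq> subspace_sum L C'" by (subst C) (auto elim!: subspace_sumE intro: subspace_sumI)
    qed
    moreover have "subspace_sum L C' \<subseteq> subspace_sum L C"
      using C'(3) by (auto elim!: subspace_sumE intro: subspace_sumI)
    ultimately show "subspace_sum L C = subspace_sum L C'" by blast
  qed
  then have "ccodim (subspace_sum L C) L = ccdim C'" by (rule ccodim_eq[OF assms(1) C'(1)])
  also have "\<dots> \<le> ccdim C" using C'(1,3) by (rule ccdim_mono)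
  finally show ?thesis .
qed

lemma ccodim_image_le:
  assumes T: "clinear_on M T" and sub: "csubspace M" "csubspace L" and LM: "L \<subseteq> M"
  shows "ccodim (T ` M) (T ` L) \<le> ccodim M L"
proof -
  obtain C where C: "csubspace C" "direct_sum M L C" "C \<subseteq> M" "ccodim M L = ccdim C"
    by (rule obtain_complement[OF sub(2,1) LM])
  have "T ` M = subspace_sum (T ` L) (T ` C)"
    using image_subspace_sum[OF T LM C(3)] C(2) by (simp add: direct_sum_iff)
  then have "ccodim (T ` M) (T ` L) \<le> ccdim (T ` C)"
    using ccodim_sum_le[OF csubspace_image[OF T sub(1) sub(2) LM] csubspace_image[OF T sub(1) C(1,3)]]
    by simp
  also have "\<dots> \<le> ccdim C" by (rule ccdim_image_le[OF clinear_on_subset[OF T C(3)] C(1)])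
  finally show ?thesis using C(4) by simp
qed

lemma ccodim_power_range:
  assumes S: "banach_operator M S" and fin: "ccodim M (S ` M) < \<infinity>"
  shows "ccodim M ((S ^^ n) ` M) < \<infinity>"
proof (induction n)
  case 0
  then show ?case
    using ccodim_eq_0_iff[OF banach_operator_csubspace[OF S] banach_operator_csubspace[OF S]] by simp
next
  case (Suc n)
  let ?L = "(S ^^ n) ` M"
  note M = banach_operator_csubspace[OF S] and lin = banach_operator_clinear[OF S]
  have L: "csubspace ?L" "?L \<subseteq> M"
    using banach_operator_range banach_operator_maps banach_operator_power[OF S] by blast+
  have "ccodim M (S ` ?L) = ccodim M (S ` M) + ccodim (S ` M) (S ` ?L)"
    by (rule ccodim_chain[OF csubspace_image[OF lin M L] banach_operator_range[OF S] M
          image_mono[OF L(2)] banach_operator_maps[OF S]])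
  moreover have "ccodim (S ` M) (S ` ?L) < \<infinity>"
    using ccodim_image_le[OF lin M L] Suc by (rule le_less_trans)
  moreover have "(S ^^ Suc n) ` M = S ` ?L" by (simp add: image_comp)
  ultimately show ?case using fin by (simp add: plus_eq_infty_iff_enat)
qed

lemma closed_power_ranges_lower:
  assumes S: "banach_operator M S" and fin: "ccodim M (S ` M) < \<infinity>"
  shows "closed ((S ^^ n) ` M)"
  by (rule closed_range_of_finite_codim[OF banach_operator_power[OF S] ccodim_power_range[OF assms]])

section \<open>Ascent and descent near a semi-regular operator\<close>

lemma ascent_finite_iff: "ascent M T < \<infinity> \<longleftrightarrow> (\<exists>p. kernel M (T ^^ p) = kernel M (T ^^ Suc p))"
  unfolding ascent_def Inf_less_iff by (auto simp del: funpow.simps)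

lemma descent_finite_iff: "descent M T < \<infinity> \<longleftrightarrow> (\<exists>q. (T ^^ q) ` M = (T ^^ Suc q) ` M)"
  unfolding descent_def Inf_less_iff by (auto simp del: funpow.simps)

text \<open>
  Also called the hyper-range of \<open>A\<close>. For a semi-regular operator it is a closed subspace containing
  the kernel, on which the operator is onto; this makes it the right place to study small shifts.
\<close>

definition core :: "'a::complex_normed_vector set \<Rightarrow> ('a \<Rightarrow> 'a) \<Rightarrow> 'a set"
  where "core M A = (\<Inter>n. (A ^^ n) ` M)"

lemma
  assumes A: "banach_operator M A" and reg: "semi_regular M A"
  shows core_subset: "core M A \<subseteq> M"
    and core_image: "A ` core M A = core M A"
    and kernel_subset_core: "kernel M A \<subseteq> core M A"
    and core_operator: "banach_operator (core M A) A"
proof -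
  show sub: "core M A \<subseteq> M" unfolding core_def by (rule INT_lower[of 0, simplified, THEN subset_trans]) simp_all
  show ker: "kernel M A \<subseteq> core M A" using reg by (auto simp: semi_regular_def core_def)
  have R: "csubspace (core M A)"
    unfolding core_def
    by (rule complex_vector.subspace_Inter) (use banach_operator_range[OF banach_operator_power[OF A]] in auto)
  have cl: "closed (core M A)" unfolding core_def using reg by (auto simp: semi_regular_def)
  note lin = banach_operator_clinear[OF A] and M = banach_operator_csubspace[OF A]
  show image: "A ` core M A = core M A"
  proof (intro equalityI subsetI)
    fix y assume "y \<in> A ` core M A"
    then obtain x where x: "x \<in> core M A" "y = A x" by blast
    have "y \<in> (A ^^ n) ` M" for n
    proof -
      have "x \<in> (A ^^ n) ` M" using x(1) by (simp add: core_def)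
      then have "y \<in> (A ^^ Suc n) ` M" using x(2) by auto
      then show ?thesis using power_range_antimono[OF A, of n "Suc n"] by auto
    qed
    then show "y \<in> core M A" by (simp add: core_def)
  next
    fix y assume y: "y \<in> core M A"
    then have "y \<in> (A ^^ 1) ` M" unfolding core_def by blast
    then obtain x where x: "x \<in> M" "y = A x" by auto
    have "x \<in> (A ^^ n) ` M" for n
    proof -
      \<comment> \<open>two preimages of \<open>y\<close> differ by an element of the kernel, which lies in every range\<close>
      have "y \<in> (A ^^ Suc n) ` M" using y unfolding core_def by blast
      then obtain z where z: "z \<in> M" "y = A ((A ^^ n) z)" by auto
      have zn: "(A ^^ n) z \<in> M" "(A ^^ n) z \<in> (A ^^ n) ` M" using power_in[OF A z(1)] z(1) by auto
      have "x - (A ^^ n) z \<in> kernel M A"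
        using x z(2) zn(1) clinear_on_diff[OF lin M] complex_vector.subspace_diff[OF M]
        by (simp add: kernel_def)
      then have "x - (A ^^ n) z \<in> (A ^^ n) ` M" using reg by (auto simp: semi_regular_def)
      then have "x - (A ^^ n) z + (A ^^ n) z \<in> (A ^^ n) ` M"
        using zn(2) by (rule complex_vector.subspace_add[OF banach_operator_range[OF banach_operator_power[OF A]]])
      then show ?thesis by simp
    qed
    then show "y \<in> A ` core M A" using x by (auto simp: core_def)
  qed
  show "banach_operator (core M A) A"
    by (rule banach_operator_restrict[OF A R cl sub]) (simp add: image)
qed

lemma power_surjective: "B ` R = R \<Longrightarrow> (B ^^ p) ` R = (R :: 'a set)"
  by (induction p) (simp, metis funpow.simps(2) image_comp)

lemma surjective_noninjective_ascent:
  assumes "B ` R = R" "R \<subseteq> M" and u: "u \<in> kernel R B" "u \<noteq> 0"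
  shows "ascent M B = \<infinity>"
proof (rule ccontr)
  assume "ascent M B \<noteq> \<infinity>"
  then obtain p where p: "kernel M (B ^^ p) = kernel M (B ^^ Suc p)"
    using ascent_finite_iff[of M B] by auto
  have "u \<in> (B ^^ p) ` R" using power_surjective[OF assms(1)] u(1) by (simp add: kernel_def)
  then obtain v where v: "v \<in> R" "u = (B ^^ p) v" by blast
  have "v \<in> kernel M (B ^^ Suc p)" using v u(1) assms(2) by (auto simp: kernel_def)
  then have "v \<in> kernel M (B ^^ p)" using p by simp
  then show False using v(2) u(2) by (simp add: kernel_def)
qed

text \<open>
  On the core, \<open>A\<close> is onto with a nontrivial kernel. Both properties persist under small shifts,
  and an operator that is onto and not injective has strictly growing kernels of powers.
\<close>

lemma semi_regular_noninjective_ascent: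
  assumes A: "banach_operator M A" and reg: "semi_regular M A" and ker: "kernel M A \<noteq> {0}"
  obtains e where "e > 0" "\<And>l. cmod l < e \<Longrightarrow> ascent M (shift A l) = \<infinity>"
proof -
  let ?R = "core M A"
  note R = core_subset[OF A reg] core_image[OF A reg] kernel_subset_core[OF A reg] core_operator[OF A reg]
  obtain x0 where x0: "x0 \<in> kernel M A" "x0 \<noteq> 0"
    using ker complex_vector.subspace_0[OF banach_operator_kernel[OF A]] by auto
  then have x0R: "x0 \<in> ?R" "A x0 = 0" using R(3) by (auto simp: kernel_def)
  obtain C e where C: "C > 0" "e > 0"
      "\<And>l y. cmod l < e \<Longrightarrow> y \<in> ?R \<Longrightarrow> \<exists>x\<in>?R. shift A l x = y \<and> norm x \<le> C * norm y"
    using shift_surjective_bound[OF R(4,2)] by blast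
  show thesis
  proof (rule that[of "min e (1 / C)"])
    show "min e (1 / C) > 0" using C by simp
    fix l assume l: "cmod l < min e (1 / C)"
    let ?B = "shift A l"
    note B = banach_operator_shift[OF R(4), of l]
    note RR = banach_operator_csubspace[OF R(4)]
    have BR: "?B ` ?R = ?R"
    proof
      show "?R \<subseteq> ?B ` ?R"
      proof
        fix y assume "y \<in> ?R"
        then obtain x where "x \<in> ?R" "?B x = y" using C(3)[of l y] l by auto
        then show "y \<in> ?B ` ?R" by blast
      qed
    qed (rule banach_operator_maps[OF B])
    \<comment> \<open>correct \<open>x0\<close> by a small \<open>z\<close> to get an element of the kernel of the shifted operator\<close>
    have Bx0: "?B x0 \<in> ?R" "?B x0 = - (l *\<^sub>C x0)"
      using imageI[OF x0R(1), of ?B] x0R(2) unfolding BR by (simp_all add: shift_def)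
    then obtain z where z: "z \<in> ?R" "?B z = ?B x0" "norm z \<le> C * norm (?B x0)"
      using C(3)[of l "?B x0"] l by auto
    have "norm z \<le> C * cmod l * norm x0" using z(3) Bx0(2) by (simp add: norm_scaleC mult.assoc)
    also have "\<dots> < 1 * norm x0"
      using l C(1) x0(2) by (intro mult_strict_right_mono) (auto simp: field_simps)
    finally have "x0 - z \<noteq> 0" by auto
    moreover have "x0 - z \<in> kernel ?R ?B"
      using z x0R complex_vector.subspace_diff[OF RR]
      by (simp add: kernel_def clinear_on_diff[OF banach_operator_clinear[OF B] RR])
    ultimately show "ascent M ?B = \<infinity>" using surjective_noninjective_ascent[OF BR R(1)] by blast
  qed
qed

text \<open>
  From \<open>A x - l x = w\<close> with \<open>l \<noteq> 0\<close>, the vector \<open>x\<close> is a combination of \<open>A x\<close> and \<open>w\<close>, so it lies one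
  range deeper than known before. In particular these generalized eigenvectors lie in the core.
\<close>

lemma shift_kernel_power_subset_range:
  assumes A: "banach_operator M A" and l: "l \<noteq> 0" and x: "x \<in> kernel M (shift A l ^^ q)"
  shows "x \<in> (A ^^ n) ` M"
  using x
proof (induction q arbitrary: x n)
  case 0
  then show ?case using complex_vector.subspace_0[OF banach_operator_range[OF banach_operator_power[OF A]]]
    by (simp add: kernel_def)
next
  case (Suc q)
  let ?w = "shift A l x"
  have xM: "x \<in> M" using Suc.prems by (simp add: kernel_def)
  have wM: "?w \<in> M" using banach_operator_maps[OF banach_operator_shift[OF A]] xM by blast
  have "(shift A l ^^ q) ?w = 0" using Suc.prems by (simp add: kernel_def funpow_swap1)
  then have w: "?w \<in> (A ^^ n) ` M" for n using Suc.IH wM by (simp add: kernel_def)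
  show ?case
  proof (induction n)
    case 0
    then show ?case using xM by simp
  next
    case (Suc n)
    have "A x \<in> (A ^^ Suc n) ` M" using Suc by auto
    then have "inverse l *\<^sub>C (A x - ?w) \<in> (A ^^ Suc n) ` M"
      by (intro complex_vector.subspace_scale complex_vector.subspace_diff w
          banach_operator_range[OF banach_operator_power[OF A]])
    moreover have "inverse l *\<^sub>C (A x - ?w) = x" using l by (simp add: shift_def scaleC_scaleC scaleC_one)
    ultimately show ?case by simp
  qed
qed

text \<open>
  Modulo the core \<open>R\<close>, \<open>A\<close> is bounded below, since it maps \<open>R\<close> onto itself and its kernel lies in
  \<open>R\<close>; hence so is \<open>A - l\<close> for small \<open>l\<close>. If \<open>A - l\<close> is onto, write \<open>y = (A - l) x\<close>: up to the range of
  \<open>A\<close> this is \<open>- l x\<close>, with \<open>x\<close> controlled modulo \<open>R\<close> by \<open>y\<close>. Iterating this, the distance of \<open>y\<close> from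
  the range of \<open>A\<close> is at most \<open>(1 / 2) ^ n\<close> times its distance from \<open>R\<close>, for every \<open>n\<close>, so it is zero.
\<close>

lemma semi_regular_surjective_of_shift:
  assumes A: "banach_operator M A" and reg: "semi_regular M A"
  obtains e where "e > 0" "\<And>l. cmod l < e \<Longrightarrow> shift A l ` M = M \<Longrightarrow> A ` M = M"
proof -
  let ?R = "core M A"
  note R = core_subset[OF A reg] core_image[OF A reg] kernel_subset_core[OF A reg]
    banach_operator_csubspace[OF core_operator[OF A reg]]
  note M = banach_operator_csubspace[OF A] and lin = banach_operator_clinear[OF A]
  have "closed ((A ^^ 1) ` M)" using reg unfolding semi_regular_def by blast
  then have clR: "closed (A ` M)" by simp
  note AM = banach_operator_range[OF A]
  obtain C where C: "C > 0" "\<And>y. y \<in> A ` M \<Longrightarrow> \<exists>x\<in>M. A x = y \<and> norm x \<le> C * norm y"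
    using banach_operator_open[OF A clR] by blast
  have R0: "?R \<noteq> {}" using complex_vector.subspace_0[OF R(4)] by blast
  have below: "infdist x ?R \<le> C * infdist (A x) ?R" if x: "x \<in> M" for x
  proof -
    have "infdist x ?R / C \<le> dist (A x) r" if r: "r \<in> ?R" for r
    proof -
      obtain r' where r': "r' \<in> ?R" "r = A r'" using r R(2) by blast
      have xr: "x - r' \<in> M" "r' \<in> M" using x r'(1) R(1) complex_vector.subspace_diff[OF M] by auto
      have Ax: "A (x - r') = A x - r" using x xr r'(2) clinear_on_diff[OF lin M] by simp
      then obtain z where z: "z \<in> M" "A z = A x - r" "norm z \<le> C * norm (A x - r)"
        using C(2)[OF imageI[OF xr(1)]] by auto
      have "x - r' - z \<in> kernel M A"
        using z xr Ax complex_vector.subspace_diff[OF M] by (simp add: kernel_def clinear_on_diff[OF lin M])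
      then have "(x - r' - z) + r' \<in> ?R" using R(3) r'(1) by (intro complex_vector.subspace_add[OF R(4)]) auto
      then have "infdist x ?R \<le> norm (x - (x - r' - z + r'))" by (rule infdist_subspace_le)
      also have "\<dots> \<le> C * dist (A x) r" using z(3) by (simp add: dist_norm)
      finally show ?thesis using C(1) by (simp add: field_simps)
    qed
    then have "infdist x ?R / C \<le> infdist (A x) ?R" by (rule infdist_greatest[OF R0])
    then show ?thesis using C(1) by (simp add: field_simps)
  qed
  show thesis
  proof (rule that[of "1 / (4 * C)"])
    show "1 / (4 * C) > 0" using C(1) by simp
    fix l assume l: "cmod l < 1 / (4 * C)" and surj: "shift A l ` M = M"
    have lC: "cmod l * C \<le> 1 / 4" using l C(1) by (simp add: field_simps)
    have below': "infdist x ?R \<le> 2 * C * infdist (shift A l x) ?R" if x: "x \<in> M" for x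
    proof -
      have "A x = shift A l x + l *\<^sub>C x" by (simp add: shift_def)
      then have "infdist (A x) ?R \<le> infdist (shift A l x) ?R + cmod l * infdist x ?R"
        using infdist_subspace_add[OF R(4), of "shift A l x" "l *\<^sub>C x"] infdist_subspace_scale[OF R(4)] by simp
      then have "infdist x ?R \<le> C * (infdist (shift A l x) ?R + cmod l * infdist x ?R)"
        using below[OF x] C(1) by (meson less_imp_le mult_left_mono order_trans)
      also have "\<dots> = C * infdist (shift A l x) ?R + (cmod l * C) * infdist x ?R" by (simp add: algebra_simps)
      also have "\<dots> \<le> C * infdist (shift A l x) ?R + 1 / 4 * infdist x ?R"
        using lC by (intro add_left_mono mult_right_mono infdist_nonneg)
      finally have "3 / 4 * infdist x ?R \<le> C * infdist (shift A l x) ?R" by simp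
      moreover have "0 \<le> C * infdist (shift A l x) ?R"
        by (intro mult_nonneg_nonneg infdist_nonneg) (use C(1) in simp)
      ultimately show ?thesis by (simp add: mult.assoc)
    qed
    have decay: "infdist y (A ` M) \<le> (1 / 2) ^ n * infdist y ?R" if "y \<in> M" for y n
      using that
    proof (induction n arbitrary: y)
      case 0
      have "?R \<subseteq> A ` M" using R(1,2) by blast
      then show ?case using infdist_mono[OF _ R0] by simp
    next
      case (Suc n)
      then obtain x where x: "x \<in> M" "y = shift A l x" using surj by blast
      have "y = A x + (- l) *\<^sub>C x" using x(2) by (simp add: shift_def complex_vector.scale_minus_left)
      then have "infdist y (A ` M) \<le> infdist (A x) (A ` M) + cmod l * infdist x (A ` M)"
        using infdist_subspace_add[OF AM, of "A x" "(- l) *\<^sub>C x"] infdist_subspace_scale[OF AM, of "- l" x] by simp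
      also have "infdist (A x) (A ` M) = 0" using x(1) by (simp add: infdist_zero)
      also have "0 + cmod l * infdist x (A ` M) \<le> cmod l * ((1 / 2) ^ n * infdist x ?R)"
        using Suc.IH[OF x(1)] by (simp add: mult_left_mono)
      also have "\<dots> \<le> cmod l * ((1 / 2) ^ n * (2 * C * infdist y ?R))"
        using below'[OF x(1)] x(2) by (intro mult_left_mono) auto
      also have "\<dots> = (cmod l * C) * (2 * ((1 / 2) ^ n * infdist y ?R))" by (simp add: algebra_simps)
      also have "\<dots> \<le> 1 / 4 * (2 * ((1 / 2) ^ n * infdist y ?R))"
        using lC by (intro mult_right_mono mult_nonneg_nonneg infdist_nonneg) auto
      finally show ?case by (simp add: mult.commute)
    qed
    have "y \<in> A ` M" if y: "y \<in> M" for y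
    proof -
      have "(\<lambda>n. (1 / 2) ^ n * infdist y ?R) \<longlonglongrightarrow> 0"
        by (intro tendsto_mult_left_zero LIMSEQ_power_zero) simp
      then have "infdist y (A ` M) \<le> 0"
        using decay[OF y] by (intro tendsto_lowerbound[OF _ _ sequentially_bot]) auto
      then have "infdist y (A ` M) = 0" using infdist_nonneg[of y "A ` M"] by linarith
      then show ?thesis using infdist_closed_subspace_eq_0_iff[OF AM clR] by simp
    qed
    then show "A ` M = M" using banach_operator_maps[OF A] by blast
  qed
qed

text \<open>
  If the descent of \<open>B = A - l\<close> is finite, the space is the sum of the range of \<open>B\<close> and the kernel of
  a power of \<open>B\<close>. That kernel lies in the core, which \<open>B\<close> maps onto itself, so \<open>B\<close> is onto.
\<close>

lemma semi_regular_nonsurjective_descent: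
  assumes A: "banach_operator M A" and reg: "semi_regular M A" and nsurj: "A ` M \<noteq> M"
  obtains e where "e > 0" "\<And>l. cmod l < e \<Longrightarrow> l \<noteq> 0 \<Longrightarrow> descent M (shift A l) = \<infinity>"
proof -
  let ?R = "core M A"
  note R = core_subset[OF A reg] core_image[OF A reg] core_operator[OF A reg]
  obtain e1 where e1: "e1 > 0" "\<And>l. cmod l < e1 \<Longrightarrow> shift A l ` M = M \<Longrightarrow> A ` M = M"
    using semi_regular_surjective_of_shift[OF A reg] by blast
  obtain e2 where e2: "e2 > 0" "\<And>l. cmod l < e2 \<Longrightarrow> shift A l ` ?R = ?R"
    using surjective_shift[OF R(3,2)] by blast
  show thesis
  proof (rule that[of "min e1 e2"])
    show "min e1 e2 > 0" using e1 e2 by simp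
    fix l assume l: "cmod l < min e1 e2" "l \<noteq> 0"
    let ?B = "shift A l"
    note B = banach_operator_shift[OF A, of l] and M = banach_operator_csubspace[OF A]
    show "descent M ?B = \<infinity>"
    proof (rule ccontr)
      assume "descent M ?B \<noteq> \<infinity>"
      then obtain q where q: "(?B ^^ q) ` M = (?B ^^ Suc q) ` M" using descent_finite_iff[of M ?B] by auto
      have "x \<in> ?B ` M" if x: "x \<in> M" for x
      proof -
        have "(?B ^^ q) x \<in> (?B ^^ Suc q) ` M" using q x by blast
        then obtain y where y: "y \<in> M" "(?B ^^ q) x = (?B ^^ q) (?B y)" by (auto simp: funpow_swap1)
        have By: "?B y \<in> M" using banach_operator_maps[OF B] y(1) by blast
        have "x - ?B y \<in> kernel M (?B ^^ q)"
          using x y By complex_vector.subspace_diff[OF M]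
          by (simp add: kernel_def clinear_on_diff[OF banach_operator_clinear[OF banach_operator_power[OF B]] M])
        then have "x - ?B y \<in> ?R"
          using shift_kernel_power_subset_range[OF A l(2)] by (auto simp: core_def)
        then have "x - ?B y \<in> ?B ` M" using e2(2)[of l] l(1) R(1) by auto
        then have "x - ?B y + ?B y \<in> ?B ` M"
          by (rule complex_vector.subspace_add[OF banach_operator_range[OF B] _ imageI[OF y(1)]])
        then show ?thesis by simp
      qed
      then have "?B ` M = M" using banach_operator_maps[OF B] by blast
      then show False using e1(2)[of l] l(1) nsurj by simp
    qed
  qed
qed

lemma shift_invariant:
  assumes "csubspace M1" "S ` M1 \<subseteq> M1"
  shows "shift S l ` M1 \<subseteq> M1"
  using assms complex_vector.subspace_diff[OF assms(1)] complex_vector.subspace_scale[OF assms(1)]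
  by (auto simp: shift_def)

text \<open>
  The semi-regular part of the Kato decomposition has closed range; it is bounded below if it is
  injective, and otherwise all small shifts have infinite ascent.
\<close>

theorem upper_semi_Fredholm_dichotomy:
  assumes S: "banach_operator M S" and F: "upper_semi_Fredholm M S"
  shows "(\<exists>M1 M0. nilpotent_splitting M S M1 M0 \<and> bounded_below M1 S)
    \<or> (\<exists>e>0. \<forall>l. cmod l < e \<longrightarrow> ascent M (shift S l) = \<infinity>)"
proof -
  have F': "ccdim (kernel M S) < \<infinity>" "closed (S ` M)" using F by (auto simp: upper_semi_Fredholm_def)
  obtain M1 M0 where sp: "nilpotent_splitting M S M1 M0" and reg: "semi_regular M1 S"
    using Kato_decomposition[OF S closed_power_ranges_upper[OF S F']] F'(1) by blast
  have M1: "csubspace M1" "closed M1" "S ` M1 \<subseteq> M1" "csubspace M0" "direct_sum M M1 M0"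
    using sp by (simp_all add: nilpotent_splitting_def)
  have M1M: "M1 \<subseteq> M" using direct_sum_supsets(1)[OF M1(5,1,4)] .
  have S1: "banach_operator M1 S" by (rule banach_operator_restrict[OF S M1(1,2) M1M M1(3)])
  show ?thesis
  proof (cases "kernel M1 S = {0}")
    case True
    have "closed ((S ^^ 1) ` M1)" using reg unfolding semi_regular_def by blast
    then have "closed (S ` M1)" by simp
    with True have "bounded_below M1 S" using injective_closed_range_iff_bounded_below[OF S1] by simp
    then show ?thesis using sp by blast
  next
    case False
    then obtain e where e: "e > 0" "\<And>l. cmod l < e \<Longrightarrow> ascent M1 (shift S l) = \<infinity>"
      using semi_regular_noninjective_ascent[OF S1 reg] by blast
    have "ascent M (shift S l) = \<infinity>" if "cmod l < e" for l
    proof (rule ccontr)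
      assume "ascent M (shift S l) \<noteq> \<infinity>"
      then obtain p where "kernel M (shift S l ^^ p) = kernel M (shift S l ^^ Suc p)"
        using ascent_finite_iff[of M "shift S l"] by auto
      moreover have "kernel M1 T = kernel M T \<inter> M1" for T using M1M by (auto simp: kernel_def)
      ultimately have "ascent M1 (shift S l) < \<infinity>" unfolding ascent_finite_iff by auto
      then show False using e(2)[OF that] by simp
    qed
    then show ?thesis using e(1) by blast
  qed
qed

text \<open>
  The shift by zero is excluded, because the kernels of the powers of the semi-regular part are
  only compared with the core for nonzero shifts.
\<close>

theorem lower_semi_Fredholm_dichotomy:
  assumes S: "banach_operator M S" and F: "lower_semi_Fredholm M S"
  shows "(\<exists>M1 M0. nilpotent_splitting M S M1 M0 \<and> S ` M1 = M1)
    \<or> (\<exists>e>0. \<forall>l. cmod l < e \<longrightarrow> l \<noteq> 0 \<longrightarrow> descent M (shift S l) = \<infinity>)"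
proof -
  have F': "ccodim M (S ` M) < \<infinity>" using F by (auto simp: lower_semi_Fredholm_def)
  obtain M1 M0 where sp: "nilpotent_splitting M S M1 M0" and reg: "semi_regular M1 S"
    using Kato_decomposition[OF S closed_power_ranges_lower[OF S F']] F' by blast
  have M1: "csubspace M1" "closed M1" "S ` M1 \<subseteq> M1" "csubspace M0" "S ` M0 \<subseteq> M0" "direct_sum M M1 M0"
    using sp by (simp_all add: nilpotent_splitting_def)
  have M1M: "M1 \<subseteq> M" using direct_sum_supsets(1)[OF M1(6,1,4)] .
  have S1: "banach_operator M1 S" by (rule banach_operator_restrict[OF S M1(1,2) M1M M1(3)])
  show ?thesis
  proof (cases "S ` M1 = M1")
    case True
    then show ?thesis using sp by blast
  next
    case False
    then obtain e where e: "e > 0" "\<And>l. cmod l < e \<Longrightarrow> l \<noteq> 0 \<Longrightarrow> descent M1 (shift S l) = \<infinity>"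
      using semi_regular_nonsurjective_descent[OF S1 reg] by blast
    have "descent M (shift S l) = \<infinity>" if l: "cmod l < e" "l \<noteq> 0" for l
    proof (rule ccontr)
      let ?B = "shift S l"
      assume "descent M ?B \<noteq> \<infinity>"
      then obtain q where q: "(?B ^^ q) ` M = (?B ^^ Suc q) ` M"
        using descent_finite_iff[of M ?B] by auto
      have part: "(?B ^^ n) ` M1 = (?B ^^ n) ` M \<inter> M1" for n
        by (rule range_invariant_part[OF M1(6,1,4)
              banach_operator_clinear[OF banach_operator_power[OF banach_operator_shift[OF S]]]
              power_invariant[OF shift_invariant[OF M1(1,3)]]
              power_invariant[OF shift_invariant[OF M1(4,5)]]])
      have "(?B ^^ q) ` M1 = (?B ^^ Suc q) ` M1" by (simp only: part q)
      then have "descent M1 ?B < \<infinity>" unfolding descent_finite_iff by blast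
      then show False using e(2)[OF l] by simp
    qed
    then show ?thesis using e(1) by blast
  qed
qed

section \<open>Stability of the index\<close>

lemma independent_subset_of_card:
  assumes V: "csubspace V" and k: "enat k \<le> ccdim V"
  obtains B where "finite B" "B \<subseteq> V" "card B = k" "\<not> cdependent B" "ccdim V = enat k \<longrightarrow> cspan B = V"
proof -
  obtain B' where B': "B' \<subseteq> V" "\<not> cdependent B'" "cspan B' = V" by (rule obtain_basis[OF V])
  have dim: "ccdim V = (if finite B' then enat (card B') else \<infinity>)"
    using ccdim_span_independent[OF B'(2)] B'(3) by simp
  obtain B where B: "B \<subseteq> B'" "finite B" "card B = k"
  proof (cases "finite B'")
    case True
    then show ?thesis using dim k obtain_subset_with_card_n[of k B'] that by auto
  next
    case False
    then show ?thesis using infinite_arbitrarily_large[of B' k] that by auto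
  qed
  have "cspan B = V" if "ccdim V = enat k"
  proof -
    have "finite B'" "card B' = k" using dim that by (auto split: if_splits)
    then have "B = B'" using B by (simp add: card_subset_eq)
    then show ?thesis using B'(3) by simp
  qed
  moreover have "\<not> cdependent B" using complex_vector.independent_mono[OF B'(2) B(1)] .
  ultimately show thesis using that[of B] B B'(1) by blast
qed

lemma biorthogonal_functionals:
  fixes B :: "'a::complex_normed_vector set"
  assumes B: "finite B" "\<not> cdependent B"
  obtains f where "\<And>b. b \<in> B \<Longrightarrow> f b \<in> cdual"
    "\<And>b c. b \<in> B \<Longrightarrow> c \<in> B \<Longrightarrow> blinfun_apply (f b) c = (if c = b then 1 else 0)"
proof -
  have "\<exists>g. g \<in> cdual \<and> (\<forall>c\<in>B. blinfun_apply g c = (if c = b then 1 else 0))" if b: "b \<in> B" for b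
  proof -
    let ?L = "cspan (B - {b})"
    have L: "csubspace ?L" by (rule complex_vector.subspace_span)
    have "ccdim ?L < \<infinity>" unfolding ccdim_less_infinity_iff using B(1) by blast
    then have "closed ?L" by (rule closed_finite_dim[OF L])
    moreover have "b \<notin> ?L" using B(2) b unfolding complex_vector.dependent_def by blast
    ultimately obtain g where "g \<in> cdual" "blinfun_apply g b = 1" "\<And>y. y \<in> ?L \<Longrightarrow> blinfun_apply g y = 0"
      using separating_functional[OF L] by blast
    moreover have "c \<in> ?L" if "c \<in> B" "c \<noteq> b" for c
      using that by (intro complex_vector.span_base) auto
    ultimately show ?thesis by (intro exI[of _ g]) auto
  qed
  then obtain f where "\<And>b. b \<in> B \<Longrightarrow> f b \<in> cdual \<and> (\<forall>c\<in>B. blinfun_apply (f b) c = (if c = b then 1 else 0))"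
    by metis
  then show thesis using that[of f] by blast
qed

text \<open>
  An operator with closed range and finite-dimensional kernel or cokernel becomes injective or onto,
  according to the sign of its index, by adding a map \<open>F\<close> of finite rank that sends as many independent
  kernel vectors as possible to independent vectors of a complement \<open>C\<close> of the range. Such an \<open>F\<close>
  vanishes on a closed subspace \<open>Y\<close> of finite codimension. The stability of the index is thereby reduced
  to the stability of being bounded below or onto.
\<close>

lemma finite_rank_correction:
  fixes S :: "'a::complex_normed_vector \<Rightarrow> 'a"
  assumes S: "banach_operator M S" and cl: "closed (S ` M)"
    and fin: "ccdim (kernel M S) < \<infinity> \<or> ccodim M (S ` M) < \<infinity>"
  obtains F Y where "banach_operator M F" "csubspace Y" "closed Y" "Y \<subseteq> M" "ccodim M Y < \<infinity>"
    "\<And>y. y \<in> Y \<Longrightarrow> F y = 0"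
    "ccdim (kernel M S) \<le> ccodim M (S ` M) \<Longrightarrow> bounded_below M (\<lambda>x. S x + F x)"
    "ccodim M (S ` M) \<le> ccdim (kernel M S) \<Longrightarrow> (\<lambda>x. S x + F x) ` M = M"
proof -
  let ?N = "kernel M S" and ?R = "S ` M"
  note M = banach_operator_csubspace[OF S] and lin = banach_operator_clinear[OF S]
  note N = banach_operator_kernel[OF S] and R = banach_operator_range[OF S]
  obtain C where C: "csubspace C" "direct_sum M ?R C" "C \<subseteq> M" "ccodim M ?R = ccdim C"
    by (rule obtain_complement[OF R M banach_operator_maps[OF S]])
  have "min (ccdim ?N) (ccdim C) < \<infinity>" 
    using fin unfolding C(4) by (cases "ccdim ?N"; cases "ccdim C") auto
  then obtain k where k: "min (ccdim ?N) (ccdim C) = enat k" by auto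
  have kle: "enat k \<le> ccdim ?N" "enat k \<le> ccdim C" unfolding k[symmetric] by simp_all
  obtain B0 where B0: "finite B0" "B0 \<subseteq> ?N" "card B0 = k" "\<not> cdependent B0" "ccdim ?N = enat k \<longrightarrow> cspan B0 = ?N"
    by (rule independent_subset_of_card[OF N kle(1)])
  obtain B1 where B1: "finite B1" "B1 \<subseteq> C" "card B1 = k" "\<not> cdependent B1" "ccdim C = enat k \<longrightarrow> cspan B1 = C"
    by (rule independent_subset_of_card[OF C(1) kle(2)])
  obtain g where g: "bij_betw g B0 B1" using finite_same_card_bij[OF B0(1) B1(1)] B0(3) B1(3) by auto
  have gB: "B1 = g ` B0" "inj_on g B0" using g by (auto simp: bij_betw_def)
  obtain f where f: "\<And>b. b \<in> B0 \<Longrightarrow> f b \<in> cdual"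
      "\<And>b c. b \<in> B0 \<Longrightarrow> c \<in> B0 \<Longrightarrow> blinfun_apply (f b) c = (if c = b then 1 else 0)"
    using biorthogonal_functionals[OF B0(1,4)] by blast
  have f_scale: "blinfun_apply (f b) (c *\<^sub>C y) = c * blinfun_apply (f b) y" if "b \<in> B0" for b c y
    using f(1)[OF that] by (simp add: cdual_def)
  define F where "F x = (\<Sum>b\<in>B0. blinfun_apply (f b) x *\<^sub>C g b)" for x
  define Y where "Y = {x \<in> M. \<forall>b\<in>B0. blinfun_apply (f b) x = 0}"
  have gC: "g b \<in> C" if "b \<in> B0" for b using that gB(1) B1(2) by blast
  have FC: "F x \<in> C" for x
    unfolding F_def by (intro complex_vector.subspace_sum[OF C(1)] complex_vector.subspace_scale[OF C(1)] gC)
  have Fspan: "F x \<in> cspan B1" for x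
    unfolding F_def gB(1)
    by (intro complex_vector.span_sum complex_vector.span_scale complex_vector.span_base imageI)
  have F_add: "F (x + y) = F x + F y" for x y
    by (simp add: F_def blinfun.add_right scaleC_add_left sum.distrib)
  have F_scale: "F (c *\<^sub>C x) = c *\<^sub>C F x" for c x
    unfolding F_def complex_vector.scale_sum_right
    by (intro sum.cong refl) (simp add: f_scale scaleC_scaleC)
  have F: "banach_operator M F"
  proof (rule banach_operatorI[OF M banach_operator_complete[OF S]])
    show "clinear_on M F" by (simp add: clinear_on_def F_add F_scale)
    show "F ` M \<subseteq> M" using FC C(3) by blast
    show "norm (F x) \<le> (\<Sum>b\<in>B0. norm (f b) * norm (g b)) * norm x" for x
    proof -
      have "norm (F x) \<le> (\<Sum>b\<in>B0. norm (blinfun_apply (f b) x *\<^sub>C g b))"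
        unfolding F_def by (rule norm_sum)
      also have "\<dots> \<le> (\<Sum>b\<in>B0. norm (f b) * norm (g b) * norm x)"
      proof (rule sum_mono)
        fix b
        have "cmod (blinfun_apply (f b) x) * norm (g b) \<le> (norm (f b) * norm x) * norm (g b)"
          by (intro mult_right_mono norm_blinfun) simp
        then show "norm (blinfun_apply (f b) x *\<^sub>C g b) \<le> norm (f b) * norm (g b) * norm x"
          by (simp add: norm_scaleC mult_ac)
      qed
      finally show ?thesis by (simp add: sum_distrib_right)
    qed
  qed
  have Y: "csubspace Y \<and> ccodim M Y \<le> enat (card B0)"
    unfolding Y_def by (rule ccodim_Int_functional_kernels_le[OF M B0(1)]) (intro clinear_on_cdual f(1))
  have clY: "closed Y"
  proof -
    have "Y = M \<inter> (\<Inter>b\<in>B0. {x. blinfun_apply (f b) x = 0})" by (auto simp: Y_def)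
    moreover have "closed \<dots>"
      by (intro closed_Int banach_operator_closed[OF S] closed_INT ballI closed_Collect_eq continuous_intros)
    ultimately show ?thesis by simp
  qed
  let ?B = "\<lambda>x. S x + F x"
  have B: "banach_operator M ?B" by (rule banach_operator_add[OF S F])
  have range: "?B ` M = subspace_sum ?R (cspan B1)"
  proof (intro equalityI subsetI)
    fix y assume "y \<in> ?B ` M"
    then show "y \<in> subspace_sum ?R (cspan B1)" using Fspan by (auto intro: subspace_sumI)
  next
    fix y assume "y \<in> subspace_sum ?R (cspan B1)"
    then obtain x c where xc: "x \<in> M" "c \<in> cspan (g ` B0)" "y = S x + c"
      unfolding gB(1) by (auto elim!: subspace_sumE)
    then obtain u where u: "c = (\<Sum>v\<in>g ` B0. u v *\<^sub>C v)"
      using complex_vector.span_finite[of "g ` B0"] B0(1) by auto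
    define z where "z = (\<Sum>b\<in>B0. (u (g b) - blinfun_apply (f b) x) *\<^sub>C b)"
    have zN: "z \<in> ?N"
      unfolding z_def using B0(2)
      by (intro complex_vector.subspace_sum[OF N] complex_vector.subspace_scale[OF N]) auto
    then have zM: "z \<in> M" "S z = 0" by (auto simp: kernel_def)
    have "blinfun_apply (f b) (x + z) = u (g b)" if b: "b \<in> B0" for b
    proof -
      have "blinfun_apply (f b) z = (\<Sum>b'\<in>B0. (u (g b') - blinfun_apply (f b') x) * blinfun_apply (f b) b')"
        unfolding z_def by (simp add: blinfun.sum_right f_scale[OF b])
      also have "\<dots> = (\<Sum>b'\<in>B0. if b' = b then u (g b) - blinfun_apply (f b) x else 0)"
        using f(2)[OF b] by (intro sum.cong refl) simp
      also have "\<dots> = u (g b) - blinfun_apply (f b) x" using b B0(1) by simp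
      finally show ?thesis by (simp add: blinfun.add_right)
    qed
    then have "F (x + z) = (\<Sum>b\<in>B0. u (g b) *\<^sub>C g b)" unfolding F_def by (intro sum.cong) auto
    also have "\<dots> = c" unfolding u by (simp add: sum.reindex[OF gB(2)])
    finally have "?B (x + z) = y" using xc zM by (simp add: clinear_on_add[OF lin])
    then show "y \<in> ?B ` M" using complex_vector.subspace_add[OF M xc(1) zM(1)] by blast
  qed
  show thesis
  proof (rule that[OF F conjunct1[OF Y] clY])
    show "Y \<subseteq> M" by (auto simp: Y_def)
    show "ccodim M Y < \<infinity>" using conjunct2[OF Y] by (rule le_less_trans) simp
    show "F y = 0" if "y \<in> Y" for y using that unfolding F_def Y_def by (intro sum.neutral) simp
  next
    assume "ccdim ?N \<le> ccodim M ?R"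
    then have spN: "cspan B0 = ?N" using B0(5) k C(4) by (simp add: min_def)
    have "x = 0" if x: "x \<in> kernel M ?B" for x
    proof -
      have xM: "x \<in> M" "S x + F x = 0" using x by (auto simp: kernel_def)
      then have "S x = 0" "F x = 0"
        using direct_sum_zero[OF C(2) R C(1) imageI[OF xM(1)] FC] by simp_all
      have "(\<Sum>v\<in>B1. blinfun_apply (f (inv_into B0 g v)) x *\<^sub>C v) = F x"
        unfolding gB(1) F_def sum.reindex[OF gB(2)] by (intro sum.cong refl) (simp add: gB(2))
      then have "blinfun_apply (f (inv_into B0 g v)) x = 0" if "v \<in> B1" for v
        using \<open>F x = 0\<close> complex_vector.independentD[OF B1(4,1) order_refl _ that] by simp
      then have fx: "blinfun_apply (f b) x = 0" if "b \<in> B0" for b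
        using that gB by (metis image_eqI inv_into_f_f)
      have "x \<in> cspan B0" using spN \<open>S x = 0\<close> xM by (simp add: kernel_def)
      then obtain u where u: "x = (\<Sum>b\<in>B0. u b *\<^sub>C b)"
        using complex_vector.span_finite[OF B0(1)] by auto
      have "u b = 0" if b: "b \<in> B0" for b
      proof -
        have "blinfun_apply (f b) x = (\<Sum>b'\<in>B0. u b' * blinfun_apply (f b) b')"
          unfolding u by (simp add: blinfun.sum_right f_scale[OF b])
        also have "\<dots> = (\<Sum>b'\<in>B0. if b' = b then u b else 0)"
          using f(2)[OF b] by (intro sum.cong refl) simp
        also have "\<dots> = u b" using b B0(1) by simp
        finally show ?thesis using fx[OF b] by simp
      qed
      then show "x = 0" unfolding u by (intro sum.neutral) simp
    qed
    then have "kernel M ?B \<subseteq> {0}" by blast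
    then have "kernel M ?B = {0}" using complex_vector.subspace_0[OF banach_operator_kernel[OF B]] by blast
    moreover have "closed (?B ` M)" unfolding range by (rule closed_sum_finite_span[OF R cl B1(1)])
    ultimately show "bounded_below M ?B" using injective_closed_range_iff_bounded_below[OF B] by simp
  next
    assume "ccodim M ?R \<le> ccdim ?N"
    then have "cspan B1 = C" using B1(5) k C(4) by (simp add: min_def split: if_splits)
    then show "?B ` M = M" unfolding range using C(2) by (simp add: direct_sum_iff)
  qed
qed

lemma enat_add_cancel_finite: "r < \<infinity> \<Longrightarrow> r + a = r + b \<Longrightarrow> a = (b::enat)"
  by (cases r; cases a; cases b) auto

lemma enat_add_le_cancel_finite: "r < \<infinity> \<Longrightarrow> r + a \<le> r + b \<Longrightarrow> a \<le> (b::enat)"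
  by (cases r; cases a; cases b) auto

text \<open>
  An operator \<open>G\<close> differs from \<open>B\<close> by one of finite rank if and only if the two agree on a subspace
  \<open>Y\<close> of finite codimension; this is the form in which finite-rank perturbations are used.
\<close>

context
  fixes B G :: "'a::complex_normed_vector \<Rightarrow> 'a" and M Y :: "'a set"
  assumes B: "banach_operator M B" and G: "banach_operator M G"
    and Y: "csubspace Y" "closed Y" "Y \<subseteq> M" "ccodim M Y < \<infinity>"
    and agree: "\<And>y. y \<in> Y \<Longrightarrow> G y = B y"
begin

lemma agree_image_kernel: "G ` Y = B ` Y" "kernel Y G = kernel Y B"
  using agree by (auto simp: kernel_def)

text \<open>
  On \<open>Y\<close>, where the operators agree, both are injective; comparing both with their restriction to
  \<open>Y\<close> shows that they have the same index, and that of \<open>B\<close> is at most zero.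
\<close>

lemma index_le_of_bounded_below:
  assumes "bounded_below M B"
  shows "upper_semi_Fredholm M G" "ccdim (kernel M G) \<le> ccodim M (G ` M)"
proof -
  note M = banach_operator_csubspace[OF B]
  note linG = banach_operator_clinear[OF G] and linB = banach_operator_clinear[OF B]
  have kB: "kernel M B = {0}" "closed (B ` M)"
    using assms injective_closed_range_iff_bounded_below[OF B] by simp_all
  have "kernel Y B \<subseteq> kernel M B" using Y(3) by (auto simp: kernel_def)
  moreover have "0 \<in> kernel Y B"
    by (rule complex_vector.subspace_0[OF csubspace_kernel[OF clinear_on_subset[OF linB Y(3)] Y(1)]])
  ultimately have kY: "kernel Y B = {0}" using kB(1) by blast
  have "ccodim M Y = ccodim (G ` M) (G ` Y) + ccdim (kernel M G)"
    using ccodim_image[OF linG M Y(1,3)] kY agree_image_kernel by simp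
  then have kG: "ccdim (kernel M G) < \<infinity>" using Y(4) by (auto simp: plus_eq_infty_iff_enat)
  have eqB: "ccodim M (B ` M) + ccodim M Y = ccodim M (B ` Y)"
    using index_on_subspace[OF linB M Y(1,3) banach_operator_maps[OF B]] kB(1) kY by simp
  have "ccodim M (G ` M) + ccodim M Y = ccodim M (B ` Y) + ccdim (kernel M G)"
    using index_on_subspace[OF linG M Y(1,3) banach_operator_maps[OF G]] kY agree_image_kernel by simp
  then have "ccodim M Y + ccodim M (G ` M) = ccodim M Y + (ccodim M (B ` M) + ccdim (kernel M G))"
    unfolding eqB[symmetric] by (simp add: ac_simps)
  then have "ccodim M (G ` M) = ccodim M (B ` M) + ccdim (kernel M G)"
    by (rule enat_add_cancel_finite[OF Y(4)])
  then show "ccdim (kernel M G) \<le> ccodim M (G ` M)" by simp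
  have "closed (G ` M)"
  proof -
    obtain D where D: "csubspace D" "direct_sum M Y D" "D \<subseteq> M" "ccodim M Y = ccdim D"
      by (rule obtain_complement[OF Y(1) M Y(3)])
    have "closed (B ` Y)"
      using closed_image_of_closed[OF B kB(2) Y(1-3)] kB(1) complex_vector.subspace_0[OF Y(1)] by simp
    moreover have "csubspace (G ` D)" "csubspace (G ` Y)"
      using csubspace_image[OF linG M] D Y by simp_all
    moreover have "ccdim (G ` D) < \<infinity>"
      using ccdim_image_le[OF clinear_on_subset[OF linG D(3)] D(1)] D(4) Y(4) by (metis le_less_trans)
    ultimately have "closed (subspace_sum (G ` Y) (G ` D))"
      using closed_sum_finite_dim agree_image_kernel(1) by metis
    moreover have "G ` M = subspace_sum (G ` Y) (G ` D)"
      using image_subspace_sum[OF linG Y(3) D(3)] D(2) by (simp add: direct_sum_iff)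
    ultimately show ?thesis by simp
  qed
  then show "upper_semi_Fredholm M G" using kG by (simp add: upper_semi_Fredholm_def)
qed

lemma index_ge_of_surjective:
  assumes "B ` M = M"
  shows "lower_semi_Fredholm M G" "ccodim M (G ` M) \<le> ccdim (kernel M G)"
proof -
  note M = banach_operator_csubspace[OF B]
  note linG = banach_operator_clinear[OF G] and linB = banach_operator_clinear[OF B]
  have c: "ccodim M (B ` Y) \<le> ccodim M Y" using ccodim_image_le[OF linB M Y(1,3)] assms by simp
  have "ccodim M (G ` Y) = ccodim M (G ` M) + ccodim (G ` M) (G ` Y)"
    by (rule ccodim_chain[OF csubspace_image[OF linG M Y(1,3)] banach_operator_range[OF G] M
          image_mono[OF Y(3)] banach_operator_maps[OF G]])
  then have "ccodim M (G ` M) \<le> ccodim M (B ` Y)" using agree_image_kernel(1) by simp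
  then show "lower_semi_Fredholm M G" unfolding lower_semi_Fredholm_def using c Y(4)
    by (meson le_less_trans order_trans)
  have "ccodim M (G ` M) + ccodim M Y + ccdim (kernel Y G) = ccodim M (B ` Y) + ccdim (kernel M G)"
    using index_on_subspace[OF linG M Y(1,3) banach_operator_maps[OF G]] agree_image_kernel(1) by simp
  also have "\<dots> \<le> ccodim M Y + ccdim (kernel M G)" using c by (rule add_right_mono)
  finally have "ccodim M Y + (ccodim M (G ` M) + ccdim (kernel Y G)) \<le> ccodim M Y + ccdim (kernel M G)"
    by (simp add: ac_simps)
  then have "ccodim M (G ` M) + ccdim (kernel Y G) \<le> ccdim (kernel M G)"
    by (rule enat_add_le_cancel_finite[OF Y(4)])
  then show "ccodim M (G ` M) \<le> ccdim (kernel M G)"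
    using order_trans[OF add_increasing2[OF _ order_refl]] by (metis zero_le)
qed

end

lemma upper_semi_Weyl_iff:
  "upper_semi_Weyl M S \<longleftrightarrow> upper_semi_Fredholm M S \<and> ccdim (kernel M S) \<le> ccodim M (S ` M)"
  unfolding upper_semi_Weyl_def ind_def upper_semi_Fredholm_def
  by (cases "ccdim (kernel M S)"; cases "ccodim M (S ` M)") auto

lemma lower_semi_Weyl_iff:
  "lower_semi_Weyl M S \<longleftrightarrow> lower_semi_Fredholm M S \<and> ccodim M (S ` M) \<le> ccdim (kernel M S)"
  unfolding lower_semi_Weyl_def ind_def lower_semi_Fredholm_def
  by (cases "ccdim (kernel M S)"; cases "ccodim M (S ` M)") auto

lemma Weyl_iff: "Weyl M S \<longleftrightarrow> upper_semi_Weyl M S \<and> lower_semi_Weyl M S"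
  unfolding Weyl_def Fredholm_def upper_semi_Weyl_def lower_semi_Weyl_def by auto

lemma upper_semi_Weyl_shift:
  assumes S: "banach_operator M S" and W: "upper_semi_Weyl M S"
  obtains e where "e > 0" "\<And>l. cmod l < e \<Longrightarrow> upper_semi_Weyl M (shift S l)"
proof -
  have W': "ccdim (kernel M S) < \<infinity>" "closed (S ` M)" "ccdim (kernel M S) \<le> ccodim M (S ` M)"
    using W by (auto simp: upper_semi_Weyl_iff upper_semi_Fredholm_def)
  obtain F Y where F: "banach_operator M F" and Y: "csubspace Y" "closed Y" "Y \<subseteq> M" "ccodim M Y < \<infinity>"
    and FY: "\<And>y. y \<in> Y \<Longrightarrow> F y = 0" and bb: "bounded_below M (\<lambda>x. S x + F x)"
    using finite_rank_correction[OF S W'(2)] W'(1,3) by metis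
  obtain e where e: "e > 0" "\<And>l. cmod l < e \<Longrightarrow> bounded_below M (shift (\<lambda>x. S x + F x) l)"
    using bounded_below_shift[OF bb] by blast
  have "upper_semi_Weyl M (shift S l)" if l: "cmod l < e" for l
    unfolding upper_semi_Weyl_iff
    using index_le_of_bounded_below[OF banach_operator_shift[OF banach_operator_add[OF S F]]
        banach_operator_shift[OF S] Y _ e(2)[OF l]] FY by (simp add: shift_def)
  then show thesis using that e(1) by blast
qed

lemma lower_semi_Weyl_shift:
  assumes S: "banach_operator M S" and W: "lower_semi_Weyl M S"
  obtains e where "e > 0" "\<And>l. cmod l < e \<Longrightarrow> lower_semi_Weyl M (shift S l)"
proof -
  have W': "ccodim M (S ` M) < \<infinity>" "ccodim M (S ` M) \<le> ccdim (kernel M S)"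
    using W by (auto simp: lower_semi_Weyl_iff lower_semi_Fredholm_def)
  obtain F Y where F: "banach_operator M F" and Y: "csubspace Y" "closed Y" "Y \<subseteq> M" "ccodim M Y < \<infinity>"
    and FY: "\<And>y. y \<in> Y \<Longrightarrow> F y = 0" and surj: "(\<lambda>x. S x + F x) ` M = M"
    using finite_rank_correction[OF S closed_range_of_finite_codim[OF S W'(1)]] W' by metis
  obtain e where e: "e > 0" "\<And>l. cmod l < e \<Longrightarrow> shift (\<lambda>x. S x + F x) l ` M = M"
    using surjective_shift[OF banach_operator_add[OF S F] surj] by blast
  have "lower_semi_Weyl M (shift S l)" if l: "cmod l < e" for l
    unfolding lower_semi_Weyl_iff
    using index_ge_of_surjective[OF banach_operator_shift[OF banach_operator_add[OF S F]]
        banach_operator_shift[OF S] Y _ e(2)[OF l]] FY by (simp add: shift_def)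
  then show thesis using that e(1) by blast
qed

lemma Weyl_shift:
  assumes S: "banach_operator M S" and W: "Weyl M S"
  obtains e where "e > 0" "\<And>l. cmod l < e \<Longrightarrow> Weyl M (shift S l)"
proof -
  obtain e1 where e1: "e1 > 0" "\<And>l. cmod l < e1 \<Longrightarrow> upper_semi_Weyl M (shift S l)"
    using upper_semi_Weyl_shift[OF S] W unfolding Weyl_iff by blast
  obtain e2 where e2: "e2 > 0" "\<And>l. cmod l < e2 \<Longrightarrow> lower_semi_Weyl M (shift S l)"
    using lower_semi_Weyl_shift[OF S] W unfolding Weyl_iff by blast
  show thesis using that[of "min e1 e2"] e1 e2 by (simp add: Weyl_iff)
qed

section \<open>Browder operators and nilpotent splittings\<close>

text \<open>
  Kernel and cokernel of an operator on a finite-dimensional space have the same dimension.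
\<close>

lemma index_nilpotent_splitting:
  assumes S: "banach_operator M S" and sp: "nilpotent_splitting M S M1 M0"
  shows "\<exists>c<\<infinity>. ccdim (kernel M S) = ccdim (kernel M1 S) + c \<and>
    ccodim M (S ` M) = ccodim M1 (S ` M1) + c"
proof -
  have d: "csubspace M1" "closed M1" "S ` M1 \<subseteq> M1"
    "csubspace M0" "ccdim M0 < \<infinity>" "S ` M0 \<subseteq> M0" "direct_sum M M1 M0"
    using sp by (simp_all add: nilpotent_splitting_def)
  note lin = banach_operator_clinear[OF S]
  have "M0 \<subseteq> M" using direct_sum_supsets(2)[OF d(7,1,4)] .
  then have lin0: "clinear_on M0 S" by (rule clinear_on_subset[OF lin])
  have "ccdim (kernel M0 S) \<le> ccdim M0"
    by (rule ccdim_mono[OF csubspace_kernel[OF lin0 d(4)]]) (auto simp: kernel_def)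
  then have "ccdim (kernel M0 S) < \<infinity>" using d(5) by (rule le_less_trans)
  then show ?thesis
    using ccdim_kernel_invariant_sum[OF d(7,1,4) lin d(3,6)]
      ccodim_range_invariant_sum[OF d(7,1,4) lin d(3,6)]
      ccdim_kernel_eq_ccodim_range[OF lin0 d(4,5,6)] by (intro exI[of _ "ccdim (kernel M0 S)"]) simp
qed

lemma injective_power: "B ` R \<subseteq> R \<Longrightarrow> kernel R B \<subseteq> {0} \<Longrightarrow> x \<in> R \<Longrightarrow> (B ^^ n) x = 0 \<Longrightarrow> x = 0"
proof (induction n)
  case (Suc n)
  have "(B ^^ n) x \<in> R" using power_invariant[OF Suc.prems(1), of n] Suc.prems(3) by blast
  then have "(B ^^ n) x \<in> kernel R B" using Suc.prems(4) by (simp add: kernel_def)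
  then show ?case using Suc by blast
qed simp

context
  fixes S :: "'a::complex_normed_vector \<Rightarrow> 'a" and M M1 M0 :: "'a set"
  assumes S: "banach_operator M S" and sp: "nilpotent_splitting M S M1 M0"
begin

lemma splitting_facts:
  "csubspace M1" "closed M1" "S ` M1 \<subseteq> M1" "csubspace M0" "ccdim M0 < \<infinity>" "S ` M0 \<subseteq> M0"
  "direct_sum M M1 M0" "M1 \<subseteq> M" "M0 \<subseteq> M" "banach_operator M1 S" "banach_operator M0 S"
proof -
  show d: "csubspace M1" "closed M1" "S ` M1 \<subseteq> M1" "csubspace M0" "ccdim M0 < \<infinity>" "S ` M0 \<subseteq> M0"
    "direct_sum M M1 M0" using sp by (simp_all add: nilpotent_splitting_def)
  show M: "M1 \<subseteq> M" "M0 \<subseteq> M" using direct_sum_supsets[OF d(7,1,4)] by simp_all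
  show "banach_operator M1 S" by (rule banach_operator_restrict[OF S d(1,2) M(1) d(3)])
  show "banach_operator M0 S"
    by (rule banach_operator_restrict[OF S d(4) closed_finite_dim[OF d(4,5)] M(2) d(6)])
qed

lemma splitting_nilpotent:
  obtains p where "\<And>n z. n \<ge> p \<Longrightarrow> z \<in> M0 \<Longrightarrow> (S ^^ n) z = 0"
proof -
  obtain p where p: "\<forall>z\<in>M0. (S ^^ p) z = 0" using sp by (auto simp: nilpotent_splitting_def)
  have "(S ^^ n) z = 0" if "n \<ge> p" "z \<in> M0" for n z
  proof -
    have "(S ^^ n) z = (S ^^ (n - p)) ((S ^^ p) z)"
      using that(1) by (metis comp_apply funpow_add le_add_diff_inverse2)
    then show ?thesis using p that(2) power_zero[OF S] by simp
  qed
  then show thesis using that by blast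
qed

lemma splitting_ascent:
  assumes "bounded_below M1 S"
  shows "ascent M S < \<infinity>"
proof -
  note d = splitting_facts
  obtain p where p: "\<And>n z. n \<ge> p \<Longrightarrow> z \<in> M0 \<Longrightarrow> (S ^^ n) z = 0" by (rule splitting_nilpotent) blast
  have k1: "kernel M1 S \<subseteq> {0}"
    using injective_closed_range_iff_bounded_below[OF d(10)] assms by simp
  have "kernel M (S ^^ n) = M0" if n: "n \<ge> p" for n
  proof -
    have "direct_sum (kernel M (S ^^ n)) (kernel M1 (S ^^ n)) (kernel M0 (S ^^ n))"
      by (rule kernel_invariant_sum[OF d(7,1,4) banach_operator_clinear[OF banach_operator_power[OF S]]
            power_invariant[OF d(3)] power_invariant[OF d(6)]])
    moreover have "kernel M1 (S ^^ n) = {0}"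
      using injective_power[OF d(3) k1] complex_vector.subspace_0[OF d(1)] power_zero[OF S]
      by (auto simp: kernel_def)
    moreover have "kernel M0 (S ^^ n) = M0" using p[OF n] by (auto simp: kernel_def)
    ultimately show ?thesis by (simp add: direct_sum_iff subspace_sum_def)
  qed
  then have "kernel M (S ^^ p) = kernel M (S ^^ Suc p)" by (metis le_Suc_eq order_refl)
  then show ?thesis unfolding ascent_finite_iff by blast
qed

lemma splitting_descent_range:
  obtains p where "\<And>n. n \<ge> p \<Longrightarrow> (S ^^ n) ` M = (S ^^ n) ` M1"
proof -
  note d = splitting_facts
  obtain p where p: "\<And>n z. n \<ge> p \<Longrightarrow> z \<in> M0 \<Longrightarrow> (S ^^ n) z = 0" by (rule splitting_nilpotent) blast
  have "(S ^^ n) ` M = (S ^^ n) ` M1" if n: "n \<ge> p" for n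
  proof -
    have "direct_sum ((S ^^ n) ` M) ((S ^^ n) ` M1) ((S ^^ n) ` M0)"
      by (rule range_invariant_sum[OF d(7,1,4) banach_operator_clinear[OF banach_operator_power[OF S]]
            power_invariant[OF d(3)] power_invariant[OF d(6)]])
    moreover have "(S ^^ n) ` M0 = {0}"
      using p[OF n] complex_vector.subspace_0[OF d(4)] by (auto simp: image_iff)
    ultimately show ?thesis by (simp add: direct_sum_iff subspace_sum_def)
  qed
  then show thesis using that by blast
qed

lemma splitting_descent:
  assumes "S ` M1 = M1"
  shows "descent M S < \<infinity>"
proof -
  obtain p where p: "\<And>n. n \<ge> p \<Longrightarrow> (S ^^ n) ` M = (S ^^ n) ` M1" by (rule splitting_descent_range) blast
  then have "(S ^^ n) ` M = M1" if "n \<ge> p" for n using power_surjective[OF assms] that by metis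
  then have "(S ^^ p) ` M = (S ^^ Suc p) ` M" by (metis le_Suc_eq order_refl)
  then show ?thesis unfolding descent_finite_iff by blast
qed

text \<open>
  From some power on, the ranges on \<open>M\<close> are those on \<open>M1\<close>. If they are stationary, injectivity on
  \<open>M1\<close> allows the common power to be cancelled.
\<close>

lemma splitting_surjective_of_descent:
  assumes bb: "bounded_below M1 S" and "descent M S < \<infinity>"
  shows "S ` M1 = M1"
proof -
  note d = splitting_facts
  obtain p where p: "\<And>n. n \<ge> p \<Longrightarrow> (S ^^ n) ` M = (S ^^ n) ` M1" by (rule splitting_descent_range) blast
  obtain q where q: "(S ^^ q) ` M = (S ^^ Suc q) ` M" using assms(2) unfolding descent_finite_iff by blast
  have step: "(S ^^ n) ` M = (S ^^ Suc n) ` M" if "n \<ge> q" for n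
    using that
  proof (induction n rule: dec_induct)
    case (step n)
    have "(S ^^ Suc n) ` M = S ` ((S ^^ n) ` M)" by (simp add: image_comp)
    also have "\<dots> = S ` ((S ^^ Suc n) ` M)" by (simp only: step.IH)
    also have "\<dots> = (S ^^ Suc (Suc n)) ` M" by (simp add: image_comp)
    finally show ?case .
  qed (rule q)
  define n where "n = max p q"
  have eq: "(S ^^ n) ` M1 = (S ^^ Suc n) ` M1"
    using step[of n] p[of n] p[of "Suc n"] by (simp add: n_def del: funpow.simps)
  have k1: "kernel M1 S \<subseteq> {0}"
    using injective_closed_range_iff_bounded_below[OF d(10)] bb by simp
  have "x \<in> S ` M1" if x: "x \<in> M1" for x
  proof -
    have "(S ^^ n) x \<in> (S ^^ Suc n) ` M1" using eq x by blast
    then obtain y where y: "y \<in> M1" "(S ^^ n) x = (S ^^ n) (S y)" by (auto simp: funpow_swap1)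
    have Sy: "S y \<in> M1" using d(3) y(1) by blast
    have "x - S y \<in> M1" using x Sy by (rule complex_vector.subspace_diff[OF d(1)])
    moreover have "(S ^^ n) (x - S y) = 0"
      using y(2) clinear_on_diff[OF banach_operator_clinear[OF banach_operator_power[OF d(10)]] d(1) x Sy] by simp
    ultimately have "x - S y = 0" by (rule injective_power[OF d(3) k1])
    then show ?thesis using y(1) by auto
  qed
  then show ?thesis using d(3) by blast
qed

lemma splitting_surjective_of_index:
  assumes bb: "bounded_below M1 S" and W: "Weyl M S"
  shows "S ` M1 = M1"
proof -
  note d = splitting_facts
  obtain c where c: "c < \<infinity>" "ccdim (kernel M S) = ccdim (kernel M1 S) + c"
      "ccodim M (S ` M) = ccodim M1 (S ` M1) + c"
    using index_nilpotent_splitting[OF S sp] by blast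
  have "kernel M1 S = {0}"
    using injective_closed_range_iff_bounded_below[OF d(10)] bb by simp
  moreover have "ccdim (kernel M S) = ccodim M (S ` M)"
    using W unfolding Weyl_iff upper_semi_Weyl_iff lower_semi_Weyl_iff by (simp add: antisym)
  ultimately have "c + ccodim M1 (S ` M1) = c + 0" using c by (simp add: add.commute)
  then have "ccodim M1 (S ` M1) = 0" by (rule enat_add_cancel_finite[OF c(1)])
  then show ?thesis
    using ccodim_eq_0_iff[OF banach_operator_range[OF d(10)] d(1,3)] by simp
qed

end

lemma upper_semi_Browder_imp_splitting:
  assumes S: "banach_operator M S" and "upper_semi_Browder M S"
  obtains M1 M0 where "nilpotent_splitting M S M1 M0" "bounded_below M1 S"
proof -
  have "\<not> (\<exists>e>0. \<forall>l. cmod l < e \<longrightarrow> ascent M (shift S l) = \<infinity>)"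
  proof
    assume "\<exists>e>0. \<forall>l. cmod l < e \<longrightarrow> ascent M (shift S l) = \<infinity>"
    then have "ascent M (shift S 0) = \<infinity>" by auto
    moreover have "shift S 0 = S" by (simp add: shift_def)
    ultimately show False using assms(2) by (simp add: upper_semi_Browder_def)
  qed
  then show thesis
    using upper_semi_Fredholm_dichotomy[OF S] assms(2) that unfolding upper_semi_Browder_def by blast
qed

lemma upper_semi_Browder_imp_upper_semi_Weyl:
  assumes S: "banach_operator M S" and B: "upper_semi_Browder M S"
  shows "upper_semi_Weyl M S"
proof -
  obtain M1 M0 where sp: "nilpotent_splitting M S M1 M0" and bb: "bounded_below M1 S"
    using upper_semi_Browder_imp_splitting[OF assms] by blast
  have "kernel M1 S = {0}"
    using injective_closed_range_iff_bounded_below[OF splitting_facts(10)[OF S sp]] bb by simp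
  then have "ccdim (kernel M S) \<le> ccodim M (S ` M)" using index_nilpotent_splitting[OF S sp] by auto
  then show ?thesis using B by (simp add: upper_semi_Weyl_iff upper_semi_Browder_def)
qed

lemma Browder_imp_Weyl:
  assumes S: "banach_operator M S" and B: "Browder M S"
  shows "Weyl M S"
proof -
  have uB: "upper_semi_Browder M S" "descent M S < \<infinity>" "lower_semi_Fredholm M S"
    using B by (auto simp: Browder_def lower_semi_Browder_def)
  obtain M1 M0 where sp: "nilpotent_splitting M S M1 M0" and bb: "bounded_below M1 S"
    using upper_semi_Browder_imp_splitting[OF S uB(1)] by blast
  have S1: "banach_operator M1 S" using splitting_facts(10)[OF S sp] .
  have "kernel M1 S = {0}"
    using injective_closed_range_iff_bounded_below[OF S1] bb by simp
  moreover have "ccodim M1 (S ` M1) = 0"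
    using splitting_surjective_of_descent[OF S sp bb uB(2)]
      ccodim_eq_0_iff[OF banach_operator_csubspace[OF S1] banach_operator_csubspace[OF S1]] by simp
  ultimately have "ccdim (kernel M S) = ccodim M (S ` M)" using index_nilpotent_splitting[OF S sp] by auto
  then show ?thesis
    using uB by (simp add: Weyl_iff upper_semi_Weyl_iff lower_semi_Weyl_iff upper_semi_Browder_def)
qed

section \<open>Generalized Drazin decompositions\<close>

context
  fixes S :: "'a::complex_banach \<Rightarrow> 'a" and M N :: "'a set"
  assumes S: "banach_operator UNIV S" and Red: "(M, N) \<in> Red S" and qn: "quasi_nilpotent N S"
begin

lemma Red_facts:
  "csubspace M" "closed M" "S ` M \<subseteq> M" "csubspace N" "closed N" "S ` N \<subseteq> N" "direct_sum UNIV M N"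
  "banach_operator M S" "banach_operator N S"
proof -
  show d: "csubspace M" "closed M" "S ` M \<subseteq> M" "csubspace N" "closed N" "S ` N \<subseteq> N" "direct_sum UNIV M N"
    using Red by (simp_all add: Red_def)
  show "banach_operator M S" by (rule banach_operator_restrict[OF S d(1,2) subset_UNIV d(3)])
  show "banach_operator N S" by (rule banach_operator_restrict[OF S d(4,5) subset_UNIV d(6)])
qed

lemma quasi_nilpotent_part_bijective:
  assumes "l \<noteq> 0"
  shows "kernel N (shift S l) = {0}" "shift S l ` N = N"
proof -
  have "l \<notin> spectrum N S" using qn assms by (auto simp: quasi_nilpotent_def)
  then have "invertible_on N (shift S l)" by (simp add: spectrum_def)
  then show "kernel N (shift S l) = {0}" "shift S l ` N = N"
    using invertible_on_iff_bijective[OF banach_operator_shift[OF Red_facts(9)]] by simp_all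
qed

lemma shift_sum_facts:
  "shift S l ` M \<subseteq> M" "shift S l ` N \<subseteq> N" "clinear_on UNIV (shift S l)"
  using shift_invariant[OF Red_facts(1,3)] shift_invariant[OF Red_facts(4,6)]
    banach_operator_clinear[OF banach_operator_shift[OF S]] by simp_all

lemma kernel_shift_UNIV:
  assumes "l \<noteq> 0"
  shows "ccdim (kernel UNIV (shift S l)) = ccdim (kernel M (shift S l))"
  using ccdim_kernel_invariant_sum[OF Red_facts(7,1,4) shift_sum_facts(3,1,2)]
    quasi_nilpotent_part_bijective(1)[OF assms] by simp

lemma ccodim_shift_UNIV:
  assumes "l \<noteq> 0"
  shows "ccodim UNIV (shift S l ` UNIV) = ccodim M (shift S l ` M)"
  using ccodim_range_invariant_sum[OF Red_facts(7,1,4) shift_sum_facts(3,1,2)]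
    quasi_nilpotent_part_bijective(2)[OF assms] ccodim_eq_0_iff[OF Red_facts(4,4)] by simp

lemma upper_semi_Weyl_shift_UNIV:
  assumes l: "l \<noteq> 0" and W: "upper_semi_Weyl M (shift S l)"
  shows "upper_semi_Weyl UNIV (shift S l)"
proof -
  have R: "csubspace (shift S l ` M)"
    by (rule banach_operator_range[OF banach_operator_shift[OF Red_facts(8)]])
  have "closed (subspace_sum (shift S l ` M) N)"
    using W by (intro closed_direct_sum_part[OF complete_UNIV Red_facts(7,1,2,4,5) R _ shift_sum_facts(1)])
      (simp add: upper_semi_Weyl_iff upper_semi_Fredholm_def)
  moreover have "shift S l ` UNIV = subspace_sum (shift S l ` M) N"
    using range_invariant_sum[OF Red_facts(7,1,4) shift_sum_facts(3,1,2)]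
      quasi_nilpotent_part_bijective(2)[OF l] by (simp add: direct_sum_iff)
  ultimately show ?thesis
    using W kernel_shift_UNIV[OF l] ccodim_shift_UNIV[OF l]
    by (simp add: upper_semi_Weyl_iff upper_semi_Fredholm_def)
qed

lemma lower_semi_Weyl_shift_UNIV:
  assumes l: "l \<noteq> 0" and W: "lower_semi_Weyl M (shift S l)"
  shows "lower_semi_Weyl UNIV (shift S l)"
  using W kernel_shift_UNIV[OF l] ccodim_shift_UNIV[OF l]
  by (simp add: lower_semi_Weyl_iff lower_semi_Fredholm_def)

text \<open>
  A nonzero shift of the nilpotent part is injective, hence bijective in finite dimension, so the
  spectrum of the enlarged second summand is still contained in \<open>{0}\<close>.
\<close>

lemma Red_absorb_nilpotent_part:
  assumes sp: "nilpotent_splitting M S M1 M0"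
  shows "(M1, subspace_sum M0 N) \<in> Red S" "quasi_nilpotent (subspace_sum M0 N) S"
proof -
  note d = splitting_facts[OF Red_facts(8) sp] and r = Red_facts
  let ?N = "subspace_sum M0 N"
  note ds = direct_sum_assoc[OF r(7) d(7) d(1,4) r(4)]
  have N: "csubspace ?N" "closed ?N"
    using csubspace_sum[OF d(4) r(4)] closed_sum_finite_dim[OF r(4,5) d(4,5)]
    by (simp_all add: subspace_sum_commute)
  have inv: "S ` ?N \<subseteq> ?N"
  proof (intro image_subsetI)
    fix z assume "z \<in> ?N"
    then obtain a b where ab: "a \<in> M0" "b \<in> N" "z = a + b" by (rule subspace_sumE)
    have "S z = S a + S b" unfolding ab(3) using clinear_on_add[OF banach_operator_clinear[OF S]] by simp
    then show "S z \<in> ?N" using ab d(6) r(6) subspace_sumI[of "S a" M0 "S b" N] by auto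
  qed
  show "(M1, ?N) \<in> Red S" using ds(1) d(1-3) N inv by (simp add: Red_def)
  have SN: "banach_operator ?N S" by (rule banach_operator_restrict[OF S N subset_UNIV inv])
  have "invertible_on ?N (shift S l)" if l: "l \<noteq> 0" for l
  proof -
    let ?B = "shift S l"
    note B = banach_operator_shift[OF SN, of l]
    have B0: "banach_operator M0 ?B" by (rule banach_operator_shift[OF d(11)])
    have k0: "kernel M0 ?B = {0}"
    proof -
      have "z = 0" if "z \<in> kernel M0 ?B" for z
      proof -
        have z: "z \<in> M0" "S z = l *\<^sub>C z" using that by (auto simp: kernel_def shift_def)
        have "(S ^^ n) z = l ^ n *\<^sub>C z" for n
        proof (induction n)
          case (Suc n)
          then show ?case
            using z clinear_on_scale[OF banach_operator_clinear[OF d(11)] z(1)]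
            by (simp add: scaleC_scaleC mult.commute)
        qed (simp add: scaleC_one)
        moreover obtain p where "(S ^^ p) z = 0"
          using splitting_nilpotent[OF r(8) sp] z(1) by (metis order_refl)
        ultimately have "l ^ p *\<^sub>C z = 0" by metis
        then show "z = 0" using l complex_vector.scale_eq_0_iff by simp
      qed
      then have "kernel M0 ?B \<subseteq> {0}" by blast
      then show ?thesis using complex_vector.subspace_0[OF banach_operator_kernel[OF B0]] by blast
    qed
    have "ccodim M0 (?B ` M0) = 0"
      using ccdim_kernel_eq_ccodim_range[OF banach_operator_clinear[OF B0] d(4,5) banach_operator_maps[OF B0]]
        k0 by simp
    then have r0: "?B ` M0 = M0"
      using ccodim_eq_0_iff[OF banach_operator_range[OF B0] d(4) banach_operator_maps[OF B0]] by simp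
    note inv = banach_operator_maps[OF B0] shift_sum_facts(2)[of l]
    have "kernel ?N ?B = {0}"
      using kernel_invariant_sum[OF ds(2) d(4) r(4) banach_operator_clinear[OF B] inv]
        k0 quasi_nilpotent_part_bijective(1)[OF l] by (simp add: direct_sum_iff subspace_sum_def)
    moreover have "?B ` ?N = ?N"
      using range_invariant_sum[OF ds(2) d(4) r(4) banach_operator_clinear[OF B] inv]
        r0 quasi_nilpotent_part_bijective(2)[OF l] by (simp add: direct_sum_iff)
    ultimately show ?thesis using invertible_on_iff_bijective[OF B] by simp
  qed
  then show "quasi_nilpotent ?N S" by (auto simp: quasi_nilpotent_def spectrum_def)
qed

end

lemma ascent_subspace: "M \<subseteq> X \<Longrightarrow> ascent X T < \<infinity> \<Longrightarrow> ascent M T < \<infinity>"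
proof -
  assume "M \<subseteq> X" "ascent X T < \<infinity>"
  then obtain p where "kernel X (T ^^ p) = kernel X (T ^^ Suc p)" unfolding ascent_finite_iff by blast
  moreover have "kernel M U = kernel X U \<inter> M" for U using \<open>M \<subseteq> X\<close> by (auto simp: kernel_def)
  ultimately have "kernel M (T ^^ p) = kernel M (T ^^ Suc p)" by (simp del: funpow.simps)
  then show ?thesis unfolding ascent_finite_iff by blast
qed

lemma descent_invariant_part:
  assumes ds: "direct_sum X M N" "csubspace M" "csubspace N" and T: "banach_operator X T"
    and inv: "T ` M \<subseteq> M" "T ` N \<subseteq> N" and "descent X T < \<infinity>"
  shows "descent M T < \<infinity>"
proof -
  obtain q where q: "(T ^^ q) ` X = (T ^^ Suc q) ` X" using assms(7) unfolding descent_finite_iff by blast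
  have part: "(T ^^ n) ` M = (T ^^ n) ` X \<inter> M" for n
    by (rule range_invariant_part[OF ds banach_operator_clinear[OF banach_operator_power[OF T]]
          power_invariant[OF inv(1)] power_invariant[OF inv(2)]])
  have "(T ^^ q) ` M = (T ^^ Suc q) ` M" by (simp only: part q)
  then show ?thesis unfolding descent_finite_iff by blast
qed

lemma ex_small_nonzero:
  assumes "e > 0" "e' > 0"
  obtains l :: complex where "l \<noteq> 0" "cmod l < e" "cmod l < e'"
proof (rule that[of "complex_of_real (min e e' / 2)"])
  show "complex_of_real (min e e' / 2) \<noteq> 0" using assms by simp
  show "cmod (complex_of_real (min e e' / 2)) < e" "cmod (complex_of_real (min e e' / 2)) < e'"
    unfolding norm_of_real using assms by (simp_all add: min_def)
qed

lemma Red_UNIV_zero: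
  assumes "banach_operator UNIV S"
  shows "(UNIV, {0}) \<in> Red S" "quasi_nilpotent {0} S"
proof -
  show "(UNIV, {0}) \<in> Red S"
    using power_zero[OF assms, of 1]
    by (auto simp: Red_def direct_sum_iff subspace_sum_def complex_vector.subspace_single_0)
  have "invertible_on {0} (shift S l)" for l
    using power_zero[OF banach_operator_shift[OF assms, of l], of 1]
    by (auto simp: invertible_on_def bounded_operators_def intro!: bexI[of _ "\<lambda>x. 0"])
  then show "quasi_nilpotent {0} S" by (simp add: quasi_nilpotent_def spectrum_def)
qed

context
  fixes S :: "'a::complex_banach \<Rightarrow> 'a"
  assumes S: "banach_operator UNIV S"
begin

text \<open>
  The other alternative of the dichotomy would give infinite ascent on \<open>M\<close>, hence on the whole
  space, for all small shifts.
\<close>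

lemma gD_upper_semi_Weyl_splitting:
  assumes Red: "(M, N) \<in> Red S" and qn: "quasi_nilpotent N S" and W: "upper_semi_Weyl M S"
    and asc: "\<exists>e>0. \<forall>l. l \<noteq> 0 \<longrightarrow> cmod l < e \<longrightarrow> ascent UNIV (shift S l) < \<infinity>"
  obtains M1 M0 where "nilpotent_splitting M S M1 M0" "bounded_below M1 S"
proof -
  note r = Red_facts[OF S Red qn]
  obtain e1 where e1: "e1 > 0" "\<And>l. l \<noteq> 0 \<Longrightarrow> cmod l < e1 \<Longrightarrow> ascent UNIV (shift S l) < \<infinity>"
    using asc by blast
  have "\<not> (\<exists>e>0. \<forall>l. cmod l < e \<longrightarrow> ascent M (shift S l) = \<infinity>)"
  proof
    assume "\<exists>e>0. \<forall>l. cmod l < e \<longrightarrow> ascent M (shift S l) = \<infinity>"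
    then obtain e2 where e2: "e2 > 0" "\<And>l. cmod l < e2 \<Longrightarrow> ascent M (shift S l) = \<infinity>" by blast
    obtain l :: complex where l: "l \<noteq> 0" "cmod l < e1" "cmod l < e2"
      by (rule ex_small_nonzero[OF e1(1) e2(1)])
    have "ascent M (shift S l) < \<infinity>" by (rule ascent_subspace[OF subset_UNIV e1(2)[OF l(1,2)]])
    then show False using e2(2)[OF l(3)] by simp
  qed
  then show thesis
    using upper_semi_Fredholm_dichotomy[OF r(8)] W that unfolding upper_semi_Weyl_iff by blast
qed

text \<open>
  For small \<open>l \<noteq> 0\<close> the shift is upper semi-Weyl on \<open>M\<close> by stability of the index, and bijective
  on the quasi-nilpotent summand, so it is upper semi-Weyl on the whole space and has finite ascent
  by assumption. The splitting of \<open>M\<close> that this entails has a finite-dimensional nilpotent part,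
  which is moved to the quasi-nilpotent summand.
\<close>

lemma gD_upper_semi_Weyl_imp_bounded_below:
  assumes gD: "gD_upper_semi_Weyl S"
    and asc: "\<And>l. upper_semi_Weyl UNIV (shift S l) \<Longrightarrow> ascent UNIV (shift S l) < \<infinity>"
  shows "gD_bounded_below S"
proof -
  obtain M N where Red: "(M, N) \<in> Red S" and qn: "quasi_nilpotent N S" and W: "upper_semi_Weyl M S"
    using gD by (auto simp: gD_upper_semi_Weyl_def)
  obtain e where e: "e > 0" "\<And>l. cmod l < e \<Longrightarrow> upper_semi_Weyl M (shift S l)"
    using upper_semi_Weyl_shift[OF Red_facts(8)[OF S Red qn] W] by blast
  have "\<exists>e>0. \<forall>l. l \<noteq> 0 \<longrightarrow> cmod l < e \<longrightarrow> ascent UNIV (shift S l) < \<infinity>"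
    using e asc upper_semi_Weyl_shift_UNIV[OF S Red qn] by blast
  then obtain M1 M0 where sp: "nilpotent_splitting M S M1 M0" "bounded_below M1 S"
    using gD_upper_semi_Weyl_splitting[OF Red qn W] by blast
  then show ?thesis
    using Red_absorb_nilpotent_part[OF S Red qn sp(1)] unfolding gD_bounded_below_def by blast
qed

text \<open>
  Small nonzero shifts are injective on both summands, so they have ascent zero and exclude the
  second alternative of the dichotomy.
\<close>

lemma gD_bounded_below_splitting:
  assumes gD: "gD_bounded_below S" and F: "upper_semi_Fredholm UNIV S"
  obtains M1 M0 where "nilpotent_splitting UNIV S M1 M0" "bounded_below M1 S"
proof -
  obtain M N where Red: "(M, N) \<in> Red S" and qn: "quasi_nilpotent N S" and bb: "bounded_below M S"
    using gD by (auto simp: gD_bounded_below_def)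
  note r = Red_facts[OF S Red qn]
  obtain e1 where e1: "e1 > 0" "\<And>l. cmod l < e1 \<Longrightarrow> bounded_below M (shift S l)"
    using bounded_below_shift[OF bb] by blast
  have asc: "ascent UNIV (shift S l) < \<infinity>" if l: "l \<noteq> 0" "cmod l < e1" for l
  proof -
    have "kernel M (shift S l) = {0}"
      using e1(2)[OF l(2)] injective_closed_range_iff_bounded_below[OF banach_operator_shift[OF r(8)]] by blast
    then have "ccdim (kernel UNIV (shift S l)) = 0" using kernel_shift_UNIV[OF S Red qn l(1)] by simp
    then have "kernel UNIV (shift S l) = {0}"
      using ccdim_eq_0_iff[OF banach_operator_kernel[OF banach_operator_shift[OF S]]] by simp
    moreover have "kernel UNIV (shift S l ^^ 0) = {0}" by (simp add: kernel_def)
    ultimately have "kernel UNIV (shift S l ^^ 0) = kernel UNIV (shift S l ^^ Suc 0)" by simp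
    then show ?thesis unfolding ascent_finite_iff by blast
  qed
  have "\<not> (\<exists>e>0. \<forall>l. cmod l < e \<longrightarrow> ascent UNIV (shift S l) = \<infinity>)"
  proof
    assume "\<exists>e>0. \<forall>l. cmod l < e \<longrightarrow> ascent UNIV (shift S l) = \<infinity>"
    then obtain e2 where e2: "e2 > 0" "\<And>l. cmod l < e2 \<Longrightarrow> ascent UNIV (shift S l) = \<infinity>" by blast
    obtain l :: complex where l: "l \<noteq> 0" "cmod l < e1" "cmod l < e2"
      by (rule ex_small_nonzero[OF e1(1) e2(1)])
    show False using asc[OF l(1,2)] e2(2)[OF l(3)] by simp
  qed
  then show thesis using upper_semi_Fredholm_dichotomy[OF S F] that by blast
qed

lemma gD_lower_semi_Weyl_imp_surjective:
  assumes gD: "gD_lower_semi_Weyl S"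
    and desc: "\<And>l. lower_semi_Weyl UNIV (shift S l) \<Longrightarrow> descent UNIV (shift S l) < \<infinity>"
  shows "gD_surjective S"
proof -
  obtain M N where Red: "(M, N) \<in> Red S" and qn: "quasi_nilpotent N S" and W: "lower_semi_Weyl M S"
    using gD by (auto simp: gD_lower_semi_Weyl_def)
  note r = Red_facts[OF S Red qn]
  obtain e1 where e1: "e1 > 0" "\<And>l. cmod l < e1 \<Longrightarrow> lower_semi_Weyl M (shift S l)"
    using lower_semi_Weyl_shift[OF r(8) W] by blast
  have "\<not> (\<exists>e>0. \<forall>l. cmod l < e \<longrightarrow> l \<noteq> 0 \<longrightarrow> descent M (shift S l) = \<infinity>)"
  proof
    assume "\<exists>e>0. \<forall>l. cmod l < e \<longrightarrow> l \<noteq> 0 \<longrightarrow> descent M (shift S l) = \<infinity>"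
    then obtain e2 where e2: "e2 > 0" "\<And>l. cmod l < e2 \<Longrightarrow> l \<noteq> 0 \<Longrightarrow> descent M (shift S l) = \<infinity>" by blast
    obtain l :: complex where l: "l \<noteq> 0" "cmod l < e1" "cmod l < e2"
      by (rule ex_small_nonzero[OF e1(1) e2(1)])
    have "descent UNIV (shift S l) < \<infinity>"
      by (rule desc[OF lower_semi_Weyl_shift_UNIV[OF S Red qn l(1) e1(2)[OF l(2)]]])
    then have "descent M (shift S l) < \<infinity>"
      by (rule descent_invariant_part[OF r(7,1,4) banach_operator_shift[OF S]
            shift_sum_facts(1,2)[OF S Red qn]])
    then show False using e2(2)[OF l(3,1)] by simp
  qed
  then obtain M1 M0 where sp: "nilpotent_splitting M S M1 M0" "S ` M1 = M1"
    using lower_semi_Fredholm_dichotomy[OF r(8)] W unfolding lower_semi_Weyl_iff by blast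
  then show ?thesis
    using Red_absorb_nilpotent_part[OF S Red qn sp(1)] unfolding gD_surjective_def surjective_def by blast
qed

lemma gD_surjective_imp_descent:
  assumes gD: "gD_surjective S" and F: "lower_semi_Fredholm UNIV S"
  shows "descent UNIV S < \<infinity>"
proof -
  obtain M N where Red: "(M, N) \<in> Red S" and qn: "quasi_nilpotent N S" and surj: "S ` M = M"
    using gD by (auto simp: gD_surjective_def surjective_def)
  note r = Red_facts[OF S Red qn]
  obtain e1 where e1: "e1 > 0" "\<And>l. cmod l < e1 \<Longrightarrow> shift S l ` M = M"
    using surjective_shift[OF r(8) surj] by blast
  have desc: "descent UNIV (shift S l) < \<infinity>" if l: "l \<noteq> 0" "cmod l < e1" for l
  proof -
    have "shift S l ` UNIV = UNIV"
      using range_invariant_sum[OF r(7,1,4) shift_sum_facts(3,1,2)[OF S Red qn], of l]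
        quasi_nilpotent_part_bijective(2)[OF S Red qn l(1)] e1(2)[OF l(2)] r(7)
      by (simp add: direct_sum_iff)
    then have "(shift S l ^^ 0) ` UNIV = (shift S l ^^ Suc 0) ` UNIV" by simp
    then show ?thesis unfolding descent_finite_iff by blast
  qed
  have "\<not> (\<exists>e>0. \<forall>l. cmod l < e \<longrightarrow> l \<noteq> 0 \<longrightarrow> descent UNIV (shift S l) = \<infinity>)"
  proof
    assume "\<exists>e>0. \<forall>l. cmod l < e \<longrightarrow> l \<noteq> 0 \<longrightarrow> descent UNIV (shift S l) = \<infinity>"
    then obtain e2 where e2: "e2 > 0" "\<And>l. cmod l < e2 \<Longrightarrow> l \<noteq> 0 \<Longrightarrow> descent UNIV (shift S l) = \<infinity>" by blast
    obtain l :: complex where l: "l \<noteq> 0" "cmod l < e1" "cmod l < e2"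
      by (rule ex_small_nonzero[OF e1(1) e2(1)])
    show False using desc[OF l(1,2)] e2(2)[OF l(3,1)] by simp
  qed
  then obtain M1 M0 where "nilpotent_splitting UNIV S M1 M0" "S ` M1 = M1"
    using lower_semi_Fredholm_dichotomy[OF S F] by blast
  then show ?thesis using splitting_descent[OF S] by blast
qed

lemma pseudo_B_Weyl_imp_invertible:
  assumes gD: "pseudo_B_Weyl S"
    and asc: "\<And>l. Weyl UNIV (shift S l) \<Longrightarrow> ascent UNIV (shift S l) < \<infinity>"
  shows "gD_invertible S"
proof -
  obtain M N where Red: "(M, N) \<in> Red S" and qn: "quasi_nilpotent N S" and W: "Weyl M S"
    using gD by (auto simp: pseudo_B_Weyl_def)
  note r = Red_facts[OF S Red qn]
  obtain e where e: "e > 0" "\<And>l. cmod l < e \<Longrightarrow> Weyl M (shift S l)"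
    using Weyl_shift[OF r(8) W] by blast
  have "\<exists>e>0. \<forall>l. l \<noteq> 0 \<longrightarrow> cmod l < e \<longrightarrow> ascent UNIV (shift S l) < \<infinity>"
    using e asc upper_semi_Weyl_shift_UNIV[OF S Red qn] lower_semi_Weyl_shift_UNIV[OF S Red qn]
    unfolding Weyl_iff by blast
  moreover have "upper_semi_Weyl M S" using W by (simp add: Weyl_iff)
  ultimately obtain M1 M0 where sp: "nilpotent_splitting M S M1 M0" "bounded_below M1 S"
    using gD_upper_semi_Weyl_splitting[OF Red qn] by blast
  note S1 = splitting_facts(10)[OF r(8) sp(1)]
  have "kernel M1 S = {0}" using injective_closed_range_iff_bounded_below[OF S1] sp(2) by simp
  then have "invertible_on M1 S"
    using splitting_surjective_of_index[OF r(8) sp W] invertible_on_iff_bijective[OF S1] by simp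
  then show ?thesis
    using Red_absorb_nilpotent_part[OF S Red qn sp(1)] unfolding gD_invertible_def by blast
qed

lemma gD_invertible_imp_bounded_below: "gD_invertible S \<Longrightarrow> gD_bounded_below S"
proof -
  assume "gD_invertible S"
  then obtain M N where Red: "(M, N) \<in> Red S" and qn: "quasi_nilpotent N S" and inv: "invertible_on M S"
    by (auto simp: gD_invertible_def)
  note r = Red_facts[OF S Red qn]
  have "bounded_below M S"
    using inv invertible_on_iff_bijective[OF r(8)] injective_closed_range_iff_bounded_below[OF r(8)] r(2) by simp
  then show ?thesis using Red qn unfolding gD_bounded_below_def by blast
qed

lemma gD_invertible_imp_Browder:
  assumes gD: "gD_invertible S" and W: "Weyl UNIV S"
  shows "Browder UNIV S"
proof -
  have F: "upper_semi_Fredholm UNIV S" "lower_semi_Fredholm UNIV S"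
    using W by (simp_all add: Weyl_def Fredholm_def)
  obtain M1 M0 where sp: "nilpotent_splitting UNIV S M1 M0" "bounded_below M1 S"
    using gD_bounded_below_splitting[OF gD_invertible_imp_bounded_below[OF gD] F(1)] by blast
  show ?thesis
    using F splitting_ascent[OF S sp] splitting_descent[OF S sp(1) splitting_surjective_of_index[OF S sp W]]
    by (simp add: Browder_def upper_semi_Browder_def lower_semi_Browder_def)
qed

lemma gD_bounded_below_imp_upper_semi_Weyl: "gD_bounded_below S \<Longrightarrow> gD_upper_semi_Weyl S"
proof -
  assume "gD_bounded_below S"
  then obtain M N where Red: "(M, N) \<in> Red S" and qn: "quasi_nilpotent N S" and bb: "bounded_below M S"
    by (auto simp: gD_bounded_below_def)
  have "upper_semi_Weyl M S"
    using bb injective_closed_range_iff_bounded_below[OF Red_facts(8)[OF S Red qn]]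
    by (simp add: upper_semi_Weyl_iff upper_semi_Fredholm_def)
  then show ?thesis using Red qn unfolding gD_upper_semi_Weyl_def by blast
qed

lemma gD_surjective_imp_lower_semi_Weyl: "gD_surjective S \<Longrightarrow> gD_lower_semi_Weyl S"
proof -
  assume "gD_surjective S"
  then obtain M N where Red: "(M, N) \<in> Red S" and qn: "quasi_nilpotent N S" and surj: "S ` M = M"
    by (auto simp: gD_surjective_def surjective_def)
  note r = Red_facts[OF S Red qn]
  have "lower_semi_Weyl M S"
    using surj ccodim_eq_0_iff[OF r(1) r(1)] by (simp add: lower_semi_Weyl_iff lower_semi_Fredholm_def)
  then show ?thesis using Red qn unfolding gD_lower_semi_Weyl_def by blast
qed

lemma gD_invertible_imp_pseudo_B_Weyl: "gD_invertible S \<Longrightarrow> pseudo_B_Weyl S"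
proof -
  assume "gD_invertible S"
  then obtain M N where Red: "(M, N) \<in> Red S" and qn: "quasi_nilpotent N S" and inv: "invertible_on M S"
    by (auto simp: gD_invertible_def)
  note r = Red_facts[OF S Red qn]
  have "Weyl M S"
    using inv invertible_on_iff_bijective[OF r(8)] r(2) ccodim_eq_0_iff[OF r(1) r(1)]
    by (simp add: Weyl_iff upper_semi_Weyl_iff upper_semi_Fredholm_def lower_semi_Weyl_iff lower_semi_Fredholm_def)
  then show ?thesis using Red qn unfolding pseudo_B_Weyl_def by blast
qed

end

section \<open>Duality\<close>

lemma subspace_closure:
  fixes R :: "'a::real_normed_vector set"
  assumes R: "subspace R"
  shows "subspace (closure R)"
  unfolding subspace_def
proof (intro conjI ballI allI)
  show "0 \<in> closure R" using subspace_0[OF R] closure_subset by blast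
  show "x + y \<in> closure R" if xy: "x \<in> closure R" "y \<in> closure R" for x y
  proof -
    obtain s t where "\<forall>n. s n \<in> R" "s \<longlonglongrightarrow> x" "\<forall>n. t n \<in> R" "t \<longlonglongrightarrow> y"
      using xy unfolding closure_sequential by blast
    then show ?thesis
      unfolding closure_sequential using R
      by (intro exI[of _ "\<lambda>n. s n + t n"]) (auto intro: tendsto_add subspace_add)
  qed
  show "c *\<^sub>R x \<in> closure R" if x: "x \<in> closure R" for c x
  proof -
    obtain s where "\<forall>n. s n \<in> R" "s \<longlonglongrightarrow> x" using x unfolding closure_sequential by blast
    then show ?thesis
      unfolding closure_sequential using R
      by (intro exI[of _ "\<lambda>n. c *\<^sub>R s n"]) (auto intro: tendsto_intros subspace_scale)
  qed
qed

lemma banach_operator_dual: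
  fixes T :: "'a::complex_banach \<Rightarrow> 'a"
  assumes "T \<in> bounded_operators UNIV"
  shows "banach_operator cdual (dual_operator T)"
  unfolding banach_operator_def
  using csubspace_cdual closed_cdual dual_operator_bounded_operators[OF assms]
  by (simp add: complete_eq_closed)

text \<open>
  The operator \<open>D\<close> is only required to act as the adjoint on complex-linear functionals. This covers
  \<open>shift (dual_operator T) l\<close>, which agrees with \<open>dual_operator (shift T l)\<close> there but in general not on
  the other elements of the type of real-linear functionals.
\<close>

context
  fixes S :: "'a::complex_banach \<Rightarrow> 'a" and D :: "('a \<Rightarrow>\<^sub>L complex) \<Rightarrow> ('a \<Rightarrow>\<^sub>L complex)"
  assumes S: "banach_operator UNIV S" and D: "banach_operator cdual D"
    and adj: "\<And>f x. f \<in> cdual \<Longrightarrow> blinfun_apply (D f) x = blinfun_apply f (S x)"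
begin

lemma adjoint_power:
  assumes "f \<in> cdual"
  shows "blinfun_apply ((D ^^ n) f) x = blinfun_apply f ((S ^^ n) x)"
proof (induction n arbitrary: x)
  case (Suc n)
  have "(D ^^ n) f \<in> cdual" by (rule power_in[OF D assms])
  then have "blinfun_apply ((D ^^ Suc n) f) x = blinfun_apply ((D ^^ n) f) (S x)" by (simp add: adj)
  also have "\<dots> = blinfun_apply f ((S ^^ n) (S x))" by (rule Suc)
  also have "(S ^^ n) (S x) = (S ^^ Suc n) x" by (simp add: funpow_swap1)
  finally show ?case .
qed simp

lemma kernel_adjoint_power: "kernel cdual (D ^^ n) = annihilator (range (S ^^ n))"
proof (intro equalityI subsetI)
  fix f assume "f \<in> kernel cdual (D ^^ n)"
  then have f: "f \<in> cdual" "(D ^^ n) f = 0" by (simp_all add: kernel_def)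
  then have "blinfun_apply f ((S ^^ n) x) = 0" for x using adjoint_power[OF f(1), of n x] by simp
  then show "f \<in> annihilator (range (S ^^ n))" using f(1) by (auto simp: annihilator_def)
next
  fix f assume f: "f \<in> annihilator (range (S ^^ n))"
  then have fc: "f \<in> cdual" by (simp add: annihilator_def)
  have "blinfun_apply ((D ^^ n) f) x = 0" for x
    using f adjoint_power[OF fc, of n x] by (simp add: annihilator_def)
  then have "(D ^^ n) f = 0" by (intro blinfun_eqI) simp
  then show "f \<in> kernel cdual (D ^^ n)" using fc by (simp add: kernel_def)
qed

lemma kernel_adjoint: "kernel cdual D = annihilator (range S)"
  using kernel_adjoint_power[of 1] by simp

text \<open>
  Let \<open>f\<close> vanish on the kernel and \<open>f x1 = 1\<close>. The image of the null space \<open>L\<close> of \<open>f\<close> is closed and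
  does not contain \<open>S x1\<close>; a functional separating the two, normalized to 1 at \<open>S x1\<close>, is a preimage
  of \<open>f\<close>.
\<close>

lemma range_adjoint:
  assumes cl: "closed (range S)"
  shows "D ` cdual = annihilator (kernel UNIV S)"
proof (intro equalityI subsetI)
  fix h assume "h \<in> D ` cdual"
  then obtain f where f: "f \<in> cdual" "h = D f" by blast
  have "blinfun_apply h x = 0" if "x \<in> kernel UNIV S" for x
    using that f adj[OF f(1), of x] by (simp add: kernel_def blinfun.zero_right)
  moreover have "h \<in> cdual" using banach_operator_maps[OF D] f by blast
  ultimately show "h \<in> annihilator (kernel UNIV S)" by (simp add: annihilator_def)
next
  fix f assume f: "f \<in> annihilator (kernel UNIV S)"
  then have fc: "f \<in> cdual" by (simp add: annihilator_def)
  have f_scale: "blinfun_apply f (c *\<^sub>C y) = c * blinfun_apply f y" for c y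
    using fc by (simp add: cdual_def)
  show "f \<in> D ` cdual"
  proof (cases "f = 0")
    case True
    have "0 \<in> D ` cdual" by (rule complex_vector.subspace_0[OF banach_operator_range[OF D]])
    then show ?thesis using True by simp
  next
    case False
    then obtain x where x: "blinfun_apply f x \<noteq> 0" by (metis blinfun_eqI zero_blinfun.rep_eq)
    define x1 where "x1 = inverse (blinfun_apply f x) *\<^sub>C x"
    have x1: "blinfun_apply f x1 = 1" using x by (simp add: x1_def f_scale)
    define L where "L = {y. blinfun_apply f y = 0}"
    have L: "csubspace L"
      unfolding L_def complex_vector.subspace_def by (simp add: blinfun.zero_right blinfun.add_right f_scale)
    have "closed L" unfolding L_def by (intro closed_Collect_eq continuous_intros)
    moreover have "kernel UNIV S \<subseteq> L" using f by (auto simp: L_def annihilator_def)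
    ultimately have clSL: "closed (S ` L)" using closed_image_of_closed[OF S cl L] by simp
    note lin = banach_operator_clinear[OF S]
    have SL: "csubspace (S ` L)"
      by (rule csubspace_image[OF lin complex_vector.subspace_UNIV L subset_UNIV])
    have "S x1 \<notin> S ` L"
    proof
      assume "S x1 \<in> S ` L"
      then obtain y where y: "y \<in> L" "S x1 = S y" by blast
      then have "x1 - y \<in> kernel UNIV S"
        using clinear_on_diff[OF lin complex_vector.subspace_UNIV] by (simp add: kernel_def)
      then have "blinfun_apply f (x1 - y) = 0" using f by (simp add: annihilator_def)
      then show False using x1 y(1) by (simp add: blinfun.diff_right L_def)
    qed
    then obtain g where g: "g \<in> cdual" "blinfun_apply g (S x1) = 1" "\<And>y. y \<in> S ` L \<Longrightarrow> blinfun_apply g y = 0"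
      using separating_functional[OF SL clSL] by blast
    have "blinfun_apply (D g) y = blinfun_apply f y" for y
    proof -
      let ?c = "blinfun_apply f y"
      have "y - ?c *\<^sub>C x1 \<in> L" by (simp add: L_def blinfun.diff_right f_scale x1)
      then have "blinfun_apply g (S (y - ?c *\<^sub>C x1)) = 0" using g(3) by blast
      moreover have "S (y - ?c *\<^sub>C x1) = S y - ?c *\<^sub>C S x1"
        using clinear_on_diff[OF lin complex_vector.subspace_UNIV] clinear_on_scale[OF lin] by simp
      ultimately show ?thesis using g(1,2) adj[OF g(1), of y] by (simp add: blinfun.diff_right cdual_def)
    qed
    then have "D g = f" by (intro blinfun_eqI) simp
    then show ?thesis using g(1) by blast
  qed
qed

text \<open>
  The hard half of the closed range theorem. For \<open>y\<close> in the closure of the range, closedness of the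
  range of the adjoint gives \<open>\<bar>g y\<bar> \<le> C \<parallel>D g\<parallel> \<parallel>y\<parallel>\<close> for all functionals \<open>g\<close>. The seminorm
  \<open>p y = inf\<^sub>x (\<parallel>x\<parallel> + \<parallel>y - S x\<parallel> / d)\<close> is at most \<open>\<parallel>x\<parallel>\<close> at \<open>S x\<close>, so that every functional \<open>g\<close> below \<open>p\<close> has
  \<open>\<parallel>D g\<parallel> \<le> 1\<close>; choosing one that attains \<open>p y\<close> yields \<open>p y \<le> C \<parallel>y\<parallel>\<close>. By the definition of \<open>p\<close>, this says
  that \<open>S x = y\<close> can be solved approximately with control, hence exactly.
\<close>

lemma closed_range_of_adjoint:
  assumes cl: "closed (D ` cdual)"
  shows "closed (range S)"
proof -
  note lin = banach_operator_clinear[OF S]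
  have S_add: "S (x + y) = S x + S y" for x y using clinear_on_add[OF lin] by simp
  have S_scale: "S (c *\<^sub>C x) = c *\<^sub>C S x" for c x using clinear_on_scale[OF lin] by simp
  have S_zero: "S 0 = 0" using power_zero[OF S, of 1] by simp
  obtain C where C: "C > 0" "\<And>h. h \<in> D ` cdual \<Longrightarrow> \<exists>g\<in>cdual. D g = h \<and> norm g \<le> C * norm h"
    using banach_operator_open[OF D cl] by blast
  define Y where "Y = closure (range S)"
  have Y: "subspace Y"
    unfolding Y_def
    by (intro subspace_closure csubspace_imp_subspace banach_operator_range[OF S])
  have small: "cmod (blinfun_apply g y) \<le> C * norm (D g) * norm y" if y: "y \<in> Y" and g: "g \<in> cdual" for g y
  proof -
    obtain g' where g': "g' \<in> cdual" "D g' = D g" "norm g' \<le> C * norm (D g)" using C(2) g by blast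
    have "blinfun_apply g z = blinfun_apply g' z" if "z \<in> range S" for z
      using that adj[OF g] adj[OF g'(1)] g'(2) by auto
    then have "range S \<subseteq> {z. blinfun_apply g z = blinfun_apply g' z}" by blast
    moreover have "closed {z. blinfun_apply g z = blinfun_apply g' z}"
      by (intro closed_Collect_eq continuous_intros)
    ultimately have "Y \<subseteq> {z. blinfun_apply g z = blinfun_apply g' z}"
      unfolding Y_def by (rule closure_minimal)
    then have "blinfun_apply g y = blinfun_apply g' y" using y by blast
    also have "cmod \<dots> \<le> norm g' * norm y" by (rule norm_blinfun)
    also have "\<dots> \<le> C * norm (D g) * norm y" using g'(3) by (rule mult_right_mono) simp
    finally show ?thesis .
  qed
  define d where "d = 1 / (2 * (C + 1))"
  have d: "d > 0" using C(1) by (simp add: d_def)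
  define q where "q y x = norm x + norm (y - S x) / d" for y x
  define p where "p y = (INF x. q y x)" for y
  have q0: "0 \<le> q y x" for y x using d by (simp add: q_def)
  have lower: "p y \<le> q y x" for y x
    unfolding p_def by (rule cINF_lower[OF bdd_belowI2[of _ 0]]) (auto intro: q0)
  have greatest: "c \<le> p y" if "\<And>x. c \<le> q y x" for c y
    unfolding p_def using that by (intro cINF_greatest) auto
  have p_add: "p (y + z) \<le> p y + p z" for y z
  proof -
    have "p (y + z) \<le> q y x + q z x'" for x x'
    proof -
      have "norm (y + z - S (x + x')) \<le> norm (y - S x) + norm (z - S x')"
        using norm_triangle_ineq[of "y - S x" "z - S x'"] by (simp add: S_add algebra_simps)
      then have "norm (y + z - S (x + x')) / d \<le> norm (y - S x) / d + norm (z - S x') / d"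
        using d by (simp add: divide_right_mono add_divide_distrib[symmetric])
      then have "q (y + z) (x + x') \<le> q y x + q z x'"
        using norm_triangle_ineq[of x x'] by (simp add: q_def)
      then show ?thesis using lower[of "y + z" "x + x'"] by simp
    qed
    then have "p (y + z) - q z x' \<le> p y" for x' by (intro greatest) (simp add: algebra_simps)
    then have "p (y + z) - p y \<le> p z" by (intro greatest) (simp add: algebra_simps)
    then show ?thesis by simp
  qed
  have p_scale: "p (c *\<^sub>C y) \<le> cmod c * p y" for c y
  proof -
    have le: "p (c *\<^sub>C y) \<le> cmod c * q y x" for x
    proof -
      have "c *\<^sub>C y - S (c *\<^sub>C x) = c *\<^sub>C (y - S x)"
        by (simp add: S_scale complex_vector.scale_right_diff_distrib)
      then have "q (c *\<^sub>C y) (c *\<^sub>C x) = cmod c * q y x" by (simp add: q_def norm_scaleC distrib_left)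
      then show ?thesis using lower[of "c *\<^sub>C y" "c *\<^sub>C x"] by simp
    qed
    show ?thesis
    proof (cases "c = 0")
      case False
      then have "p (c *\<^sub>C y) / cmod c \<le> q y x" for x using le[of x] by (simp add: field_simps)
      then have "p (c *\<^sub>C y) / cmod c \<le> p y" by (rule greatest)
      then show ?thesis using False by (simp add: field_simps)
    qed (use le in simp)
  qed
  have p_bound: "p y \<le> (1 / d) * norm y" for y using lower[of y 0] by (simp add: q_def S_zero)
  have p_le: "p y \<le> C * norm y" if y: "y \<in> Y" for y
  proof -
    obtain g where g: "g \<in> cdual" "\<And>x. cmod (blinfun_apply g x) \<le> p x"
        "blinfun_apply g y = complex_of_real (p y)"
      using Hahn_Banach_seminorm[of p "1 / d" y, OF p_add p_scale p_bound] by blast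
    have "cmod (blinfun_apply (D g) x) \<le> 1 * norm x" for x
      using g(2)[of "S x"] lower[of "S x" x] adj[OF g(1), of x] by (simp add: q_def)
    then have "norm (D g) \<le> 1" by (intro norm_blinfun_bound) auto
    then have "C * norm (D g) * norm y \<le> C * 1 * norm y"
      using C(1) by (intro mult_right_mono mult_left_mono) auto
    moreover have "p y \<le> cmod (blinfun_apply g y)" unfolding g(3) by simp
    ultimately show ?thesis using small[OF y g(1)] by simp
  qed
  have "\<exists>x\<in>UNIV. norm x \<le> (C + 1) * norm y \<and> norm (y - S x) \<le> norm y / 2" if y: "y \<in> Y" for y
  proof (cases "y = 0")
    case True
    then show ?thesis using S_zero by (intro bexI[of _ 0]) auto
  next
    case False
    then have "C * norm y < (C + 1) * norm y" by simp
    with p_le[OF y] have "p y < (C + 1) * norm y" by (rule le_less_trans)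
    then obtain x where x: "q y x < (C + 1) * norm y"
      using greatest[of "(C + 1) * norm y" y] by (meson not_le)
    have "norm (y - S x) / d \<le> (C + 1) * norm y"
      using x norm_ge_zero[of x] unfolding q_def by linarith
    then have "norm (y - S x) \<le> (C + 1) * norm y * d" using d by (simp add: field_simps)
    also have "\<dots> = norm y / 2"
    proof -
      have "C + 1 \<noteq> 0" using C(1) by simp
      then show ?thesis unfolding d_def by (simp add: divide_simps)
    qed
    finally have "norm (y - S x) \<le> norm y / 2" .
    moreover have "0 \<le> norm (y - S x) / d" using d by simp
    then have "norm x \<le> (C + 1) * norm y" using x unfolding q_def by linarith
    ultimately show ?thesis by blast
  qed
  then have "\<exists>x\<in>UNIV. S x = y \<and> norm x \<le> 2 * (C + 1) * norm y" if "y \<in> Y" for y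
    by (intro approximate_solutions_imp_solutions[OF subspace_UNIV complete_UNIV
          banach_operator_bounded[OF S] Y _ _ _ that]) (use C(1) in \<open>auto simp: Y_def intro: subsetD[OF closure_subset]\<close>)
  then have "Y \<subseteq> range S" by blast
  then show ?thesis unfolding Y_def using closure_subset_eq by blast
qed

text \<open>
  Taking adjoints exchanges the dimension of the kernel with the codimension of the range.
\<close>

lemma upper_semi_Weyl_adjoint_iff: "upper_semi_Weyl cdual D \<longleftrightarrow> lower_semi_Weyl UNIV S"
proof -
  have swap: "ccdim (kernel cdual D) = ccodim UNIV (range S)"
    "ccodim cdual (D ` cdual) = ccdim (kernel UNIV S)" if "closed (range S)"
    using ccdim_annihilator[OF banach_operator_range[OF S] that]
      ccodim_annihilator[OF banach_operator_kernel[OF S]]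
    by (simp_all add: kernel_adjoint range_adjoint[OF that])
  show ?thesis
  proof
    assume W: "upper_semi_Weyl cdual D"
    then have "closed (range S)"
      by (intro closed_range_of_adjoint) (simp add: upper_semi_Weyl_iff upper_semi_Fredholm_def)
    then show "lower_semi_Weyl UNIV S"
      using W swap by (simp add: upper_semi_Weyl_iff upper_semi_Fredholm_def
          lower_semi_Weyl_iff lower_semi_Fredholm_def)
  next
    assume W: "lower_semi_Weyl UNIV S"
    then have cl: "closed (range S)"
      by (intro closed_range_of_finite_codim[OF S]) (simp add: lower_semi_Weyl_iff lower_semi_Fredholm_def)
    then have "closed (D ` cdual)" using closed_annihilator by (simp add: range_adjoint)
    then show "upper_semi_Weyl cdual D"
      using W swap[OF cl] by (simp add: upper_semi_Weyl_iff upper_semi_Fredholm_def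
          lower_semi_Weyl_iff lower_semi_Fredholm_def)
  qed
qed

lemma annihilator_inj:
  assumes "csubspace A" "closed A" "csubspace B" "closed (B :: 'a set)" "annihilator A = annihilator B"
  shows "A = B"
proof -
  have sub: "A \<subseteq> B" if AB: "csubspace B" "closed B" "annihilator B \<subseteq> annihilator A" for A B :: "'a set"
  proof (rule ccontr)
    assume "\<not> A \<subseteq> B"
    then obtain a where a: "a \<in> A" "a \<notin> B" by blast
    then obtain f where "f \<in> cdual" "blinfun_apply f a = 1" "\<And>r. r \<in> B \<Longrightarrow> blinfun_apply f r = 0"
      using separating_functional[OF AB(1,2)] by blast
    then have "f \<in> annihilator A" "blinfun_apply f a \<noteq> 0"
      using AB(3) by (auto simp: annihilator_def)
    then show False using a(1) by (simp add: annihilator_def)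
  qed
  show ?thesis using sub[OF assms(3,4)] sub[OF assms(1,2)] assms(5) by blast
qed

text \<open>
  The kernels of the powers of the adjoint are the annihilators of the ranges of the powers, which
  are closed and hence determined by their annihilators.
\<close>

lemma ascent_adjoint_iff:
  assumes F: "lower_semi_Fredholm UNIV S"
  shows "ascent cdual D < \<infinity> \<longleftrightarrow> descent UNIV S < \<infinity>"
proof -
  have cl: "closed (range (S ^^ n))" for n
    using closed_power_ranges_lower[OF S] F by (simp add: lower_semi_Fredholm_def)
  note R = banach_operator_range[OF banach_operator_power[OF S]]
  have "annihilator (range (S ^^ n)) = annihilator (range (S ^^ m)) \<longleftrightarrow> range (S ^^ n) = range (S ^^ m)" for m n
    using annihilator_inj[OF R[of n] cl[of n] R[of m] cl[of m]] by metis
  then show ?thesis unfolding ascent_finite_iff descent_finite_iff kernel_adjoint_power by blast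
qed

end

section \<open>The characterizations\<close>

text \<open>
  Upper semi-Browder operators are upper semi-Weyl, so only one inclusion of the spectra is at
  stake.
\<close>

lemma a_Browder_theorem_iff:
  assumes T: "banach_operator M T"
  shows "a_Browder_theorem M T \<longleftrightarrow>
    (\<forall>l. upper_semi_Weyl M (shift T l) \<longrightarrow> ascent M (shift T l) < \<infinity>)"
  using upper_semi_Browder_imp_upper_semi_Weyl[OF banach_operator_shift[OF T]]
  unfolding a_Browder_theorem_def sigma_uW_def sigma_uB_def
  by (auto simp: upper_semi_Browder_def upper_semi_Weyl_iff set_eq_iff)

lemma Browder_theorem_iff:
  assumes T: "banach_operator M T"
  shows "Browder_theorem M T \<longleftrightarrow> (\<forall>l. Weyl M (shift T l) \<longrightarrow> Browder M (shift T l))"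
  using Browder_imp_Weyl[OF banach_operator_shift[OF T]]
  unfolding Browder_theorem_def sigma_W_def sigma_B_def by (auto simp: set_eq_iff)

lemma a_Browder_theorem_iff_spectra:
  fixes T :: "'a::complex_banach \<Rightarrow> 'a"
  assumes T: "banach_operator UNIV T"
  shows "a_Browder_theorem UNIV T \<longleftrightarrow> sigma_gDM T = sigma_gDW_plus T"
proof -
  note Sl = banach_operator_shift[OF T]
  have "sigma_gDM T = sigma_gDW_plus T \<longleftrightarrow>
      (\<forall>l. gD_upper_semi_Weyl (shift T l) \<longrightarrow> gD_bounded_below (shift T l))"
    using gD_bounded_below_imp_upper_semi_Weyl[OF Sl]
    unfolding sigma_gDM_def sigma_gDW_plus_def by (auto simp: set_eq_iff)
  also have "\<dots> \<longleftrightarrow> a_Browder_theorem UNIV T"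
    unfolding a_Browder_theorem_iff[OF T]
  proof (intro iffI allI impI)
    fix l
    assume gD: "\<forall>l. gD_upper_semi_Weyl (shift T l) \<longrightarrow> gD_bounded_below (shift T l)"
      and W: "upper_semi_Weyl UNIV (shift T l)"
    have "gD_upper_semi_Weyl (shift T l)"
      unfolding gD_upper_semi_Weyl_def using W Red_UNIV_zero[OF Sl] by blast
    then have bb: "gD_bounded_below (shift T l)" using gD by blast
    obtain M1 M0 where sp: "nilpotent_splitting UNIV (shift T l) M1 M0" "bounded_below M1 (shift T l)"
      using gD_bounded_below_splitting[OF Sl bb] W by (auto simp: upper_semi_Weyl_iff)
    then show "ascent UNIV (shift T l) < \<infinity>" by (rule splitting_ascent[OF Sl])
  next
    fix l
    assume "\<forall>l. upper_semi_Weyl UNIV (shift T l) \<longrightarrow> ascent UNIV (shift T l) < \<infinity>"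
      and "gD_upper_semi_Weyl (shift T l)"
    then show "gD_bounded_below (shift T l)"
      by (intro gD_upper_semi_Weyl_imp_bounded_below[OF Sl]) (simp_all add: shift_shift)
  qed
  finally show ?thesis by blast
qed

lemma a_Browder_theorem_dual_iff_spectra:
  fixes T :: "'a::complex_banach \<Rightarrow> 'a"
  assumes T: "T \<in> bounded_operators UNIV"
  shows "a_Browder_theorem cdual (dual_operator T) \<longleftrightarrow> sigma_gDQ T = sigma_gDW_minus T"
proof -
  have T': "banach_operator UNIV T"
    using T complete_UNIV complex_vector.subspace_UNIV by (simp add: banach_operator_def)
  note Sl = banach_operator_shift[OF T'] and D = banach_operator_dual[OF T]
  note Dl = banach_operator_shift[OF D]
  have adj: "blinfun_apply (shift (dual_operator T) l f) x = blinfun_apply f (shift T l x)"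
    if "f \<in> cdual" for l f x
    using that blinfun_apply_dual_operator[OF T, of f x]
    by (simp add: shift_def cdual_def blinfun.diff_left blinfun.diff_right blinfun_apply_scaleC scaleC_complex_def)
  have weyl: "upper_semi_Weyl cdual (shift (dual_operator T) l) \<longleftrightarrow> lower_semi_Weyl UNIV (shift T l)" for l
    by (rule upper_semi_Weyl_adjoint_iff[OF Sl Dl adj])
  have asc: "ascent cdual (shift (dual_operator T) l) < \<infinity> \<longleftrightarrow> descent UNIV (shift T l) < \<infinity>"
    if "lower_semi_Weyl UNIV (shift T l)" for l
    by (rule ascent_adjoint_iff[OF Sl Dl adj]) (use that in \<open>simp_all add: lower_semi_Weyl_iff\<close>)
  have "sigma_gDQ T = sigma_gDW_minus T \<longleftrightarrow>
      (\<forall>l. gD_lower_semi_Weyl (shift T l) \<longrightarrow> gD_surjective (shift T l))"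
    using gD_surjective_imp_lower_semi_Weyl[OF Sl]
    unfolding sigma_gDQ_def sigma_gDW_minus_def by (auto simp: set_eq_iff)
  also have "\<dots> \<longleftrightarrow> (\<forall>l. lower_semi_Weyl UNIV (shift T l) \<longrightarrow> descent UNIV (shift T l) < \<infinity>)"
  proof (intro iffI allI impI)
    fix l
    assume gD: "\<forall>l. gD_lower_semi_Weyl (shift T l) \<longrightarrow> gD_surjective (shift T l)"
      and W: "lower_semi_Weyl UNIV (shift T l)"
    have "gD_lower_semi_Weyl (shift T l)"
      unfolding gD_lower_semi_Weyl_def using W Red_UNIV_zero[OF Sl] by blast
    then show "descent UNIV (shift T l) < \<infinity>"
      using gD W by (intro gD_surjective_imp_descent[OF Sl]) (simp_all add: lower_semi_Weyl_iff)
  next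
    fix l
    assume "\<forall>l. lower_semi_Weyl UNIV (shift T l) \<longrightarrow> descent UNIV (shift T l) < \<infinity>"
      and "gD_lower_semi_Weyl (shift T l)"
    then show "gD_surjective (shift T l)"
      by (intro gD_lower_semi_Weyl_imp_surjective[OF Sl]) (simp_all add: shift_shift)
  qed
  also have "\<dots> \<longleftrightarrow> a_Browder_theorem cdual (dual_operator T)"
    unfolding a_Browder_theorem_iff[OF D] weyl using asc by blast
  finally show ?thesis by blast
qed

lemma Browder_theorem_iff_spectra:
  fixes T :: "'a::complex_banach \<Rightarrow> 'a"
  assumes T: "banach_operator UNIV T"
  shows "Browder_theorem UNIV T \<longleftrightarrow> sigma_gD T = sigma_gDW T"
proof -
  note Sl = banach_operator_shift[OF T]
  have "sigma_gD T = sigma_gDW T \<longleftrightarrow>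
      (\<forall>l. pseudo_B_Weyl (shift T l) \<longrightarrow> gD_invertible (shift T l))"
    using gD_invertible_imp_pseudo_B_Weyl[OF Sl]
    unfolding sigma_gD_def sigma_gDW_def by (auto simp: set_eq_iff)
  also have "\<dots> \<longleftrightarrow> Browder_theorem UNIV T"
    unfolding Browder_theorem_iff[OF T]
  proof (intro iffI allI impI)
    fix l
    assume gD: "\<forall>l. pseudo_B_Weyl (shift T l) \<longrightarrow> gD_invertible (shift T l)"
      and W: "Weyl UNIV (shift T l)"
    have "pseudo_B_Weyl (shift T l)"
      unfolding pseudo_B_Weyl_def using W Red_UNIV_zero[OF Sl] by blast
    then show "Browder UNIV (shift T l)" using gD W by (intro gD_invertible_imp_Browder[OF Sl]) auto
  next
    fix l
    assume "\<forall>l. Weyl UNIV (shift T l) \<longrightarrow> Browder UNIV (shift T l)"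
      and "pseudo_B_Weyl (shift T l)"
    then show "gD_invertible (shift T l)"
      by (intro pseudo_B_Weyl_imp_invertible[OF Sl])
        (simp_all add: shift_shift Browder_def upper_semi_Browder_def)
  qed
  finally show ?thesis by blast
qed

theorem theorem2p1:
  fixes T :: "'a::complex_banach \<Rightarrow> 'a"
  assumes "T \<in> bounded_operators UNIV"
  shows "(a_Browder_theorem UNIV T \<longleftrightarrow> sigma_gDM T = sigma_gDW_plus T) \<and>
    (a_Browder_theorem cdual (dual_operator T) \<longleftrightarrow> sigma_gDQ T = sigma_gDW_minus T) \<and>
    (Browder_theorem UNIV T \<longleftrightarrow> sigma_gD T = sigma_gDW T)"
proof -
  have "banach_operator UNIV T"
    using assms complete_UNIV complex_vector.subspace_UNIV by (simp add: banach_operator_def)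
  then show ?thesis
    using a_Browder_theorem_iff_spectra a_Browder_theorem_dual_iff_spectra[OF assms]
      Browder_theorem_iff_spectra by blast
qed

end
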